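(* Let $(f,I,\mu)$ be a system as described in the context, with constants $d=d(\mu)\le D=D(\mu)$. Then there exist $\delta_0\in(0,1)$ and, for each $\epsilon\in(0,1)$, a constant $K_\epsilon<\infty$ (depending on $\epsilon$ but not on $\delta$) such that for all $\epsilon\in(0,1)$ and all $\delta\in(0,\delta_0)$, $$\mathbb{E}_\mu \mathcal{B}_\delta^{1-\epsilon}\;\le\; K_\epsilon\,\delta^{-D}\log\left(\frac1\delta\right),$$ where $$K_\epsilon=O\left(\frac{1}{\epsilon^{2+\frac1d}}\right).$$
   Context: Setting. $I\subset\mathbb{R}$ is an interval with a finite partition $\mathcal{P}$ into intervals, and $f:I\to\mathbb{R}$ is a map such that for each $P\in\mathcal{P}$ the restriction $f:P\to I$ is $C^2$, uniformly expanding, and extends continuously to $\overline P$ so that $f:\overline P\to I$ is a diffeomorphism (full branches). For $n\in\mathbb{N}$ let $\mathcal{P}_n=\bigvee_{i=0}^{n-1}f^{-i}\mathcal{P}$, whose elements are called $n$-cylinders, and assume bounded distortion: $\sup_n\sup_{P\in\mathcal{P}_n}\sup_{x,y\in P}|Df^n(x)|/|Df^n(y)|<\infty$. (Boundary points of cylinders have measure zero and are ignored.) $\phi:I\to\mathbb{R}$ is a potential that is Hölder on each $P\in\mathcal{P}$, with $S_n\phi=\sum_{i=0}^{n-1}\phi\circ f^i$ and pressure $P(\phi)=\lim_{n\to\infty}\frac1n\log\sum_{f^nx=x}e^{S_n\phi(x)}$; replacing $\phi$ by $\phi-P(\phi)$ we assume $P(\phi)=0$. $\mu=\mu_\phi$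 is the unique $f$-invariant Gibbs probability measure for $\phi$: there is $0<C<\infty$ with $\frac1C\le \mu(P)/e^{S_n\phi(x)}\le C$ for all $n$, $P\in\mathcal{P}_n$, $x\in P$. The measure $\mu$ is fully supported on $I$. The constants $d,D$ are $$d=\lim_{\delta\to0}\frac{\log\max_{x\in I}\mu(B(x,\delta))}{\log\delta},\qquad D=\lim_{\delta\to0}\frac{\log\min_{x\in I}\mu(B(x,\delta))}{\log\delta}$$ (the limits exist in this setting), where $B(x,\delta)$ is the ball of radius $\delta$ centred at $x$. Blanket time. For $\epsilon,\delta\in(0,1)$, $$\mathcal{B}_\delta^{1-\epsilon}(x)=\min\Big\{N\ge1:\ \forall y\in\mathrm{supp}\,\mu,\ \frac1N\sum_{i=0}^{N-1}\mathbf{1}_{B(y,\delta)}(f^ix)\ge(1-\epsilon)\mu(B(y,\delta))\Big\},$$ and $\mathbb{E}_\mu$ denotes expectation with respect to $\mu$. $a_\epsilon=O(b_\epsilon)$ means that there is a constant $C>0$, independent of $\epsilon$, with $|a_\epsilon|\le C|b_\epsilon|$. *)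

theory Defs
  imports "HOL-Probability.Probability"
begin

text \<open>
  Derivatives are taken within the set, so they are one-sided at endpoints of an interval.
\<close>

primrec Ck_on :: "nat \<Rightarrow> real set \<Rightarrow> (real \<Rightarrow> real) \<Rightarrow> bool" where
  "Ck_on 0 S g \<longleftrightarrow> continuous_on S g"
| "Ck_on (Suc k) S g \<longleftrightarrow>
     (\<exists>g'. (\<forall>x\<in>S. (g has_real_derivative g' x) (at x within S)) \<and> Ck_on k S g')"

definition diffeomorphism_betw :: "(real \<Rightarrow> real) \<Rightarrow> real set \<Rightarrow> real set \<Rightarrow> bool" where
  "diffeomorphism_betw g S T \<longleftrightarrow>
     bij_betw g S T \<and> Ck_on 1 S g \<and> Ck_on 1 T (inv_into S g)"

definition uniformly_expanding_on :: "real set \<Rightarrow> (real \<Rightarrow> real) \<Rightarrow> bool" where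
  "uniformly_expanding_on S g \<longleftrightarrow>
     (\<exists>\<kappa>>1. \<forall>x\<in>S. \<bar>vector_derivative g (at x within S)\<bar> \<ge> \<kappa>)"

text \<open>
  The partition is a genuine one (disjoint, covering all of \<open>I\<close>), so that \<open>f\<close> has a definite value
  at the common endpoints of its branches; \<open>f\<close> itself need not agree with the extended branch
  at those endpoints of an element of the partition that belong to a neighbouring element.
  Since the closure of a branch domain is carried homeomorphically onto \<open>I\<close>, the remaining
  conditions force \<open>I\<close> to be closed.
\<close>

definition full_branch_map :: "real set \<Rightarrow> real set set \<Rightarrow> (real \<Rightarrow> real) \<Rightarrow> bool" where
  "full_branch_map I \<P> f \<longleftrightarrow>
     is_interval I \<and> interior I \<noteq> {} \<and>
     finite \<P> \<and> partition_on I \<P> \<and>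
     (\<forall>P\<in>\<P>. is_interval P \<and> Ck_on 2 P f \<and> uniformly_expanding_on P f \<and>
        (\<exists>g. (\<forall>x\<in>P. g x = f x) \<and> diffeomorphism_betw g (closure P) I))"

definition cylinders :: "real set \<Rightarrow> real set set \<Rightarrow> (real \<Rightarrow> real) \<Rightarrow> nat \<Rightarrow> real set set" where
  "cylinders I \<P> f n =
     {Q. Q \<noteq> {} \<and> (\<exists>w. (\<forall>i<n. w i \<in> \<P>) \<and> Q = {x \<in> I. \<forall>i<n. (f ^^ i) x \<in> w i})}"

definition bounded_distortion :: "real set \<Rightarrow> real set set \<Rightarrow> (real \<Rightarrow> real) \<Rightarrow> bool" where
  "bounded_distortion I \<P> f \<longleftrightarrow>
     (\<exists>L. \<forall>n\<ge>1. \<forall>Q\<in>cylinders I \<P> f n. \<forall>x\<in>Q. \<forall>y\<in>Q.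
        \<bar>vector_derivative (f ^^ n) (at x within Q)\<bar> /
        \<bar>vector_derivative (f ^^ n) (at y within Q)\<bar> \<le> L)"

definition holder_on :: "real set \<Rightarrow> (real \<Rightarrow> real) \<Rightarrow> bool" where
  "holder_on S \<phi> \<longleftrightarrow>
     (\<exists>\<alpha> H. 0 < \<alpha> \<and> \<alpha> \<le> 1 \<and> (\<forall>x\<in>S. \<forall>y\<in>S. \<bar>\<phi> x - \<phi> y\<bar> \<le> H * \<bar>x - y\<bar> powr \<alpha>))"

definition birkhoff_sum :: "(real \<Rightarrow> real) \<Rightarrow> (real \<Rightarrow> real) \<Rightarrow> nat \<Rightarrow> real \<Rightarrow> real" where
  "birkhoff_sum f \<phi> n x = (\<Sum>i<n. \<phi> ((f ^^ i) x))"

text \<open>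
  For a full-branch map an \<open>n\<close>-cylinder contains at most one fixed point of \<open>f ^^ n\<close>, so the sum
  below ranges over a finite set when \<open>n \<ge> 1\<close>.
\<close>

definition has_pressure ::
  "real set \<Rightarrow> (real \<Rightarrow> real) \<Rightarrow> (real \<Rightarrow> real) \<Rightarrow> real \<Rightarrow> bool" where
  "has_pressure I f \<phi> p \<longleftrightarrow>
     (\<lambda>n. 1 / real n * ln (\<Sum>x\<in>{x \<in> I. (f ^^ n) x = x}. exp (birkhoff_sum f \<phi> n x)))
       \<longlonglongrightarrow> p"

text \<open>
  A Borel measure on \<open>I\<close> has \<open>I\<close> as its space, hence balls have to be intersected with
  \<open>space M\<close> before they are measured.
\<close>

definition borel_probability_on :: "real set \<Rightarrow> real measure \<Rightarrow> bool" where
  "borel_probability_on I M \<longleftrightarrow> prob_space M \<and> sets M = sets (restrict_space borel I)"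

definition invariant_measure :: "(real \<Rightarrow> real) \<Rightarrow> real measure \<Rightarrow> bool" where
  "invariant_measure f M \<longleftrightarrow> f \<in> measurable M M \<and> distr M M f = M"

definition gibbs_measure ::
  "real set \<Rightarrow> real set set \<Rightarrow> (real \<Rightarrow> real) \<Rightarrow> (real \<Rightarrow> real) \<Rightarrow> real measure \<Rightarrow> bool" where
  "gibbs_measure I \<P> f \<phi> M \<longleftrightarrow>
     (\<exists>C>0. \<forall>n\<ge>1. \<forall>Q\<in>cylinders I \<P> f n. \<forall>x\<in>Q.
        1 / C \<le> measure M Q / exp (birkhoff_sum f \<phi> n x) \<and>
        measure M Q / exp (birkhoff_sum f \<phi> n x) \<le> C)"

definition ball_measure :: "real measure \<Rightarrow> real \<Rightarrow> real \<Rightarrow> real" where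
  "ball_measure M x \<delta> = measure M (ball x \<delta> \<inter> space M)"

definition supp :: "real measure \<Rightarrow> real set" where
  "supp M = {x \<in> space M. \<forall>r>0. ball_measure M x r > 0}"

text \<open>
  The maximum and minimum over the compact interval are written as supremum and infimum
  (\<^const>\<open>Max\<close> and \<^const>\<open>Min\<close> are meaningful for finite sets only). They are attained for
  the measures considered here, since these have no atoms.
\<close>

definition dim_max_ball :: "real measure \<Rightarrow> real" where
  "dim_max_ball M = Lim (at_right 0) (\<lambda>\<delta>. ln (SUP x\<in>space M. ball_measure M x \<delta>) / ln \<delta>)"

definition dim_min_ball :: "real measure \<Rightarrow> real" where
  "dim_min_ball M = Lim (at_right 0) (\<lambda>\<delta>. ln (INF x\<in>space M. ball_measure M x \<delta>) / ln \<delta>)"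

definition blanketed :: "(real \<Rightarrow> real) \<Rightarrow> real measure \<Rightarrow> real \<Rightarrow> real \<Rightarrow> real \<Rightarrow> nat \<Rightarrow> bool" where
  "blanketed f M \<epsilon> \<delta> x N \<longleftrightarrow>
     (\<forall>y\<in>supp M. 1 / real N * (\<Sum>i<N. indicat_real (ball y \<delta>) ((f ^^ i) x))
                    \<ge> (1 - \<epsilon>) * ball_measure M y \<delta>)"

text \<open>The minimum of the empty set is \<open>\<infinity>\<close>.\<close>

definition blanket_time :: "(real \<Rightarrow> real) \<Rightarrow> real measure \<Rightarrow> real \<Rightarrow> real \<Rightarrow> real \<Rightarrow> ennreal" where
  "blanket_time f M \<epsilon> \<delta> x =
     (if \<exists>N\<ge>1. blanketed f M \<epsilon> \<delta> x N
      then of_nat (LEAST N. 1 \<le> N \<and> blanketed f M \<epsilon> \<delta> x N)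
      else \<infinity>)"

end

theory Submission
  imports Defs
begin

text \<open>
  Up to time \<open>N\<close> the orbit of \<open>x\<close> has failed to be blanketed only if, for some ball, it has
  visited the ball fewer than \<open>1 - \<epsilon>\<close> times as often as expected. Moving centres to a grid
  leaves finitely many slightly smaller balls \<open>A\<close>; their number is at most a constant times a
  fixed power of \<open>1 / (\<delta> * \<epsilon>)\<close>. If the event of too few visits to \<open>A\<close> has measure at most
  \<open>C * exp (- c \<epsilon> * \<mu> A * N)\<close>, a union bound and summation over \<open>N\<close> give a mean blanket time
  of order \<open>ln (number of balls) / (c \<epsilon> * min \<mu> A)\<close>. This is the claim once \<open>min \<mu> A\<close> is known
  to be at least a constant times \<open>\<delta> powr D\<close> and \<open>c \<epsilon>\<close> to be of order
  \<open>\<epsilon>\<^sup>2 / (1 + ln (1 / \<epsilon>))\<^sup>2\<close>: as a function of \<open>\<epsilon>\<close> the bound is then the cube of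
  \<open>1 + ln (1 / \<epsilon>)\<close> over \<open>\<epsilon>\<^sup>2\<close>, and since \<open>0 < d\<close> the logarithms are absorbed by
  \<open>\<epsilon> powr (- 1 / d)\<close> (\<open>log_cube_le_power\<close>).

  The deviation estimate \<open>lower_deviation_ball\<close> must not lose a factor for the dependence
  between successive visits. The Gibbs property makes the inverse branches a Markov chain
  whose operator \<open>T\<close> is dual to composition with \<open>f\<close>, so the mean of the product of
  \<open>1 - r * u (f\<^sup>i x)\<close>, with \<open>u\<close> the indicator of \<open>A\<close>, is up to a constant an iterate of the
  operator sending \<open>g\<close> to \<open>T ((1 - r * u) * g)\<close>. For this operator \<open>1 - t * (\<Sum>n=1..n0. T\<^sup>n u)\<close>
  is an explicit subeigenfunction (\<open>killed_iterate\<close>). The rate it yields depends on the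
  dynamics only through a bound for \<open>\<Sum>n=1..n0. T\<^sup>n u\<close>, the expected number of visits to \<open>A\<close> in
  \<open>n0\<close> backward steps, and this sum is at most a constant times \<open>n0 * \<mu> A + 1\<close>: an interval
  cuts at most two cylinders of each level, so that \<open>T\<^sup>n u\<close> is at most a constant times
  \<open>\<mu> A + 2 * \<theta>\<^sup>n\<close>. The length \<open>n0\<close> has to be such that \<open>T\<^sup>n u\<close> is within a factor \<open>1 - \<epsilon> / 4\<close>
  of \<open>\<mu> A\<close> for \<open>n > n0\<close>, which is provided by Doeblin's argument (\<open>quantitative_mixing\<close>).

  The chain is built from the potential alone (\<open>normalised_weights\<close>): its weights are \<open>exp \<phi>\<close>
  times a coboundary formed with a positive fixed point of the transfer operator. That its
  invariant law is the given measure is a consequence of the deviation estimate itself,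
  applied to a set and to its complement (\<open>equilibrium_eq_measure\<close>), since the mean frequency
  of visits to a set is its measure.

  The two dimensions exist, and the minimal measure of a \<open>\<delta>\<close>-ball is at least a constant times
  \<open>\<delta> powr D\<close>, because bounded distortion makes the minimal and the maximal measure of a ball
  submultiplicative in the radius up to constants (\<open>min_ball_submultiplicative\<close>,
  \<open>max_ball_submultiplicative\<close>), and Fekete's lemma applies to their logarithms.
\<close>

section \<open>Superadditive functions\<close>

text \<open>
  Fekete's lemma with an additive error \<open>C\<close> and a shift \<open>c\<close> of the argument. The function
  \<open>b (\<tau> - c) - C\<close> is exactly superadditive, so its quotient by \<open>\<tau>\<close> converges to its supremum.
  That the limit is a supremum gives the second conclusion, an upper bound at every \<open>t\<close> with
  uniform constants, and not just to leading order.
\<close>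

lemma superadditive_limit:
  fixes b :: "real \<Rightarrow> real"
  assumes mono: "\<And>s t. t0 \<le> s \<Longrightarrow> s \<le> t \<Longrightarrow> b s \<le> b t"
    and super: "\<And>s t. t0 \<le> s \<Longrightarrow> t0 \<le> t \<Longrightarrow> b s + b t - C \<le> b (s + t + c)"
    and lin: "\<And>t. t0 \<le> t \<Longrightarrow> b t \<le> A * t + A'"
    and "0 < t0" "0 \<le> c"
  shows "\<exists>L. ((\<lambda>t. b t / t) \<longlongrightarrow> L) at_top \<and> (\<forall>t\<ge>t0. b t \<le> L * (t + c) + C)"
proof -
  define t1 where "t1 = t0 + c"
  define E where "E \<tau> = b (\<tau> - c) - C" for \<tau>
  have t1: "0 < t1" using assms by (simp add: t1_def)
  have Emono: "E s \<le> E t" if "t1 \<le> s" "s \<le> t" for s t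
    using mono[of "s - c" "t - c"] that by (simp add: E_def t1_def)
  have Esup: "E s + E t \<le> E (s + t)" if "t1 \<le> s" "t1 \<le> t" for s t
    using super[of "s - c" "t - c"] that by (simp add: E_def t1_def)
  have Emult: "real n * E \<tau> + E r \<le> E (real n * \<tau> + r)" if "t1 \<le> \<tau>" "t1 \<le> r" for n \<tau> r
  proof (induction n)
    case (Suc n)
    have "0 \<le> real n * \<tau>" using that t1 by simp
    hence "t1 \<le> real n * \<tau> + r" using that by linarith
    hence "E \<tau> + E (real n * \<tau> + r) \<le> E (\<tau> + (real n * \<tau> + r))" using that by (intro Esup)
    thus ?case using Suc by (simp add: algebra_simps)
  qed auto
  define U where "U = \<bar>A\<bar> + (\<bar>A * c\<bar> + \<bar>A'\<bar> + \<bar>C\<bar>) / t1"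
  have EU: "E \<tau> / \<tau> \<le> U" if "t1 \<le> \<tau>" for \<tau>
  proof -
    have "E \<tau> \<le> A * (\<tau> - c) + A' - C" using lin[of "\<tau> - c"] that by (simp add: E_def t1_def)
    also have "\<dots> \<le> \<bar>A\<bar> * \<tau> + (\<bar>A * c\<bar> + \<bar>A'\<bar> + \<bar>C\<bar>)"
    proof -
      have "A * \<tau> \<le> \<bar>A\<bar> * \<tau>" using that t1 by (intro mult_right_mono) auto
      thus ?thesis by (simp add: right_diff_distrib)
    qed
    also have "\<dots> \<le> \<bar>A\<bar> * \<tau> + (\<bar>A * c\<bar> + \<bar>A'\<bar> + \<bar>C\<bar>) / t1 * \<tau>"
      using that t1 mult_left_mono[of t1 \<tau> "(\<bar>A * c\<bar> + \<bar>A'\<bar> + \<bar>C\<bar>) / t1"] by simp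
    finally show ?thesis using that t1 by (simp add: U_def field_simps)
  qed
  define L where "L = (SUP \<tau>\<in>{t1..}. E \<tau> / \<tau>)"
  have bdd: "bdd_above ((\<lambda>\<tau>. E \<tau> / \<tau>) ` {t1..})" using EU by (auto intro!: bdd_aboveI)
  have upL: "E \<tau> / \<tau> \<le> L" if "t1 \<le> \<tau>" for \<tau>
    unfolding L_def using bdd that by (intro cSUP_upper) auto
  have lim: "((\<lambda>\<tau>. E \<tau> / \<tau>) \<longlongrightarrow> L) at_top"
  proof (rule tendstoI)
    fix e :: real assume e: "0 < e"
    have "\<exists>\<tau>\<in>{t1..}. L - e / 2 < E \<tau> / \<tau>"
      using e bdd unfolding L_def by (subst less_cSUP_iff[symmetric]) auto
    then obtain \<tau> where \<tau>: "t1 \<le> \<tau>" "L - e / 2 < E \<tau> / \<tau>" by auto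
    have \<tau>0: "0 < \<tau>" using \<tau> t1 by simp
    have "eventually (\<lambda>T. T \<ge> 2 * \<tau> \<and> T \<ge> t1 \<and> T > 2 * \<bar>E \<tau>\<bar> / e) at_top"
      by (intro eventually_conj eventually_ge_at_top eventually_gt_at_top)
    thus "eventually (\<lambda>T. dist (E T / T) L < e) at_top"
    proof eventually_elim
      case (elim T)
      define n where "n = nat \<lfloor>T / \<tau>\<rfloor> - 1"
      have "2 \<le> T / \<tau>" using elim \<tau>0 by (simp add: field_simps)
      hence "2 \<le> \<lfloor>T / \<tau>\<rfloor>" by linarith
      hence "int n + 1 = \<lfloor>T / \<tau>\<rfloor>" unfolding n_def by linarith
      hence n: "real n + 1 = of_int \<lfloor>T / \<tau>\<rfloor>"
        by (metis of_int_1 of_int_add of_int_of_nat_eq)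
      have n1: "real n + 1 \<le> T / \<tau>" and n2: "T / \<tau> < real n + 2" using n by linarith+
      define r where "r = T - real n * \<tau>"
      have "(real n + 1) * \<tau> \<le> T" using n1 \<tau>0 by (simp add: field_simps)
      hence r: "\<tau> \<le> r" by (simp add: r_def algebra_simps)
      have "E T = E (real n * \<tau> + r)" by (simp add: r_def)
      also have "\<dots> \<ge> real n * E \<tau> + E r" using Emult \<tau> r by simp
      finally have "E T \<ge> (real n + 1) * E \<tau>" using Emono[of \<tau> r] \<tau> r by (simp add: algebra_simps)
      moreover have "\<bar>(T / \<tau> - (real n + 1)) * E \<tau>\<bar> \<le> 1 * \<bar>E \<tau>\<bar>"
        unfolding abs_mult using n1 n2 by (intro mult_right_mono) auto
      ultimately have ge: "E T \<ge> T / \<tau> * E \<tau> - \<bar>E \<tau>\<bar>" by (simp add: algebra_simps)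
      have T0: "0 < T" using elim \<tau>0 by simp
      have "E T / T \<ge> (T / \<tau> * E \<tau> - \<bar>E \<tau>\<bar>) / T" using ge T0 by (intro divide_right_mono) auto
      also have "(T / \<tau> * E \<tau> - \<bar>E \<tau>\<bar>) / T = E \<tau> / \<tau> - \<bar>E \<tau>\<bar> / T" using T0 by (simp add: field_simps)
      finally have 1: "E T / T \<ge> E \<tau> / \<tau> - \<bar>E \<tau>\<bar> / T" .
      have "\<bar>E \<tau>\<bar> / T < e / 2" using elim T0 e by (simp add: field_simps)
      with 1 \<tau>(2) upL[of T] elim show ?case by (simp add: dist_real_def)
    qed
  qed
  have s1: "filterlim (\<lambda>t. t + c) at_top (at_top::real filter)"
    by (rule filterlim_tendsto_add_at_top[of "\<lambda>_. c" c _ "\<lambda>t. t", unfolded add.commute[of c]])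
       (auto simp: filterlim_ident)
  have "((\<lambda>t. E (t + c) / (t + c) * (1 + c / t) + C / t) \<longlongrightarrow> L * (1 + 0) + 0) at_top"
    by (intro tendsto_intros filterlim_compose[OF lim s1] tendsto_divide_0[OF tendsto_const]
        filterlim_at_top_imp_at_infinity filterlim_ident)
  moreover have "eventually (\<lambda>t. E (t + c) / (t + c) * (1 + c / t) + C / t = b t / t) at_top"
    using eventually_gt_at_top[of 0]
  proof eventually_elim
    case (elim t)
    hence "t + c \<noteq> 0" "t \<noteq> 0" using assms by auto
    moreover from this have "1 + c / t = (t + c) / t" by (simp add: field_simps)
    ultimately have "E (t + c) / (t + c) * (1 + c / t) = E (t + c) / t" by simp
    thus ?case by (simp add: E_def diff_divide_distrib)
  qed
  ultimately have "((\<lambda>t. b t / t) \<longlongrightarrow> L) at_top" by (subst (asm) tendsto_cong) auto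
  moreover have "b t \<le> L * (t + c) + C" if "t0 \<le> t" for t
  proof -
    have p: "0 < t + c" using that assms by linarith
    have "E (t + c) / (t + c) \<le> L" using that by (intro upL) (simp add: t1_def)
    thus ?thesis using p by (simp add: E_def field_simps)
  qed
  ultimately show ?thesis by blast
qed

section \<open>Words and transfer operators\<close>

definition words :: "'p set \<Rightarrow> nat \<Rightarrow> 'p list set" where
  "words A n = {w. set w \<subseteq> A \<and> length w = n}"

lemma words_0 [simp]: "words A 0 = {[]}"
  by (auto simp: words_def)

lemma words_Suc: "words A (Suc n) = (\<lambda>(a, w). a # w) ` (A \<times> words A n)"
  by (auto simp: words_def length_Suc_conv image_iff)

lemma finite_words [simp]: "finite A \<Longrightarrow> finite (words A n)"
  unfolding words_def by (rule finite_lists_length_eq)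

lemma sum_words_Suc: "(\<Sum>w\<in>words A (Suc n). F w) = (\<Sum>a\<in>A. \<Sum>w\<in>words A n. F (a # w))"
  unfolding words_Suc
  by (subst sum.reindex) (auto simp: inj_on_def sum.cartesian_product split_def)

lemma words_append: "v \<in> words A k \<Longrightarrow> w \<in> words A n \<Longrightarrow> v @ w \<in> words A (k + n)"
  by (auto simp: words_def)

lemma words_split:
  assumes "w \<in> words A (k + n)"
  obtains u v where "u \<in> words A k" "v \<in> words A n" "w = u @ v"
proof -
  have "take k w \<in> words A k" "drop k w \<in> words A n" "w = take k w @ drop k w"
    using assms by (auto simp: words_def dest: in_set_takeD in_set_dropD)
  thus ?thesis using that by blast
qed

text \<open>
  The last letter of the word acts first, so that the map \<open>f\<close> with \<open>f (s a x) = x\<close> removes the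
  first letter.
\<close>

fun branch :: "('p \<Rightarrow> 'a \<Rightarrow> 'a) \<Rightarrow> 'p list \<Rightarrow> 'a \<Rightarrow> 'a" where
  "branch s [] x = x"
| "branch s (a # w) x = s a (branch s w x)"

lemma branch_append: "branch s (v @ w) x = branch s v (branch s w x)"
  by (induction v) auto

locale branches =
  fixes X :: "'a set" and A :: "'p set" and s :: "'p \<Rightarrow> 'a \<Rightarrow> 'a"
  assumes finA: "finite A" and Xne: "X \<noteq> {}"
    and sX: "a \<in> A \<Longrightarrow> x \<in> X \<Longrightarrow> s a x \<in> X"
begin

lemma branch_in: "w \<in> words A n \<Longrightarrow> x \<in> X \<Longrightarrow> branch s w x \<in> X"
  unfolding words_def by (induction w arbitrary: n) (auto intro: sX)

text \<open>
  When \<open>p a x\<close> is \<open>exp (\<phi> (s a x))\<close>, this is the exponential of a Birkhoff sum of \<open>\<phi>\<close> along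
  the backward orbit of \<open>x\<close> prescribed by the word.
\<close>

fun weight :: "('p \<Rightarrow> 'a \<Rightarrow> real) \<Rightarrow> 'p list \<Rightarrow> 'a \<Rightarrow> real" where
  "weight p [] x = 1"
| "weight p (a # w) x = p a (branch s w x) * weight p w x"

definition transfer :: "('p \<Rightarrow> 'a \<Rightarrow> real) \<Rightarrow> ('a \<Rightarrow> real) \<Rightarrow> 'a \<Rightarrow> real" where
  "transfer p g x = (\<Sum>a\<in>A. p a x * g (s a x))"

lemma transfer_pow: "(transfer p ^^ n) g x = (\<Sum>w\<in>words A n. weight p w x * g (branch s w x))"
proof (induction n arbitrary: g)
  case (Suc n)
  have "(transfer p ^^ Suc n) g x = (transfer p ^^ n) (transfer p g) x"
    by (simp only: funpow_Suc_right o_def)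
  also have "\<dots> = (\<Sum>w\<in>words A n. \<Sum>a\<in>A. weight p (a # w) x * g (branch s (a # w) x))"
    by (simp add: Suc transfer_def sum_distrib_left mult_ac)
  also have "\<dots> = (\<Sum>w\<in>words A (Suc n). weight p w x * g (branch s w x))"
    unfolding sum_words_Suc by (rule sum.swap)
  finally show ?case .
qed simp

lemma transfer_pow_cong:
  "(\<And>y. y \<in> X \<Longrightarrow> g y = g' y) \<Longrightarrow> x \<in> X \<Longrightarrow> (transfer p ^^ n) g x = (transfer p ^^ n) g' x"
  unfolding transfer_pow by (intro sum.cong refl) (auto simp: branch_in)

end

section \<open>Mixing of normalised transfer operators\<close>

text \<open>
  The abstract form of a Gibbs measure with a Hoelder potential. Since the weights of the
  letters add up to one, \<open>T\<close> is the operator of a Markov chain that follows inverse branches.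
  The constant \<open>B\<close> bounds the influence of the starting point on the probability of a word;
  the next assumption says that this influence dies out exponentially with the number of
  letters that the starting points share.
\<close>

locale markov_branches = branches X A s
  for X :: "'a set" and A :: "'p set" and s +
  fixes p :: "'p \<Rightarrow> 'a \<Rightarrow> real" and B K \<theta> :: real
  assumes p_nonneg: "a \<in> A \<Longrightarrow> x \<in> X \<Longrightarrow> 0 \<le> p a x"
    and p_sum: "x \<in> X \<Longrightarrow> (\<Sum>a\<in>A. p a x) = 1"
    and weight_comparable: "w \<in> words A n \<Longrightarrow> x \<in> X \<Longrightarrow> y \<in> X \<Longrightarrow> weight p w x \<le> B * weight p w y"
    and weight_regular: "v \<in> words A k \<Longrightarrow> w \<in> words A n \<Longrightarrow> x \<in> X \<Longrightarrow> y \<in> X \<Longrightarrow>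
       weight p v (branch s w x) \<le> exp (K * \<theta> ^ n) * weight p v (branch s w y)"
    and K_nonneg: "0 \<le> K" and \<theta>: "0 < \<theta>" "\<theta> < 1" and B1: "1 \<le> B"
begin

abbreviation T where "T \<equiv> transfer p"

lemma weight_nonneg: "w \<in> words A n \<Longrightarrow> x \<in> X \<Longrightarrow> 0 \<le> weight p w x"
proof (induction w arbitrary: n)
  case (Cons a w)
  hence "a \<in> A" "w \<in> words A (length w)" by (auto simp: words_def)
  thus ?case using Cons.IH[of "length w"] Cons.prems branch_in by (auto intro!: mult_nonneg_nonneg p_nonneg)
qed auto

lemma T_pow_mono:
  assumes "\<And>y. y \<in> X \<Longrightarrow> g y \<le> g' y" "x \<in> X"
  shows "(T ^^ n) g x \<le> (T ^^ n) g' x"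
  unfolding transfer_pow using assms
  by (intro sum_mono mult_left_mono) (auto simp: weight_nonneg branch_in)

lemma T_mono: "(\<And>y. y \<in> X \<Longrightarrow> g y \<le> g' y) \<Longrightarrow> x \<in> X \<Longrightarrow> T g x \<le> T g' x"
  using T_pow_mono[of g g' x 1] by simp

lemma T_cmult: "T (\<lambda>y. c * g y) x = c * T g x"
  by (simp add: transfer_def sum_distrib_left mult_ac)

lemma T_diff: "T (\<lambda>y. g y - h y) x = T g x - T h x"
  by (simp add: transfer_def sum_subtractf right_diff_distrib)

lemma T_sum: "T (\<lambda>y. \<Sum>i\<in>J. g i y) x = (\<Sum>i\<in>J. T (g i) x)"
  unfolding transfer_def sum_distrib_left by (rule sum.swap)

lemma T_const: "x \<in> X \<Longrightarrow> T (\<lambda>_. c) x = c"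
  by (simp add: transfer_def p_sum flip: sum_distrib_right)

lemma T_pow_const: "x \<in> X \<Longrightarrow> (T ^^ n) (\<lambda>_. c) x = c"
proof (induction n arbitrary: x)
  case (Suc n)
  have "(T ^^ Suc n) (\<lambda>_. c) x = T ((T ^^ n) (\<lambda>_. c)) x" by simp
  also have "\<dots> = T (\<lambda>_. c) x"
    using transfer_pow_cong[of "(T ^^ n) (\<lambda>_. c)" "\<lambda>_. c" x 1 p] Suc by simp
  finally show ?case using Suc T_const by simp
qed simp

lemma weight_sum: "x \<in> X \<Longrightarrow> (\<Sum>w\<in>words A n. weight p w x) = 1"
  using T_pow_const[of x n 1] by (simp add: transfer_pow)

lemma T_pow_bounds:
  assumes "\<And>y. y \<in> X \<Longrightarrow> lo \<le> g y" "\<And>y. y \<in> X \<Longrightarrow> g y \<le> hi" "x \<in> X"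
  shows "lo \<le> (T ^^ n) g x" "(T ^^ n) g x \<le> hi"
  using T_pow_mono[of "\<lambda>_. lo" g x n] T_pow_mono[of g "\<lambda>_. hi" x n] assms
  by (auto simp: T_pow_const)

text \<open>
  If \<open>u\<close> depends on the first \<open>m\<close> letters only, then \<open>(T ^^ n) u\<close> for \<open>m \<le> n\<close> is a combination
  of weights of words with constant coefficients and inherits both estimates on weights. The
  class increases with \<open>m\<close>, so these estimates hold for all later iterates with the same
  constants.
\<close>

definition cylinder_function :: "nat \<Rightarrow> ('a \<Rightarrow> real) \<Rightarrow> bool" where
  "cylinder_function m u \<longleftrightarrow>
     (\<forall>x\<in>X. 0 \<le> u x \<and> u x \<le> 1) \<and>
     (\<forall>w\<in>words A m. \<forall>x\<in>X. \<forall>y\<in>X. u (branch s w x) = u (branch s w y))"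

lemma cylinder_functionD:
  assumes "cylinder_function m u"
  shows "x \<in> X \<Longrightarrow> 0 \<le> u x" "x \<in> X \<Longrightarrow> u x \<le> 1"
    "w \<in> words A m \<Longrightarrow> x \<in> X \<Longrightarrow> y \<in> X \<Longrightarrow> u (branch s w x) = u (branch s w y)"
  using assms unfolding cylinder_function_def by blast+

lemma cylinder_function_mono:
  assumes "cylinder_function m u" "m \<le> n"
  shows "cylinder_function n u"
  unfolding cylinder_function_def
proof (intro conjI ballI)
  fix w x y assume w: "w \<in> words A n" and xy: "x \<in> X" "y \<in> X"
  from w assms(2) have "w \<in> words A (m + (n - m))" by simp
  then obtain a b where ab: "a \<in> words A m" "b \<in> words A (n - m)" "w = a @ b" by (rule words_split)
  show "u (branch s w x) = u (branch s w y)"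
    unfolding ab(3) branch_append
    by (intro cylinder_functionD(3)[OF assms(1) ab(1)] branch_in[OF ab(2)] xy)
qed (use assms in \<open>auto simp: cylinder_function_def\<close>)

lemma iterate_comparable:
  assumes "cylinder_function m u" "m \<le> n" "x \<in> X" "y \<in> X"
  shows "(T ^^ n) u x \<le> B * (T ^^ n) u y"
proof -
  note c = cylinder_function_mono[OF assms(1,2)]
  have "weight p w x * u (branch s w x) \<le> B * (weight p w y * u (branch s w y))"
    if w: "w \<in> words A n" for w
  proof -
    have "u (branch s w x) = u (branch s w y)" "0 \<le> u (branch s w y)"
      by (rule cylinder_functionD(3)[OF c w assms(3,4)], rule cylinder_functionD(1)[OF c branch_in[OF w assms(4)]])
    thus ?thesis using mult_right_mono[OF weight_comparable[OF w assms(3,4)], of "u (branch s w y)"]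
      by (simp add: mult_ac)
  qed
  thus ?thesis unfolding transfer_pow sum_distrib_left by (rule sum_mono)
qed

lemma iterate_regular:
  assumes "cylinder_function m u" "m \<le> n" "x \<in> X" "y \<in> X" "v \<in> words A j"
  shows "(T ^^ n) u (branch s v x) \<le> exp (K * \<theta> ^ j) * (T ^^ n) u (branch s v y)"
proof -
  note c = cylinder_function_mono[OF assms(1,2)]
  have "weight p w (branch s v x) * u (branch s w (branch s v x))
      \<le> exp (K * \<theta> ^ j) * (weight p w (branch s v y) * u (branch s w (branch s v y)))"
    if w: "w \<in> words A n" for w
  proof -
    have b: "branch s v x \<in> X" "branch s v y \<in> X" using assms branch_in by blast+
    have "u (branch s w (branch s v x)) = u (branch s w (branch s v y))"
       "0 \<le> u (branch s w (branch s v y))"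
      by (rule cylinder_functionD(3)[OF c w b], rule cylinder_functionD(1)[OF c branch_in[OF w b(2)]])
    thus ?thesis
      using mult_right_mono[OF weight_regular[OF w assms(5,3,4)], of "u (branch s w (branch s v y))"]
      by (simp add: mult_ac)
  qed
  thus ?thesis unfolding transfer_pow sum_distrib_left by (rule sum_mono)
qed

text \<open>
  Doeblin's argument. The distributions of a word of length \<open>j\<close> seen from \<open>x\<close> and from \<open>y\<close>
  have the part \<open>weight p v y / B\<close> in common, so only the proportion \<open>1 - 1 / B\<close> of the
  oscillation can survive; evaluating at \<open>branch s v y\<close> in place of \<open>branch s v x\<close> costs the
  second term.
\<close>

lemma oscillation_step:
  assumes u: "cylinder_function m u" "m \<le> n"
    and osc: "\<And>x y. x \<in> X \<Longrightarrow> y \<in> X \<Longrightarrow> (T ^^ n) u x - (T ^^ n) u y \<le> \<Delta>"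
    and H: "\<And>x. x \<in> X \<Longrightarrow> (T ^^ n) u x \<le> H"
    and x: "x \<in> X" and y: "y \<in> X"
  shows "(T ^^ (j + n)) u x - (T ^^ (j + n)) u y \<le> (1 - 1 / B) * \<Delta> + (exp (K * \<theta> ^ j) - 1) * H"
proof -
  define U where "U = (T ^^ n) u"
  define e where "e = exp (K * \<theta> ^ j) - 1"
  have e0: "0 \<le> e" unfolding e_def using K_nonneg \<theta> by simp
  have eq: "(T ^^ (j + n)) u z = (\<Sum>v\<in>words A j. weight p v z * U (branch s v z))" for z
    unfolding U_def transfer_pow[symmetric] by (simp add: funpow_add)
  define Y where "Y = (\<Sum>v\<in>words A j. weight p v y * U (branch s v y))"
  have UX: "U (branch s v x) \<le> U (branch s v y) + e * H" if "v \<in> words A j" for v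
  proof -
    have "U (branch s v x) \<le> exp (K * \<theta> ^ j) * U (branch s v y)"
      unfolding U_def using iterate_regular[OF u x y that] .
    also have "\<dots> = U (branch s v y) + e * U (branch s v y)" by (simp add: e_def algebra_simps)
    also have "e * U (branch s v y) \<le> e * H"
      unfolding U_def using H branch_in[OF that y] e0 by (intro mult_left_mono) auto
    finally show ?thesis by simp
  qed
  have UY: "U (branch s v y) \<le> \<Delta> + Y" if v: "v \<in> words A j" for v
  proof -
    have "U (branch s v y) - \<Delta> = (\<Sum>v'\<in>words A j. weight p v' y * (U (branch s v y) - \<Delta>))"
      using weight_sum[OF y, of j] by (simp flip: sum_distrib_right)
    also have "\<dots> \<le> Y" unfolding Y_def
    proof (intro sum_mono mult_left_mono)
      fix v' assume v': "v' \<in> words A j"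
      show "U (branch s v y) - \<Delta> \<le> U (branch s v' y)"
        using osc[OF branch_in[OF v y] branch_in[OF v' y]] by (simp add: U_def)
    qed (use weight_nonneg y in auto)
    finally show ?thesis by simp
  qed
  have "(\<Sum>v\<in>words A j. weight p v x * U (branch s v x))
      \<le> (\<Sum>v\<in>words A j. weight p v x * (U (branch s v y) + e * H))"
    using UX weight_nonneg x by (intro sum_mono mult_left_mono) auto
  also have "\<dots> = (\<Sum>v\<in>words A j. weight p v x * U (branch s v y)) + e * H"
    using weight_sum[OF x, of j] by (simp add: distrib_left sum.distrib flip: sum_distrib_right)
  \<comment> \<open>The common part contributes \<open>Y / B\<close>.\<close>
  also have "(\<Sum>v\<in>words A j. weight p v x * U (branch s v y)) =
      (\<Sum>v\<in>words A j. (weight p v x - weight p v y / B) * U (branch s v y)) + Y / B"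
    by (simp add: Y_def left_diff_distrib sum_subtractf sum_divide_distrib)
  also have "(\<Sum>v\<in>words A j. (weight p v x - weight p v y / B) * U (branch s v y))
      \<le> (\<Sum>v\<in>words A j. (weight p v x - weight p v y / B) * (\<Delta> + Y))"
  proof (intro sum_mono mult_left_mono)
    fix v assume v: "v \<in> words A j"
    show "0 \<le> weight p v x - weight p v y / B"
      using weight_comparable[OF v y x] B1 by (simp add: field_simps)
  qed (use UY in auto)
  also have "\<dots> = (1 - 1 / B) * (\<Delta> + Y)"
    using weight_sum[OF x, of j] weight_sum[OF y, of j]
    by (simp add: sum_subtractf flip: sum_distrib_right sum_divide_distrib)
  finally show ?thesis unfolding eq using Y_def by (simp add: e_def algebra_simps)
qed

text \<open>
  The contraction acts on the previous oscillation only, while the error \<open>exp (K * \<theta> ^ j) - 1\<close>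
  reappears in every step. Precision \<open>\<eta>\<close> therefore takes \<open>i\<close> steps of \<open>j\<close> letters with both
  numbers of order \<open>ln (1 / \<eta>)\<close>, whence the square of the logarithm in the mixing time.
\<close>

lemma oscillation_iterate:
  assumes u: "cylinder_function m u"
    and H: "\<And>x. x \<in> X \<Longrightarrow> (T ^^ m) u x \<le> H"
    and x: "x \<in> X" and y: "y \<in> X"
  shows "(T ^^ (i * j + m)) u x - (T ^^ (i * j + m)) u y
     \<le> ((1 - 1 / B) ^ i + B * (exp (K * \<theta> ^ j) - 1)) * H"
  using x y
proof (induction i arbitrary: x y)
  case 0
  define e where "e = exp (K * \<theta> ^ j) - 1"
  have e0: "0 \<le> e" unfolding e_def using K_nonneg \<theta> by simp
  have "0 \<le> (T ^^ m) u y" 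
    using cylinder_functionD[OF u] 0 by (intro T_pow_bounds(1)[of 0 u 1]) auto
  moreover have "0 \<le> H" using H[OF 0(2)] calculation by simp
  ultimately have "(T ^^ m) u x - (T ^^ m) u y \<le> 1 * H" using H[OF 0(1)] by simp
  also have "1 * H \<le> (1 + B * e) * H" using \<open>0 \<le> H\<close> e0 B1 by (intro mult_right_mono) auto
  finally show ?case by (simp add: e_def)
next
  case (Suc i)
  define \<beta> where "\<beta> = 1 - 1 / B"
  define e where "e = exp (K * \<theta> ^ j) - 1"
  have HH: "(T ^^ (i * j + m)) u z \<le> H" if "z \<in> X" for z
  proof -
    have "(T ^^ (i * j)) ((T ^^ m) u) z \<le> (T ^^ (i * j)) (\<lambda>_. H) z"
      using H that by (intro T_pow_mono)
    thus ?thesis using that by (simp add: funpow_add T_pow_const)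
  qed
  have "(T ^^ (j + (i * j + m))) u x - (T ^^ (j + (i * j + m))) u y
     \<le> \<beta> * ((\<beta> ^ i + B * e) * H) + e * H"
    unfolding \<beta>_def e_def
    by (rule oscillation_step[OF u _ Suc.IH HH Suc.prems]) simp_all
  also have "\<dots> = (\<beta> ^ Suc i + B * e) * H" using B1 by (simp add: \<beta>_def field_simps)
  finally show ?case by (simp add: \<beta>_def e_def add.assoc)
qed

text \<open>
  All values of \<open>(T ^^ m) u\<close> are within a factor \<open>B\<close> of each other, which turns the absolute
  error into a relative one. The bounds persist under further iterations because \<open>T\<close> averages.
\<close>

lemma ratio_mixing:
  assumes u: "cylinder_function m u" and n: "m + i * j \<le> n"
    and x: "x \<in> X" and y: "y \<in> X"
  shows "(T ^^ n) u x \<le> (1 + B\<^sup>2 * ((1 - 1 / B) ^ i + B * (exp (K * \<theta> ^ j) - 1))) * (T ^^ n) u y"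
proof -
  \<comment> \<open>\<open>H\<close> bounds \<open>(T ^^ m) u\<close> from above and is at most \<open>B\<^sup>2\<close> times its infimum, so the
      relative error is \<open>B\<^sup>2 * E\<close>.\<close>
  define E where "E = (1 - 1 / B) ^ i + B * (exp (K * \<theta> ^ j) - 1)"
  obtain x0 where x0: "x0 \<in> X" using Xne by auto
  define H where "H = B * (T ^^ m) u x0"
  have E0: "0 \<le> E" unfolding E_def using B1 K_nonneg \<theta> by (intro add_nonneg_nonneg mult_nonneg_nonneg zero_le_power) auto
  have H: "(T ^^ m) u z \<le> H" if "z \<in> X" for z
    unfolding H_def by (rule iterate_comparable[OF u order_refl that x0])
  have Hl: "H / B\<^sup>2 \<le> (T ^^ m) u z" if "z \<in> X" for z
    using iterate_comparable[OF u order_refl x0 that] B1 by (simp add: H_def field_simps power2_eq_square)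
  have Hl2: "H \<le> B\<^sup>2 * (T ^^ (i * j + m)) u z" if "z \<in> X" for z
  proof -
    have "(T ^^ (i * j)) (\<lambda>_. H / B\<^sup>2) z \<le> (T ^^ (i * j)) ((T ^^ m) u) z"
      using Hl that by (intro T_pow_mono)
    hence "H / B\<^sup>2 \<le> (T ^^ (i * j + m)) u z"
      unfolding funpow_add o_apply using that by (simp only: T_pow_const)
    thus ?thesis using B1 by (simp add: field_simps)
  qed
  have r: "(T ^^ (i * j + m)) u z \<le> (1 + B\<^sup>2 * E) * (T ^^ (i * j + m)) u z'" if "z \<in> X" "z' \<in> X" for z z'
  proof -
    have "(T ^^ (i * j + m)) u z \<le> (T ^^ (i * j + m)) u z' + E * H"
      using oscillation_iterate[OF u H that, of i j] by (simp add: E_def)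
    also have "E * H \<le> E * (B\<^sup>2 * (T ^^ (i * j + m)) u z')" using Hl2[OF that(2)] E0 by (intro mult_left_mono)
    finally show ?thesis by (simp add: algebra_simps)
  qed
  define k where "k = n - (i * j + m)"
  have n: "n = k + (i * j + m)" using n by (simp add: k_def)
  define V where "V = (T ^^ (i * j + m)) u"
  have split: "(T ^^ n) u z = (T ^^ k) V z" for z unfolding n V_def by (simp only: funpow_add o_def)
  have "(T ^^ n) u x \<le> (1 + B\<^sup>2 * E) * V z'" if "z' \<in> X" for z'
    unfolding split
  proof (rule T_pow_bounds(2)[of 0])
    fix z assume z: "z \<in> X"
    show "0 \<le> V z" unfolding V_def using cylinder_functionD[OF u] z by (intro T_pow_bounds(1)[of 0 u 1]) auto
    show "V z \<le> (1 + B\<^sup>2 * E) * V z'" unfolding V_def using r[OF z that] .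
  qed (fact x)
  hence "(T ^^ n) u x / (1 + B\<^sup>2 * E) \<le> V z'" if "z' \<in> X" for z'
    using that E0 by (simp add: field_simps add_pos_nonneg)
  hence "(T ^^ k) (\<lambda>_. (T ^^ n) u x / (1 + B\<^sup>2 * E)) y \<le> (T ^^ k) V y" using y by (intro T_pow_mono)
  hence "(T ^^ n) u x / (1 + B\<^sup>2 * E) \<le> (T ^^ n) u y" using y by (simp add: split T_pow_const)
  thus ?thesis unfolding E_def[symmetric] using E0 by (simp add: field_simps add_pos_nonneg)
qed

end

text \<open>
  The constant does not depend on \<open>\<eta>\<close>, and the logarithm is shifted by one so that the bound
  is also meaningful for \<open>\<eta>\<close> near one.
\<close>

lemma geometric_reach:
  fixes \<beta> a :: real
  assumes "0 \<le> \<beta>" "\<beta> < 1" "0 < a"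
  shows "\<exists>C\<ge>0. \<forall>\<eta>\<in>{0<..1}. \<exists>i::nat. real i \<le> C * (1 + ln (1 / \<eta>)) \<and> a * \<beta> ^ i \<le> \<eta>"
proof -
  define \<gamma> where "\<gamma> = max \<beta> (1 / 2)"
  have \<gamma>: "0 < \<gamma>" "\<gamma> < 1" "\<beta> \<le> \<gamma>" using assms by (auto simp: \<gamma>_def)
  define l where "l = - ln \<gamma>"
  have l: "0 < l" using \<gamma> by (simp add: l_def)
  have "\<exists>i::nat. real i \<le> ((\<bar>ln a\<bar> + 1) / l + 1) * (1 + ln (1 / \<eta>)) \<and> a * \<beta> ^ i \<le> \<eta>"
    if \<eta>: "0 < \<eta>" "\<eta> \<le> 1" for \<eta>
  proof -
    define y where "y = ln (1 / \<eta>)"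
    have y: "0 \<le> y" "ln \<eta> = - y" using \<eta> by (auto simp: y_def ln_div)
    define i where "i = nat \<lceil>(\<bar>ln a\<bar> + y) / l\<rceil>"
    have i1: "(\<bar>ln a\<bar> + y) / l \<le> real i" unfolding i_def by linarith
    have "0 \<le> (\<bar>ln a\<bar> + y) / l" using l y by simp
    hence "real i \<le> (\<bar>ln a\<bar> + y) / l + 1" unfolding i_def by linarith
    also have "\<dots> \<le> (\<bar>ln a\<bar> + 1) * (1 + y) / l + (1 + y)"
      using y l by (intro add_mono divide_right_mono) (auto simp: algebra_simps)
    finally have "real i \<le> ((\<bar>ln a\<bar> + 1) / l + 1) * (1 + y)" by (simp add: algebra_simps)
    moreover have "a * \<beta> ^ i \<le> \<eta>"
    proof -
      have "ln a - real i * l \<le> - y" using i1 l by (simp add: field_simps)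
      moreover have "a * \<gamma> ^ i = exp (ln a - real i * l)"
        using assms \<gamma> by (simp add: l_def exp_add exp_of_nat_mult)
      ultimately have "a * \<gamma> ^ i \<le> exp (ln \<eta>)" using y by simp
      moreover have "a * \<beta> ^ i \<le> a * \<gamma> ^ i" using assms \<gamma> by (intro mult_left_mono power_mono) auto
      ultimately show ?thesis using \<eta> by simp
    qed
    ultimately show ?thesis unfolding y_def by blast
  qed
  moreover have "0 \<le> (\<bar>ln a\<bar> + 1) / l + 1" using l by simp
  ultimately show ?thesis by (intro exI[of _ "(\<bar>ln a\<bar> + 1) / l + 1"]) auto
qed

context markov_branches
begin

definition mixes_within :: "real \<Rightarrow> nat \<Rightarrow> bool" where
  "mixes_within \<eta> k \<longleftrightarrow>
     (\<forall>m u n x y. cylinder_function m u \<longrightarrow> m + k \<le> n \<longrightarrow> x \<in> X \<longrightarrow> y \<in> X \<longrightarrow>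
        (T ^^ n) u x \<le> (1 + \<eta>) * (T ^^ n) u y)"

lemma quantitative_mixing:
  "\<exists>C\<ge>0. \<exists>k :: real \<Rightarrow> nat. \<forall>\<eta>\<in>{0<..<1}. real (k \<eta>) \<le> C * (1 + ln (1 / \<eta>))\<^sup>2 \<and>
     mixes_within \<eta> (k \<eta>)"
proof -
  define a where "a = B ^ 3 * K * exp K + 1"
  have "0 \<le> B ^ 3 * K * exp K" using K_nonneg B1 by (intro mult_nonneg_nonneg zero_le_power) auto
  hence a: "0 < a" by (simp add: a_def)
  obtain C1 where C1: "C1 \<ge> 0" "\<And>\<eta>. \<eta> \<in> {0<..1} \<Longrightarrow>
      \<exists>i::nat. real i \<le> C1 * (1 + ln (1 / \<eta>)) \<and> B\<^sup>2 * (1 - 1 / B) ^ i \<le> \<eta>"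
    using geometric_reach[of "1 - 1 / B" "B\<^sup>2"] B1 by (auto simp: field_simps)
  obtain C2 where C2: "C2 \<ge> 0" "\<And>\<eta>. \<eta> \<in> {0<..1} \<Longrightarrow>
      \<exists>j::nat. real j \<le> C2 * (1 + ln (1 / \<eta>)) \<and> a * \<theta> ^ j \<le> \<eta>"
    using geometric_reach[of \<theta> a] \<theta> a by auto
  have "\<exists>k::nat. real k \<le> (4 * C1 * C2) * (1 + ln (1 / \<eta>))\<^sup>2 \<and>
     mixes_within \<eta> k" if \<eta>: "0 < \<eta>" "\<eta> < 1" for \<eta>
  proof -
    have h: "\<eta> / 2 \<in> {0<..1}" using \<eta> by auto
    obtain i where i: "real i \<le> C1 * (1 + ln (1 / (\<eta> / 2)))" "B\<^sup>2 * (1 - 1 / B) ^ i \<le> \<eta> / 2"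
      using C1(2)[OF h] by auto
    obtain j where j: "real j \<le> C2 * (1 + ln (1 / (\<eta> / 2)))" "a * \<theta> ^ j \<le> \<eta> / 2"
      using C2(2)[OF h] by auto
    have "ln (1 / (\<eta> / 2)) = ln 2 + ln (1 / \<eta>)" using \<eta> by (simp add: ln_div)
    moreover have "ln 2 \<le> (1::real)" using ln_le_minus_one[of "2::real"] by simp
    moreover have "0 \<le> ln (1 / \<eta>)" using \<eta> by simp
    ultimately have l: "1 + ln (1 / (\<eta> / 2)) \<le> 2 * (1 + ln (1 / \<eta>))" "0 \<le> 1 + ln (1 / (\<eta> / 2))" by auto
    have "real (i * j) \<le> (C1 * (1 + ln (1 / (\<eta> / 2)))) * (C2 * (1 + ln (1 / (\<eta> / 2))))"
      using i j C1 C2 l by (simp only: of_nat_mult) (intro mult_mono mult_nonneg_nonneg, auto)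
    also have "\<dots> \<le> (C1 * (2 * (1 + ln (1 / \<eta>)))) * (C2 * (2 * (1 + ln (1 / \<eta>))))"
      using C1 C2 l by (intro mult_mono mult_nonneg_nonneg) auto
    finally have "real (i * j) \<le> (4 * C1 * C2) * (1 + ln (1 / \<eta>))\<^sup>2"
      by (simp add: power2_eq_square algebra_simps)
    moreover
    have "(T ^^ n) u x \<le> (1 + \<eta>) * (T ^^ n) u y"
      if u: "cylinder_function m u" "m + i * j \<le> n" and xy: "x \<in> X" "y \<in> X" for m u n x y
    proof -
      define z where "z = K * \<theta> ^ j"
      have z: "0 \<le> z" "z \<le> K" using K_nonneg \<theta> by (auto simp: z_def mult_left_le power_le_one)
      have "1 + (- z) \<le> exp (- z)" by (rule exp_ge_add_one_self)
      hence "exp z * (1 - z) \<le> exp z * exp (- z)" by (intro mult_left_mono) auto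
      hence "exp z - 1 \<le> z * exp z" by (simp add: exp_minus algebra_simps)
      also have "\<dots> \<le> z * exp K" using z by (intro mult_left_mono) auto
      finally have "B ^ 3 * (exp z - 1) \<le> B ^ 3 * (z * exp K)" using B1 by (intro mult_left_mono) auto
      also have "\<dots> = (a - 1) * \<theta> ^ j" by (simp add: a_def z_def algebra_simps)
      also have "\<dots> \<le> \<eta> / 2" using j(2) \<theta> by (simp add: algebra_simps) (smt (verit) zero_le_power)
      finally have "B\<^sup>2 * ((1 - 1 / B) ^ i + B * (exp z - 1)) \<le> \<eta>"
        using i(2) by (simp add: algebra_simps power2_eq_square power3_eq_cube)
      moreover have "0 \<le> (T ^^ n) u y" using cylinder_functionD[OF u(1)] xy by (intro T_pow_bounds(1)[of 0 u 1]) auto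
      ultimately have "(1 + B\<^sup>2 * ((1 - 1 / B) ^ i + B * (exp z - 1))) * (T ^^ n) u y \<le> (1 + \<eta>) * (T ^^ n) u y"
        by (intro mult_right_mono) auto
      thus ?thesis using ratio_mixing[OF u xy] by (simp add: z_def)
    qed
    hence "mixes_within \<eta> (i * j)" unfolding mixes_within_def by blast
    ultimately show ?thesis by blast
  qed
  hence "\<forall>\<eta>\<in>{0<..<1}. \<exists>k::nat. real k \<le> (4 * C1 * C2) * (1 + ln (1 / \<eta>))\<^sup>2 \<and>
     mixes_within \<eta> k" by auto
  from bchoice[OF this] show ?thesis using C1 C2 by (intro exI[of _ "4 * C1 * C2"]) simp
qed

definition mixing_time :: "real \<Rightarrow> nat" where
  "mixing_time = (SOME k. \<exists>C\<ge>0. \<forall>\<eta>\<in>{0<..<1}. real (k \<eta>) \<le> C * (1 + ln (1 / \<eta>))\<^sup>2 \<and>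
     mixes_within \<eta> (k \<eta>))"

lemma mixing_time:
  "\<exists>C\<ge>0. \<forall>\<eta>\<in>{0<..<1}. real (mixing_time \<eta>) \<le> C * (1 + ln (1 / \<eta>))\<^sup>2 \<and>
     mixes_within \<eta> (mixing_time \<eta>)"
proof -
  have "\<exists>k. \<exists>C\<ge>0. \<forall>\<eta>\<in>{0<..<1}. real (k \<eta>) \<le> C * (1 + ln (1 / \<eta>))\<^sup>2 \<and> mixes_within \<eta> (k \<eta>)"
    using quantitative_mixing by blast
  from someI_ex[OF this] show ?thesis unfolding mixing_time_def .
qed

lemma mixing_time_ratio:
  assumes "\<eta> \<in> {0<..<1}" "cylinder_function m u" "m + mixing_time \<eta> \<le> n" "x \<in> X" "y \<in> X"
  shows "(T ^^ n) u x \<le> (1 + \<eta>) * (T ^^ n) u y"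
  using mixing_time assms unfolding mixes_within_def by blast

definition base_point :: 'a where "base_point = (SOME x. x \<in> X)"

lemma base_point: "base_point \<in> X"
  unfolding base_point_def using Xne by (simp add: some_in_eq)

text \<open>
  The mean of \<open>u\<close> under the invariant law of the chain. The oscillation of \<open>(T ^^ n) u\<close> tends
  to zero for cylinder functions, so one base point determines the limit.
\<close>

definition equilibrium :: "('a \<Rightarrow> real) \<Rightarrow> real" where
  "equilibrium u = lim (\<lambda>n. (T ^^ n) u base_point)"

lemma mixing_nested:
  assumes \<eta>: "\<eta> \<in> {0<..<1}" and u: "cylinder_function m u" and n: "m + mixing_time \<eta> \<le> n" "n \<le> n'"
    and xy: "x \<in> X" "y \<in> X"
  shows "(T ^^ n') u x \<le> (1 + \<eta>) * (T ^^ n) u y" "(T ^^ n) u y \<le> (1 + \<eta>) * (T ^^ n') u x"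
proof -
  have split: "(T ^^ n') u z = (T ^^ (n' - n)) ((T ^^ n) u) z" for z
    using n by (simp flip: funpow_add o_apply[of "T ^^ (n' - n)" "T ^^ n"])
  note R = mixing_time_ratio[OF \<eta> u n(1)]
  have "(T ^^ (n' - n)) ((T ^^ n) u) x \<le> (1 + \<eta>) * (T ^^ n) u y"
    using R[OF _ xy(2)] T_pow_mono[of "(T ^^ n) u" "\<lambda>_. (1 + \<eta>) * (T ^^ n) u y" x "n' - n"] xy
    by (simp add: T_pow_const)
  thus "(T ^^ n') u x \<le> (1 + \<eta>) * (T ^^ n) u y" by (simp add: split)
  have "(T ^^ n) u y / (1 + \<eta>) \<le> (T ^^ n) u z" if "z \<in> X" for z
    using R[OF xy(2) that] \<eta> by (simp add: field_simps)
  hence "(T ^^ n) u y / (1 + \<eta>) \<le> (T ^^ (n' - n)) ((T ^^ n) u) x"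
    using T_pow_mono[of "\<lambda>_. (T ^^ n) u y / (1 + \<eta>)" "(T ^^ n) u" x "n' - n"] xy
    by (simp add: T_pow_const)
  thus "(T ^^ n) u y \<le> (1 + \<eta>) * (T ^^ n') u x" using \<eta> by (simp add: split field_simps)
qed

lemma iterate_unit:
  assumes "cylinder_function m u" "x \<in> X"
  shows "0 \<le> (T ^^ n) u x" "(T ^^ n) u x \<le> 1"
  using cylinder_functionD[OF assms(1)] assms(2) T_pow_bounds[of 0 u 1 x n] by auto

lemma equilibrium_limit:
  assumes u: "cylinder_function m u"
  shows "(\<lambda>n. (T ^^ n) u base_point) \<longlonglongrightarrow> equilibrium u"
proof -
  have "Cauchy (\<lambda>n. (T ^^ n) u base_point)"
  proof (rule metric_CauchyI)
    fix e :: real assume e: "0 < e"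
    define \<eta> where "\<eta> = min (e / 2) (1 / 2)"
    have \<eta>: "\<eta> \<in> {0<..<1}" "\<eta> < e" using e by (auto simp: \<eta>_def)
    define x where "x = base_point"
    have x: "x \<in> X" by (simp add: x_def base_point)
    have *: "\<bar>(T ^^ n) u x - (T ^^ n') u x\<bar> < e" if "m + mixing_time \<eta> \<le> n" "n \<le> n'" for n n'
    proof -
      have "(T ^^ n') u x \<le> (1 + \<eta>) * (T ^^ n) u x" "(T ^^ n) u x \<le> (1 + \<eta>) * (T ^^ n') u x"
        using mixing_nested[OF \<eta>(1) u that x x] by auto
      moreover have "\<eta> * (T ^^ n') u x \<le> \<eta> * 1" "\<eta> * (T ^^ n) u x \<le> \<eta> * 1"
        using iterate_unit[OF u x] \<eta> by (intro mult_left_mono; simp)+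
      ultimately show ?thesis using \<eta>(2) by (simp add: algebra_simps abs_less_iff)
    qed
    show "\<exists>M. \<forall>n\<ge>M. \<forall>n'\<ge>M. dist ((T ^^ n) u base_point) ((T ^^ n') u base_point) < e"
    proof (intro exI allI impI)
      fix n n' assume "m + mixing_time \<eta> \<le> n" "m + mixing_time \<eta> \<le> n'"
      thus "dist ((T ^^ n) u base_point) ((T ^^ n') u base_point) < e"
        using *[of n n'] *[of n' n] unfolding x_def[symmetric] dist_real_def
        by (cases "n \<le> n'") (auto simp: abs_minus_commute)
    qed
  qed
  hence "convergent (\<lambda>n. (T ^^ n) u base_point)" by (simp add: Cauchy_convergent_iff)
  thus ?thesis unfolding equilibrium_def by (simp add: convergent_LIMSEQ_iff)
qed

lemma equilibrium_le:
  assumes u: "cylinder_function m u" and \<eta>: "\<eta> \<in> {0<..<1}" and n: "m + mixing_time \<eta> \<le> n" and x: "x \<in> X"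
  shows "equilibrium u \<le> (1 + \<eta>) * (T ^^ n) u x"
  by (rule LIMSEQ_le_const2[OF equilibrium_limit[OF u]])
     (use mixing_nested(1)[OF \<eta> u n _ base_point x] in blast)

lemma equilibrium_bounds:
  assumes u: "cylinder_function m u"
  shows "0 \<le> equilibrium u" "equilibrium u \<le> 1"
  by (rule LIMSEQ_le_const[OF equilibrium_limit[OF u]], simp add: iterate_unit[OF u base_point])
     (rule LIMSEQ_le_const2[OF equilibrium_limit[OF u]], simp add: iterate_unit[OF u base_point])

lemma cylinder_function_complement:
  assumes "cylinder_function m u"
  shows "cylinder_function m (\<lambda>x. 1 - u x)"
  unfolding cylinder_function_def
proof (intro conjI ballI)
  fix w x y assume "w \<in> words A m" "x \<in> X" "y \<in> X"
  thus "1 - u (branch s w x) = 1 - u (branch s w y)" using cylinder_functionD(3)[OF assms, of w x y] by simp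
qed (use cylinder_functionD(1,2)[OF assms] in auto)

lemma equilibrium_complement:
  assumes u: "cylinder_function m u"
  shows "equilibrium (\<lambda>x. 1 - u x) = 1 - equilibrium u"
proof -
  have "(T ^^ n) (\<lambda>x. 1 - u x) base_point = 1 - (T ^^ n) u base_point" for n
    using weight_sum[OF base_point, of n] by (simp add: transfer_pow right_diff_distrib sum_subtractf)
  hence "(\<lambda>n. (T ^^ n) (\<lambda>x. 1 - u x) base_point) \<longlonglongrightarrow> 1 - equilibrium u"
    using tendsto_diff[OF tendsto_const equilibrium_limit[OF u], of 1] by simp
  thus ?thesis using equilibrium_limit[OF cylinder_function_complement[OF u]] LIMSEQ_unique by blast
qed

section \<open>Deviations below the mean\<close>

text \<open>
  With \<open>w\<close> the sum of \<open>(T ^^ n) u\<close> for \<open>n\<close> from \<open>1\<close> to \<open>n0\<close>, the function \<open>1 - t * w\<close> is a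
  subeigenfunction: \<open>T w = w - T u + (T ^^ Suc n0) u\<close>, and \<open>t = r / (1 + r * W)\<close> is the value
  for which the terms \<open>T u\<close> cancel once \<open>w\<close> is estimated by \<open>W\<close> where it multiplies \<open>u\<close>,
  leaving the loss \<open>t * (T ^^ Suc n0) u\<close>. Thus the clustering of visits enters through \<open>W\<close>
  alone.
\<close>

lemma killed_iterate:
  fixes a r W :: real
  assumes u: "\<And>x. x \<in> X \<Longrightarrow> 0 \<le> u x" "\<And>x. x \<in> X \<Longrightarrow> u x \<le> 1"
    and W: "\<And>x. x \<in> X \<Longrightarrow> (\<Sum>n=1..n0. (T ^^ n) u x) \<le> W" "0 \<le> W"
    and a: "\<And>x. x \<in> X \<Longrightarrow> a \<le> (T ^^ Suc n0) u x" "0 \<le> a"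
    and r: "0 < r" "r < 1" and x: "x \<in> X"
  shows "((\<lambda>g. T (\<lambda>y. (1 - r * u y) * g y)) ^^ N) (\<lambda>_. 1) x \<le> (1 + r * W) * (1 - r / (1 + r * W) * a) ^ N"
proof -
  define t where "t = r / (1 + r * W)"
  define w where "w y = (\<Sum>n=1..n0. (T ^^ n) u y)" for y
  define g where "g y = 1 - t * w y" for y
  define \<rho> where "\<rho> = 1 - t * a"
  have p: "0 < 1 + r * W" using r W(2) by (simp add: add_pos_nonneg)
  have t: "0 < t" using r p by (simp add: t_def)
  have st: "r - r * t * W = t" using p by (simp add: t_def field_simps)
  have w: "0 \<le> w y" "w y \<le> W" if "y \<in> X" for y
    unfolding w_def using u W(1) that by (auto intro!: sum_nonneg T_pow_bounds(1)[of 0 u 1])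
  have "1 - t * W = 1 / (1 + r * W)" using p by (simp add: t_def field_simps)
  hence glow: "1 \<le> (1 + r * W) * g y" if "y \<in> X" for y
  proof -
    have "1 / (1 + r * W) \<le> g y"
      using mult_left_mono[OF w(2)[OF that], of t] t \<open>1 - t * W = 1 / (1 + r * W)\<close>
      unfolding g_def by linarith
    thus ?thesis using p by (simp add: field_simps)
  qed
  have ghigh: "g y \<le> 1" if "y \<in> X" for y using w(1)[OF that] t by (simp add: g_def)
  obtain x1 where "x1 \<in> X" using Xne by auto
  have a1: "a \<le> 1" using a(1)[OF \<open>x1 \<in> X\<close>] T_pow_bounds(2)[of 0 u 1 x1 "Suc n0"] u \<open>x1 \<in> X\<close> by force
  have "t \<le> 1" using r W(2) p by (simp add: t_def field_simps) (smt (verit) mult_nonneg_nonneg)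
  hence \<rho>0: "0 \<le> \<rho>" using a1 a(2) t mult_mono[of t 1 a 1] by (simp add: \<rho>_def)
  have Tw: "T w y = w y - T u y + (T ^^ Suc n0) u y" for y
  proof -
    have "T w y = (\<Sum>n=1..n0. (T ^^ Suc n) u y)" unfolding w_def T_sum by simp
    also have "\<dots> = (\<Sum>n=1..Suc n0. (T ^^ n) u y) - T u y"
    proof -
      have "(\<Sum>n=1..n0. (T ^^ Suc n) u y) = (\<Sum>n=Suc 1..Suc n0. (T ^^ n) u y)"
        by (rule sum.shift_bounds_cl_Suc_ivl[symmetric])
      moreover have "(\<Sum>n=1..Suc n0. (T ^^ n) u y) = (T ^^ 1) u y + (\<Sum>n=Suc 1..Suc n0. (T ^^ n) u y)"
        by (rule sum.atLeast_Suc_atMost) simp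
      ultimately show ?thesis by simp
    qed
    finally show ?thesis by (simp add: w_def)
  qed
  have step: "T (\<lambda>y. (1 - r * u y) * g y) z \<le> \<rho> * g z" if z: "z \<in> X" for z
  proof -
    have "T (\<lambda>y. (1 - r * u y) * g y) z \<le> T (\<lambda>y. (1 - t * w y) - t * u y) z"
    proof (rule T_mono[OF _ z])
      fix y assume y: "y \<in> X"
      have "r * t * u y * w y \<le> r * t * u y * W" using w(2)[OF y] u(1)[OF y] r t by (intro mult_left_mono) auto
      moreover have "(1 - r * u y) * g y = (1 - t * w y) - (r - r * t * W) * u y + (r * t * u y * w y - r * t * u y * W)"
        by (simp add: g_def algebra_simps)
      ultimately show "(1 - r * u y) * g y \<le> (1 - t * w y) - t * u y" unfolding st by simp
    qed
    also have "\<dots> = 1 - t * w z - t * (T ^^ Suc n0) u z"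
      by (simp only: T_diff T_cmult T_const[OF z] Tw) (simp add: algebra_simps)
    also have "\<dots> \<le> g z - t * a" using a(1)[OF z] t by (simp add: g_def)
    also have "\<dots> \<le> \<rho> * g z"
      using mult_left_mono[OF ghigh[OF z], of "t * a"] t a(2) by (simp add: \<rho>_def algebra_simps)
    finally show ?thesis .
  qed
  have "((\<lambda>g. T (\<lambda>y. (1 - r * u y) * g y)) ^^ N) (\<lambda>_. 1) z \<le> (1 + r * W) * \<rho> ^ N * g z" if "z \<in> X" for z
    using that
  proof (induction N arbitrary: z)
    case 0 thus ?case using glow by simp
  next
    case (Suc N)
    have "T (\<lambda>y. (1 - r * u y) * ((\<lambda>g. T (\<lambda>y. (1 - r * u y) * g y)) ^^ N) (\<lambda>_. 1) y) z
       \<le> T (\<lambda>y. (1 + r * W) * \<rho> ^ N * ((1 - r * u y) * g y)) z"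
    proof (rule T_mono[OF _ Suc.prems])
      fix y assume y: "y \<in> X"
      have "0 \<le> 1 - r * u y" using mult_mono[of r 1 "u y" 1] u[OF y] r by simp
      from mult_left_mono[OF Suc.IH[OF y] this]
      show "(1 - r * u y) * ((\<lambda>g. T (\<lambda>y. (1 - r * u y) * g y)) ^^ N) (\<lambda>_. 1) y
        \<le> (1 + r * W) * \<rho> ^ N * ((1 - r * u y) * g y)" by (simp add: mult_ac)
    qed
    also have "\<dots> = (1 + r * W) * \<rho> ^ N * T (\<lambda>y. (1 - r * u y) * g y) z" by (rule T_cmult)
    also have "\<dots> \<le> (1 + r * W) * \<rho> ^ N * (\<rho> * g z)"
      using step[OF Suc.prems] p \<rho>0 by (intro mult_left_mono) auto
    finally show ?case by (simp add: mult_ac)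
  qed
  from this[OF x] have "((\<lambda>g. T (\<lambda>y. (1 - r * u y) * g y)) ^^ N) (\<lambda>_. 1) x \<le> (1 + r * W) * \<rho> ^ N * g x" .
  also have "\<dots> \<le> (1 + r * W) * \<rho> ^ N * 1" using ghigh[OF x] p \<rho>0 by (intro mult_left_mono) auto
  finally show ?thesis by (simp add: \<rho>_def t_def)
qed

text \<open>
  The innermost \<open>T\<close> averages over the first letter of the point. Only the first factor of the
  product depends on this letter, since the others are functions of the image under \<open>f\<close>.
\<close>

lemma transfer_product:
  assumes f: "\<And>a x. a \<in> A \<Longrightarrow> x \<in> X \<Longrightarrow> f (s a x) = x" and x: "x \<in> X"
  shows "(T ^^ N) (\<lambda>y. (\<Prod>i<N. c ((f ^^ i) y)) * g y) x = ((\<lambda>g. T (\<lambda>y. c y * g y)) ^^ N) g x"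
  using x
proof (induction N arbitrary: g x)
  case (Suc N)
  have 1: "T (\<lambda>y. (\<Prod>i<Suc N. c ((f ^^ i) y)) * g y) z
     = (\<Prod>i<N. c ((f ^^ i) z)) * T (\<lambda>y. c y * g y) z" if z: "z \<in> X" for z
    unfolding transfer_def sum_distrib_left
  proof (rule sum.cong[OF refl])
    fix b assume b: "b \<in> A"
    have "(\<Prod>i<Suc N. c ((f ^^ i) (s b z))) = c (s b z) * (\<Prod>i<N. c ((f ^^ i) z))"
      by (subst prod.lessThan_Suc_shift) (simp add: funpow_Suc_right f[OF b z] del: funpow.simps)
    thus "p b z * ((\<Prod>i<Suc N. c ((f ^^ i) (s b z))) * g (s b z)) =
       (\<Prod>i<N. c ((f ^^ i) z)) * (p b z * (c (s b z) * g (s b z)))" by (simp add: mult_ac)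
  qed
  have "(T ^^ Suc N) (\<lambda>y. (\<Prod>i<Suc N. c ((f ^^ i) y)) * g y) x
     = (T ^^ N) (T (\<lambda>y. (\<Prod>i<Suc N. c ((f ^^ i) y)) * g y)) x" by (simp only: funpow_Suc_right o_apply)
  also have "\<dots> = (T ^^ N) (\<lambda>z. (\<Prod>i<N. c ((f ^^ i) z)) * T (\<lambda>y. c y * g y) z) x"
    using 1 Suc.prems by (intro transfer_pow_cong) auto
  also have "\<dots> = ((\<lambda>g. T (\<lambda>y. c y * g y)) ^^ N) (T (\<lambda>y. c y * g y)) x" by (rule Suc.IH[OF Suc.prems])
  also have "\<dots> = ((\<lambda>g. T (\<lambda>y. c y * g y)) ^^ Suc N) g x" by (simp only: funpow_Suc_right o_apply)
  finally show ?case .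
qed simp

text \<open>
  Exponential Markov inequality for \<open>(1 - r)\<close> to the power of the number of visits, with \<open>r\<close>
  proportional to \<open>\<epsilon> / (1 + W)\<close>. The exponent is then minus a quantity of order \<open>r * \<epsilon>\<close>.
\<close>

lemma lower_deviation_words:
  assumes f: "\<And>a x. a \<in> A \<Longrightarrow> x \<in> X \<Longrightarrow> f (s a x) = x"
    and u: "\<And>x. x \<in> X \<Longrightarrow> u x = 0 \<or> u x = (1::real)"
    and W: "\<And>x. x \<in> X \<Longrightarrow> (\<Sum>n=1..n0. (T ^^ n) u x) \<le> W" "0 \<le> W"
    and a: "\<And>x. x \<in> X \<Longrightarrow> (1 - \<epsilon> / 4) * a \<le> (T ^^ Suc n0) u x" "0 \<le> a"
    and \<epsilon>: "\<epsilon> \<in> {0<..<1}" and x: "x \<in> X"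
  shows "(\<Sum>w | w \<in> words A (m + N) \<and> (\<Sum>i<N. u ((f ^^ i) (branch s w x))) \<le> (1 - \<epsilon>) * a * real N. weight p w x)
     \<le> 2 * exp (- (real N * a * \<epsilon>\<^sup>2 / (16 * (1 + W))))"
proof -
  \<comment> \<open>With this choice \<open>2 * (r + r * W) = \<epsilon> / 4\<close>, which absorbs the quadratic terms of the
      exponent.\<close>
  define r where "r = \<epsilon> / (8 * (1 + W))"
  define S where "S y = (\<Sum>i<N. u ((f ^^ i) y))" for y
  define F where "F y = (\<Prod>i<N. 1 - r * u ((f ^^ i) y))" for y
  have W1: "0 < 1 + W" using W(2) by simp
  have r0: "0 < r" using \<epsilon> W1 by (simp add: r_def)
  have "r * (1 + W) = \<epsilon> / 8" using W1 unfolding r_def by (simp add: divide_simps)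
  hence rW: "r + r * W = \<epsilon> / 8" by (simp add: algebra_simps)
  have rW0: "0 \<le> r * W" using r0 W(2) by simp
  have r4: "r \<le> 1 / 4" using rW rW0 \<epsilon> by simp
  define l where "l = - ln (1 - r)"
  have l: "l \<le> r + 2 * r\<^sup>2" using ln_one_minus_pos_lower_bound[of r] r0 r4 by (simp add: l_def power2_eq_square)
  have l0: "0 \<le> l" using r0 r4 by (simp add: l_def)
  have FX: "F y = exp (- l * S y)" if "\<And>i. i < N \<Longrightarrow> (f ^^ i) y \<in> X" for y
  proof -
    have "F y = (\<Prod>i<N. exp (- l * u ((f ^^ i) y)))" unfolding F_def
      using u[OF that] r4 by (intro prod.cong refl) (fastforce simp: l_def)
    thus ?thesis by (simp add: S_def exp_sum sum_distrib_left)
  qed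
  have orbit: "(f ^^ i) (branch s w y) \<in> X" if "w \<in> words A n" "i \<le> n" "y \<in> X" for w n i y
    using that
  proof (induction i arbitrary: w n)
    case 0 thus ?case using branch_in by simp
  next
    case (Suc i)
    then obtain b v where w: "w = b # v" "b \<in> A" "v \<in> words A (n - 1)"
      by (cases w; cases n) (auto simp: words_def)
    thus ?case using Suc.IH[OF w(3)] Suc.prems branch_in[OF w(3)] by (simp add: funpow_Suc_right f del: funpow.simps)
  qed
  have "(T ^^ (m + N)) F x = (T ^^ m) ((T ^^ N) F) x" by (simp only: funpow_add o_apply)
  also have "\<dots> \<le> (1 + r * W) * (1 - r / (1 + r * W) * ((1 - \<epsilon> / 4) * a)) ^ N"
  proof (rule T_pow_bounds(2)[OF _ _ x])
    fix y assume y: "y \<in> X"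
    have uu: "0 \<le> u z" "u z \<le> 1" if "z \<in> X" for z using u[OF that] by auto
    have "(T ^^ N) F y = ((\<lambda>g. T (\<lambda>z. (1 - r * u z) * g z)) ^^ N) (\<lambda>_. 1) y"
      using transfer_product[OF f y, of N "\<lambda>z. 1 - r * u z" "\<lambda>_. 1"] by (simp add: F_def[abs_def])
    also have "\<dots> \<le> (1 + r * W) * (1 - r / (1 + r * W) * ((1 - \<epsilon> / 4) * a)) ^ N"
      using killed_iterate[OF uu W a(1) _ r0 _ y, of N] a(2) \<epsilon> r4 by simp
    finally show "(T ^^ N) F y \<le> (1 + r * W) * (1 - r / (1 + r * W) * ((1 - \<epsilon> / 4) * a)) ^ N" .
    have "0 \<le> (\<Sum>w\<in>words A N. weight p w y * F (branch s w y))"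
      using orbit y FX by (intro sum_nonneg mult_nonneg_nonneg) (auto simp: weight_nonneg)
    thus "0 \<le> (T ^^ N) F y" by (simp add: transfer_pow)
  qed
  also have "\<dots> \<le> 2 * exp (- (r / (1 + r * W) * ((1 - \<epsilon> / 4) * a))) ^ N"
  proof (intro mult_mono power_mono)
    show "1 + r * W \<le> 2" using rW r0 \<epsilon> by simp
    show "1 - r / (1 + r * W) * ((1 - \<epsilon> / 4) * a) \<le> exp (- (r / (1 + r * W) * ((1 - \<epsilon> / 4) * a)))"
      using exp_ge_add_one_self[of "- (r / (1 + r * W) * ((1 - \<epsilon> / 4) * a))"] by simp
    have "(1 - \<epsilon> / 4) * a \<le> 1"
      using a(1)[OF x] T_pow_bounds(2)[of 0 u 1 x "Suc n0"] u x by force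
    moreover have "r / (1 + r * W) \<le> 1" using rW0 r4 by (simp add: field_simps)
    ultimately have "r / (1 + r * W) * ((1 - \<epsilon> / 4) * a) \<le> 1 * 1"
      using r0 rW0 a(2) \<epsilon> by (intro mult_mono) auto
    thus "0 \<le> 1 - r / (1 + r * W) * ((1 - \<epsilon> / 4) * a)" by simp
    thus "0 \<le> (1 - r / (1 + r * W) * ((1 - \<epsilon> / 4) * a)) ^ N" by simp
  qed auto
  finally have TF: "(T ^^ (m + N)) F x \<le> 2 * exp (- (r / (1 + r * W) * ((1 - \<epsilon> / 4) * a))) ^ N" .
  define Z where "Z = (1 - \<epsilon>) * a * real N"
  have "(\<Sum>w | w \<in> words A (m + N) \<and> S (branch s w x) \<le> Z. weight p w x)
     \<le> (\<Sum>w\<in>words A (m + N). weight p w x * (exp (l * Z) * F (branch s w x)))"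
  proof -
    have "(\<Sum>w | w \<in> words A (m + N) \<and> S (branch s w x) \<le> Z. weight p w x)
      = (\<Sum>w\<in>words A (m + N). if S (branch s w x) \<le> Z then weight p w x else 0)"
      by (rule sum.mono_neutral_cong_left) (auto simp: finA)
    also have "\<dots> \<le> (\<Sum>w\<in>words A (m + N). weight p w x * (exp (l * Z) * F (branch s w x)))"
    proof (rule sum_mono)
      fix w assume w: "w \<in> words A (m + N)"
      have F: "F (branch s w x) = exp (- l * S (branch s w x))" using orbit[OF w _ x] by (intro FX) auto
      have "1 \<le> exp (l * Z) * F (branch s w x)" if "S (branch s w x) \<le> Z"
        using mult_left_mono[OF that l0] by (simp add: F flip: exp_add)
      thus "(if S (branch s w x) \<le> Z then weight p w x else 0) \<le> weight p w x * (exp (l * Z) * F (branch s w x))"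
        using weight_nonneg[OF w x] mult_left_mono[of 1 "exp (l * Z) * F (branch s w x)" "weight p w x"]
        by (auto simp: F)
    qed
    finally show ?thesis .
  qed
  also have "\<dots> = exp (l * Z) * (T ^^ (m + N)) F x" by (simp add: transfer_pow sum_distrib_left mult_ac)
  also have "\<dots> \<le> exp (l * Z) * (2 * exp (- (r / (1 + r * W) * ((1 - \<epsilon> / 4) * a))) ^ N)"
    using TF by (intro mult_left_mono) auto
  also have "\<dots> = 2 * exp (l * Z - real N * (r / (1 + r * W) * ((1 - \<epsilon> / 4) * a)))"
    by (simp add: exp_diff exp_minus exp_of_nat_mult[symmetric] field_simps)
  also have "\<dots> \<le> 2 * exp (- (real N * a * \<epsilon>\<^sup>2 / (16 * (1 + W))))"
  proof -
    have "(1 - r * W) * (1 + r * W) = 1 - (r * W)\<^sup>2" by (simp add: algebra_simps power2_eq_square)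
    hence "(1 - r * W) * (1 + r * W) \<le> 1" by simp
    hence "1 - r * W \<le> 1 / (1 + r * W)" using rW0 by (simp add: pos_le_divide_eq add_pos_nonneg)
    hence "r * (1 - r * W) \<le> r / (1 + r * W)" using mult_left_mono[of _ _ r] r0 by fastforce
    hence 1: "(1 - \<epsilon> / 4) * (r * (1 - r * W)) \<le> (1 - \<epsilon> / 4) * (r / (1 + r * W))"
      using \<epsilon> by (intro mult_left_mono) auto
    have 2: "(1 - \<epsilon>) * l \<le> (1 - \<epsilon>) * (r + 2 * r\<^sup>2)" using l \<epsilon> by (intro mult_left_mono) auto
    have "0 \<le> \<epsilon> * r" "0 \<le> \<epsilon> * (r * W)" using r0 rW0 \<epsilon> by auto
    hence "- \<epsilon> + \<epsilon> / 4 + (2 * (r + r * W) - r * W) - 2 * \<epsilon> * r - (\<epsilon> / 4) * (r * W) \<le> - \<epsilon> / 2"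
      using rW0 unfolding rW by simp
    hence 3: "r * (- \<epsilon> + \<epsilon> / 4 + (2 * (r + r * W) - r * W) - 2 * \<epsilon> * r - (\<epsilon> / 4) * (r * W)) \<le> r * (- \<epsilon> / 2)"
      using r0 by (intro mult_left_mono) auto
    have "(1 - \<epsilon>) * (r + 2 * r\<^sup>2) - (1 - \<epsilon> / 4) * (r * (1 - r * W))
       = r * (- \<epsilon> + \<epsilon> / 4 + (2 * (r + r * W) - r * W) - 2 * \<epsilon> * r - (\<epsilon> / 4) * (r * W))"
      by (simp add: algebra_simps power2_eq_square)
    moreover have "r * (- \<epsilon> / 2) = - (\<epsilon>\<^sup>2 / (16 * (1 + W)))" by (simp add: r_def power2_eq_square)
    ultimately have "(1 - \<epsilon>) * l - (1 - \<epsilon> / 4) * (r / (1 + r * W)) \<le> - (\<epsilon>\<^sup>2 / (16 * (1 + W)))" using 1 2 3 by linarith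
    hence "real N * a * ((1 - \<epsilon>) * l - (1 - \<epsilon> / 4) * (r / (1 + r * W))) \<le> real N * a * (- (\<epsilon>\<^sup>2 / (16 * (1 + W))))"
      using a(2) by (intro mult_left_mono) auto
    thus ?thesis by (simp add: Z_def algebra_simps)
  qed
  finally show ?thesis by (simp add: S_def Z_def)
qed

end

section \<open>Normalisation of the weights\<close>

text \<open>
  Weights \<open>e\<close> that are not normalised, for which the Gibbs inequality holds with masses of
  total one on each level; the iterates of the transfer operator on the constant one are then
  bounded.
\<close>

locale gibbs_branches = branches X A s
  for X :: "'a set" and A :: "'p set" and s +
  fixes e :: "'p \<Rightarrow> 'a \<Rightarrow> real" and mass :: "'p list \<Rightarrow> real" and C K \<theta> :: real
  assumes e_pos: "a \<in> A \<Longrightarrow> x \<in> X \<Longrightarrow> 0 < e a x"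
    and gibbs_lower: "w \<in> words A n \<Longrightarrow> x \<in> X \<Longrightarrow> mass w \<le> C * weight e w x"
    and gibbs_upper: "w \<in> words A n \<Longrightarrow> x \<in> X \<Longrightarrow> weight e w x \<le> C * mass w"
    and mass_sum: "(\<Sum>w\<in>words A n. mass w) = 1"
    and e_regular: "v \<in> words A k \<Longrightarrow> w \<in> words A n \<Longrightarrow> x \<in> X \<Longrightarrow> y \<in> X \<Longrightarrow>
       weight e v (branch s w x) \<le> exp (K * \<theta> ^ n) * weight e v (branch s w y)"
    and C1: "1 \<le> C" and K0: "0 \<le> K" and \<theta>01: "0 < \<theta>" "\<theta> < 1"
begin

abbreviation L where "L \<equiv> transfer e"

lemma weight_pos: "w \<in> words A n \<Longrightarrow> x \<in> X \<Longrightarrow> 0 < weight e w x"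
proof (induction w arbitrary: n)
  case (Cons a w)
  hence "a \<in> A" "w \<in> words A (length w)" by (auto simp: words_def)
  thus ?case using Cons.IH[of "length w"] Cons.prems branch_in by (auto intro!: mult_pos_pos e_pos)
qed auto

lemma L_pow_mono:
  assumes "\<And>y. y \<in> X \<Longrightarrow> g y \<le> g' y" "x \<in> X"
  shows "(L ^^ n) g x \<le> (L ^^ n) g' x"
  unfolding transfer_pow using assms
  by (intro sum_mono mult_left_mono) (auto simp: weight_pos branch_in less_imp_le)

definition partition_function :: "nat \<Rightarrow> 'a \<Rightarrow> real" where
  "partition_function n = (L ^^ n) (\<lambda>_. 1)"

lemma partition_function_bounds:
  assumes x: "x \<in> X"
  shows "1 / C \<le> partition_function n x" "partition_function n x \<le> C"
proof -
  have Z: "partition_function n x = (\<Sum>w\<in>words A n. weight e w x)"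
    by (simp add: partition_function_def transfer_pow)
  have "(\<Sum>w\<in>words A n. mass w) \<le> (\<Sum>w\<in>words A n. C * weight e w x)"
    using gibbs_lower x by (intro sum_mono) auto
  thus "1 / C \<le> partition_function n x" using C1 mass_sum by (simp add: Z field_simps sum_distrib_left)
  have "(\<Sum>w\<in>words A n. weight e w x) \<le> (\<Sum>w\<in>words A n. C * mass w)"
    using gibbs_upper x by (intro sum_mono) auto
  thus "partition_function n x \<le> C" using mass_sum by (simp add: Z flip: sum_distrib_left)
qed

text \<open>
  The multiplicative form of Hoelder continuity along words. It is preserved by pointwise
  limits and suprema, the operations by which the fixed point below is built.
\<close>

definition regular :: "real \<Rightarrow> ('a \<Rightarrow> real) \<Rightarrow> bool" where
  "regular k g \<longleftrightarrow> (\<forall>n. \<forall>w\<in>words A n. \<forall>x\<in>X. \<forall>y\<in>X. g (branch s w x) \<le> exp (k * \<theta> ^ n) * g (branch s w y))"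

lemma regularD: "regular k g \<Longrightarrow> w \<in> words A n \<Longrightarrow> x \<in> X \<Longrightarrow> y \<in> X \<Longrightarrow>
    g (branch s w x) \<le> exp (k * \<theta> ^ n) * g (branch s w y)"
  unfolding regular_def by blast

lemma regular_limit:
  assumes "\<And>i. regular k (g i)" "\<And>x. x \<in> X \<Longrightarrow> (\<lambda>i. g i x) \<longlonglongrightarrow> h x"
  shows "regular k h"
  unfolding regular_def
proof (intro allI ballI)
  fix n w x y assume w: "w \<in> words A n" "x \<in> X" "y \<in> X"
  have "(\<lambda>i. g i (branch s w x)) \<longlonglongrightarrow> h (branch s w x)"
    by (rule assms(2)) (rule branch_in[OF w(1,2)])
  moreover have "(\<lambda>i. exp (k * \<theta> ^ n) * g i (branch s w y)) \<longlonglongrightarrow> exp (k * \<theta> ^ n) * h (branch s w y)"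
    by (rule tendsto_mult_left, rule assms(2)) (rule branch_in[OF w(1,3)])
  ultimately show "h (branch s w x) \<le> exp (k * \<theta> ^ n) * h (branch s w y)"
    by (rule LIMSEQ_le) (use regularD[OF assms(1) w] in blast)
qed

lemma regular_iterate:
  assumes g: "regular k g" "\<And>x. x \<in> X \<Longrightarrow> 0 \<le> g x" "0 \<le> k"
  shows "regular (K + k) ((L ^^ j) g)"
  unfolding regular_def
proof (intro allI ballI)
  fix n w x y assume w: "w \<in> words A n" and x: "x \<in> X" and y: "y \<in> X"
  note b = branch_in[OF w x] branch_in[OF w y]
  have "weight e v (branch s w x) * g (branch s v (branch s w x))
      \<le> exp ((K + k) * \<theta> ^ n) * (weight e v (branch s w y) * g (branch s v (branch s w y)))"
    if v: "v \<in> words A j" for v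
  proof -
    have "g (branch s (v @ w) x) \<le> exp (k * \<theta> ^ (j + n)) * g (branch s (v @ w) y)"
      by (rule regularD[OF g(1) words_append[OF v w] x y])
    also have "\<dots> \<le> exp (k * \<theta> ^ n) * g (branch s (v @ w) y)"
      using g(2)[OF branch_in[OF words_append[OF v w] y]] g(3) \<theta>01
      by (intro mult_right_mono) (auto intro!: mult_left_mono power_decreasing)
    finally have "weight e v (branch s w x) * g (branch s v (branch s w x)) \<le>
      (exp (K * \<theta> ^ n) * weight e v (branch s w y)) * (exp (k * \<theta> ^ n) * g (branch s v (branch s w y)))"
      using e_regular[OF v w x y] weight_pos[OF v] b g(2)[OF branch_in[OF v]]
      by (intro mult_mono) (auto simp: branch_append less_imp_le)
    thus ?thesis by (simp add: distrib_right exp_add mult_ac)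
  qed
  thus "(L ^^ j) g (branch s w x) \<le> exp ((K + k) * \<theta> ^ n) * (L ^^ j) g (branch s w y)"
    unfolding transfer_pow sum_distrib_left by (rule sum_mono)
qed

definition envelope :: "nat \<Rightarrow> 'a \<Rightarrow> real" where
  "envelope n x = (SUP k\<in>{n..}. partition_function k x)"

lemma bdd_partition_function: "x \<in> X \<Longrightarrow> bdd_above ((\<lambda>k. partition_function k x) ` S)"
  using partition_function_bounds(2) by (intro bdd_aboveI2)

lemma partition_le_envelope: "x \<in> X \<Longrightarrow> n \<le> k \<Longrightarrow> partition_function k x \<le> envelope n x"
  unfolding envelope_def by (intro cSUP_upper bdd_partition_function) auto

lemma envelope_least:
  "(\<And>k. n \<le> k \<Longrightarrow> partition_function k x \<le> c) \<Longrightarrow> envelope n x \<le> c"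
  unfolding envelope_def by (rule cSUP_least) auto

lemma envelope_bounds:
  assumes "x \<in> X"
  shows "1 / C \<le> envelope n x" "envelope n x \<le> C"
  using partition_function_bounds[OF assms] partition_le_envelope[OF assms, of n n]
  by (auto intro: envelope_least order_trans)

lemma envelope_decreasing: "x \<in> X \<Longrightarrow> m \<le> n \<Longrightarrow> envelope n x \<le> envelope m x"
  by (rule envelope_least) (auto intro: partition_le_envelope)

lemma envelope_Suc_le: "x \<in> X \<Longrightarrow> envelope (Suc n) x \<le> L (envelope n) x"
proof (rule envelope_least)
  fix k assume x: "x \<in> X" and k: "Suc n \<le> k"
  then obtain j where j: "k = Suc j" "n \<le> j" by (cases k) auto
  have "partition_function k x = (L ^^ 1) (partition_function j) x" by (simp add: j partition_function_def)
  also have "\<dots> \<le> (L ^^ 1) (envelope n) x" using x j by (intro L_pow_mono partition_le_envelope)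
  finally show "partition_function k x \<le> L (envelope n) x" by simp
qed

lemma envelope_regular: "regular (K + 0) (envelope n)"
  unfolding regular_def
proof (intro allI ballI)
  fix m w x y assume w: "w \<in> words A m" and x: "x \<in> X" and y: "y \<in> X"
  show "envelope n (branch s w x) \<le> exp ((K + 0) * \<theta> ^ m) * envelope n (branch s w y)"
  proof (rule envelope_least)
    fix k assume k: "n \<le> k"
    have "regular 0 (\<lambda>_. 1)" by (simp add: regular_def)
    hence "regular (K + 0) (partition_function k)" unfolding partition_function_def
      by (rule regular_iterate) auto
    from regularD[OF this w x y]
    have "partition_function k (branch s w x) \<le> exp ((K + 0) * \<theta> ^ m) * partition_function k (branch s w y)" .
    also have "\<dots> \<le> exp ((K + 0) * \<theta> ^ m) * envelope n (branch s w y)"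
      using partition_le_envelope[OF branch_in[OF w y] k] by (intro mult_left_mono) auto
    finally show "partition_function k (branch s w x) \<le> exp ((K + 0) * \<theta> ^ m) * envelope n (branch s w y)" .
  qed
qed

lemma L_limit:
  assumes "\<And>x. x \<in> X \<Longrightarrow> (\<lambda>i. g i x) \<longlonglongrightarrow> h x" "x \<in> X"
  shows "(\<lambda>i. L (g i) x) \<longlonglongrightarrow> L h x"
  unfolding transfer_def using assms by (intro tendsto_sum tendsto_mult_left) (auto simp: sX)

text \<open>
  The limit superior \<open>h0\<close> of the partition functions satisfies \<open>h0 \<le> L h0\<close>, so its iterates
  increase; they stay below \<open>C\<^sup>2\<close> and their limit is a fixed point. Both limits are pointwise
  and \<open>L\<close> is a finite sum, hence they commute with \<open>L\<close>.
\<close>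

lemma invariant_density:
  "\<exists>h. (\<forall>x\<in>X. 1 / C \<le> h x \<and> h x \<le> C\<^sup>2 \<and> L h x = h x) \<and> regular (2 * K) h"
proof -
  define h0 where "h0 x = (INF n. envelope n x)" for x
  have h0lim: "(\<lambda>n. envelope n x) \<longlonglongrightarrow> h0 x" if x: "x \<in> X" for x
    unfolding h0_def using envelope_bounds(1)[OF x] envelope_decreasing[OF x]
    by (intro LIMSEQ_decseq_INF bdd_belowI2) (auto simp: decseq_def)
  have h0b: "1 / C \<le> h0 x" "h0 x \<le> C" if x: "x \<in> X" for x
    using LIMSEQ_le_const[OF h0lim[OF x]] LIMSEQ_le_const2[OF h0lim[OF x]] envelope_bounds[OF x] by blast+
  have h0p: "0 \<le> h0 x" if x: "x \<in> X" for x
    by (rule order_trans[OF _ h0b(1)[OF x]]) (use C1 in auto)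
  have h0r: "regular K h0" using regular_limit[OF envelope_regular h0lim] by simp
  have h0s: "h0 x \<le> L h0 x" if x: "x \<in> X" for x
    using envelope_Suc_le[OF x] by (intro LIMSEQ_le[OF LIMSEQ_Suc[OF h0lim[OF x]] L_limit[OF h0lim x]]) auto
  define v where "v n = (L ^^ n) h0" for n
  have vinc: "v n x \<le> v (Suc n) x" if x: "x \<in> X" for n x
    using L_pow_mono[of h0 "L h0" x n] h0s x by (simp add: v_def funpow_Suc_right del: funpow.simps)
  have vub: "v n x \<le> C\<^sup>2" if x: "x \<in> X" for n x
  proof -
    have "v n x \<le> (L ^^ n) (\<lambda>_. C) x" unfolding v_def using h0b x by (intro L_pow_mono)
    also have "\<dots> = C * partition_function n x"
      by (simp add: partition_function_def transfer_pow sum_distrib_left mult_ac)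
    also have "\<dots> \<le> C * C" using partition_function_bounds[OF x] C1 by (intro mult_left_mono) auto
    finally show ?thesis by (simp add: power2_eq_square)
  qed
  define h where "h x = lim (\<lambda>n. v n x)" for x
  have hlim: "(\<lambda>n. v n x) \<longlonglongrightarrow> h x" if x: "x \<in> X" for x
  proof -
    have "incseq (\<lambda>n. v n x)" using vinc[OF x] by (rule incseq_SucI)
    moreover have "\<forall>i. v i x \<le> C\<^sup>2" using vub[OF x] by auto
    ultimately obtain l where "(\<lambda>n. v n x) \<longlonglongrightarrow> l" by (rule incseq_convergent)
    thus ?thesis unfolding h_def by (simp add: limI)
  qed
  have "L h x = h x" if x: "x \<in> X" for x
  proof -
    have "(\<lambda>n. v (Suc n) x) \<longlonglongrightarrow> L h x" using L_limit[OF hlim x] by (simp add: v_def)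
    thus ?thesis using LIMSEQ_Suc[OF hlim[OF x]] LIMSEQ_unique by blast
  qed
  moreover have "1 / C \<le> h x" if x: "x \<in> X" for x
  proof -
    have "v 0 x \<le> v n x" for n
      using incseqD[OF incseq_SucI[of "\<lambda>n. v n x", OF vinc[OF x]], of 0 n] by simp
    hence "h0 x \<le> h x" by (intro LIMSEQ_le_const[OF hlim[OF x]]) (auto simp: v_def)
    thus ?thesis using h0b(1)[OF x] by simp
  qed
  moreover have "h x \<le> C\<^sup>2" if x: "x \<in> X" for x
    using vub[OF x] by (intro LIMSEQ_le_const2[OF hlim[OF x]]) auto
  moreover have "regular (2 * K) h"
  proof (rule regular_limit[OF _ hlim])
    show "regular (2 * K) (v i)" for i
      using regular_iterate[OF h0r h0p K0, of i] by (simp add: v_def)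
  qed
  ultimately show ?thesis by blast
qed

text \<open>
  Multiplying \<open>e a x\<close> by \<open>h (s a x) / h x\<close>, with \<open>h\<close> the fixed point, makes the weights of the
  letters sum to one and changes the weight of a word by a bounded factor, so the comparison
  with the masses is kept.
\<close>

theorem normalised_weights:
  "\<exists>p B K'. markov_branches X A s p B K' \<theta> \<and>
     (\<forall>n. \<forall>w\<in>words A n. \<forall>x\<in>X. mass w \<le> B * weight p w x \<and> weight p w x \<le> B * mass w)"
proof -
  obtain h where h: "\<And>x. x \<in> X \<Longrightarrow> 1 / C \<le> h x" "\<And>x. x \<in> X \<Longrightarrow> h x \<le> C\<^sup>2"
    "\<And>x. x \<in> X \<Longrightarrow> L h x = h x" "regular (2 * K) h" using invariant_density by blast
  have h0: "0 < h x" if "x \<in> X" for x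
    by (rule less_le_trans[OF _ h(1)[OF that]]) (use C1 in auto)
  define p where "p a x = e a x * h (s a x) / h x" for a x
  have w: "weight p w x = weight e w x * h (branch s w x) / h x" if "w \<in> words A n" "x \<in> X" for w n x
    using that(1)
  proof (induction w arbitrary: n)
    case Nil
    thus ?case using h0[OF that(2)] by simp
  next
    case (Cons a w)
    hence w: "w \<in> words A (length w)" by (auto simp: words_def)
    have "h (branch s w x) \<noteq> 0" using h0[OF branch_in[OF w that(2)]] by simp
    thus ?case using Cons.IH[OF w] by (simp add: p_def)
  qed
  have hr: "h x / h y \<le> C ^ 3" if "x \<in> X" "y \<in> X" for x y
  proof -
    have "h x \<le> C\<^sup>2 * (C * h y)"
    proof -
      have "1 \<le> C * h y" using h(1)[OF that(2)] C1 by (simp add: field_simps)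
      hence "C\<^sup>2 * 1 \<le> C\<^sup>2 * (C * h y)" by (intro mult_left_mono) auto
      thus ?thesis using h(2)[OF that(1)] by linarith
    qed
    thus ?thesis using h0[OF that(2)] by (simp add: field_simps power2_eq_square power3_eq_cube)
  qed
  have up: "weight p w x \<le> C ^ 4 * mass w" if ww: "w \<in> words A n" and x: "x \<in> X" for w n x
  proof -
    have "weight p w x = weight e w x * (h (branch s w x) / h x)" using w[OF ww x] by simp
    also have "\<dots> \<le> (C * mass w) * C ^ 3"
      using gibbs_upper[OF ww x] hr[OF branch_in[OF ww x] x] weight_pos[OF ww x] h0[OF x] h0[OF branch_in[OF ww x]]
      by (intro mult_mono) auto
    finally show ?thesis by (simp add: eval_nat_numeral mult_ac)
  qed
  have lo: "mass w \<le> C ^ 4 * weight p w x" if ww: "w \<in> words A n" and x: "x \<in> X" for w n x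
  proof -
    note b = branch_in[OF ww x]
    have "mass w \<le> C * weight e w x" by (rule gibbs_lower[OF ww x])
    also have "weight e w x = weight p w x * (h x / h (branch s w x))"
      using w[OF ww x] h0[OF x] h0[OF b] by simp
    also have "\<dots> \<le> weight p w x * C ^ 3"
      using hr[OF x b] w[OF ww x] weight_pos[OF ww x] h0[OF x] h0[OF b] by (intro mult_left_mono) auto
    finally show ?thesis using C1 by (simp add: eval_nat_numeral mult_ac)
  qed
  have "markov_branches X A s p (C ^ 8) (5 * K) \<theta>"
  proof unfold_locales
    show "0 \<le> p a x" if "a \<in> A" "x \<in> X" for a x
      using that e_pos[OF that] h0[OF that(2)] h0[OF sX[OF that]] by (simp add: p_def)
    show "(\<Sum>a\<in>A. p a x) = 1" if "x \<in> X" for x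
      using h(3)[OF that] h0[OF that] by (simp add: p_def transfer_def flip: sum_divide_distrib)
    show "weight p w x \<le> C ^ 8 * weight p w y" if ww: "w \<in> words A n" and xy: "x \<in> X" "y \<in> X" for w n x y
    proof -
      have "weight p w x \<le> C ^ 4 * mass w" by (rule up[OF ww xy(1)])
      also have "\<dots> \<le> C ^ 4 * (C ^ 4 * weight p w y)" using lo[OF ww xy(2)] C1 by (intro mult_left_mono) auto
      finally show ?thesis by (simp add: mult.assoc[symmetric] power_add[symmetric])
    qed
    show "weight p v (branch s w x) \<le> exp (5 * K * \<theta> ^ n) * weight p v (branch s w y)"
      if v: "v \<in> words A k" and ww: "w \<in> words A n" and x: "x \<in> X" and y: "y \<in> X" for v k w n x y
    proof -
      note b = branch_in[OF ww x] branch_in[OF ww y]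
      note bb = branch_in[OF v b(1)] branch_in[OF v b(2)]
      have "h (branch s (v @ w) x) \<le> exp (2 * K * \<theta> ^ (k + n)) * h (branch s (v @ w) y)"
        by (rule regularD[OF h(4) words_append[OF v ww] x y])
      also have "\<dots> \<le> exp (2 * K * \<theta> ^ n) * h (branch s (v @ w) y)"
        using h0[OF branch_in[OF words_append[OF v ww] y]] K0 \<theta>01
        by (intro mult_right_mono) (auto intro!: mult_left_mono power_decreasing)
      finally have 1: "h (branch s v (branch s w x)) \<le> exp (2 * K * \<theta> ^ n) * h (branch s v (branch s w y))"
        by (simp add: branch_append)
      have "h (branch s w y) \<le> exp (2 * K * \<theta> ^ n) * h (branch s w x)" by (rule regularD[OF h(4) ww y x])
      hence 2: "1 / h (branch s w x) \<le> exp (2 * K * \<theta> ^ n) / h (branch s w y)"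
        using h0[OF b(1)] h0[OF b(2)] by (simp add: field_simps)
      have "weight p v (branch s w x) = weight e v (branch s w x) * h (branch s v (branch s w x)) * (1 / h (branch s w x))"
        using w[OF v b(1)] by simp
      also have "\<dots> \<le> (exp (K * \<theta> ^ n) * weight e v (branch s w y)) * (exp (2 * K * \<theta> ^ n) * h (branch s v (branch s w y)))
          * (exp (2 * K * \<theta> ^ n) / h (branch s w y))"
        using e_regular[OF v ww x y] 1 2 weight_pos[OF v b(1)] weight_pos[OF v b(2)] h0[OF b(1)] h0[OF b(2)] h0[OF bb(1)] h0[OF bb(2)]
        by (intro mult_mono) auto
      also have "\<dots> = (exp (K * \<theta> ^ n) * exp (2 * K * \<theta> ^ n) * exp (2 * K * \<theta> ^ n)) * weight p v (branch s w y)"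
        using w[OF v b(2)] by simp
      also have "exp (K * \<theta> ^ n) * exp (2 * K * \<theta> ^ n) * exp (2 * K * \<theta> ^ n) = exp (5 * K * \<theta> ^ n)"
        by (simp flip: exp_add)
      finally show ?thesis .
    qed
  qed (use K0 \<theta>01 C1 in auto)
  moreover have "mass w \<le> C ^ 8 * weight p w x \<and> weight p w x \<le> C ^ 8 * mass w"
    if ww: "w \<in> words A n" and x: "x \<in> X" for w n x
  proof -
    have "C ^ 4 \<le> C ^ 8" using C1 by (intro power_increasing) auto
    moreover have "0 \<le> weight p w x"
      using w[OF ww x] weight_pos[OF ww x] h0[OF x] h0[OF branch_in[OF ww x]] by simp
    moreover from this have "0 \<le> mass w" using up[OF ww x] C1
      by (smt (verit) zero_less_power mult_pos_neg)
    ultimately show ?thesis using up[OF ww x] lo[OF ww x] by (meson mult_right_mono order_trans)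
  qed
  ultimately show ?thesis by blast
qed

end

section \<open>Structure of a full-branch map\<close>

lemma interval_mean_value:
  fixes g g' :: "real \<Rightarrow> real"
  assumes "is_interval S" and d: "\<And>z. z \<in> S \<Longrightarrow> (g has_real_derivative g' z) (at z within S)"
    and "x \<in> S" "y \<in> S" "x \<noteq> y"
  shows "\<exists>z\<in>S. g x - g y = g' z * (x - y)"
proof -
  have *: "\<exists>z\<in>S. g y - g x = g' z * (y - x)" if "x \<in> S" "y \<in> S" "x < y" for x y
  proof -
    have sub: "{x..y} \<subseteq> S" using mem_is_interval_1_I[OF assms(1) that(1,2)] by auto
    have "(g has_derivative (\<lambda>h. g' z * h)) (at z within {x..y})" if "x \<le> z" "z \<le> y" for z
      using has_derivative_subset[OF d[of z, unfolded has_field_derivative_def] sub] sub that by auto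
    from mvt_simple[OF \<open>x < y\<close> this] show ?thesis using sub by fastforce
  qed
  show ?thesis
  proof (cases "x < y")
    case True
    then obtain z where "z \<in> S" "g y - g x = g' z * (y - x)" using * assms by blast
    thus ?thesis by (intro bexI[of _ z]) (auto simp: algebra_simps)
  next
    case False
    thus ?thesis using *[of y x] assms by auto
  qed
qed

lemma at_within_interval_nontrivial:
  fixes S :: "real set"
  assumes "is_interval S" "x \<in> S" "y \<in> S" "y \<noteq> x"
  shows "at x within S \<noteq> bot"
proof -
  have "x islimpt S"
    using assms by (intro connected_imp_perfect) (auto simp: is_interval_connected_1)
  thus ?thesis by (simp add: trivial_limit_within)
qed

lemma bounded_if_bdd:
  fixes P :: "real set"
  assumes "bdd_below P" "bdd_above P"
  shows "bounded P"
proof -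
  obtain a b where "\<And>x. x \<in> P \<Longrightarrow> a \<le> x" "\<And>x. x \<in> P \<Longrightarrow> x \<le> b"
    using assms by (auto simp: bdd_below_def bdd_above_def)
  hence "P \<subseteq> {a..b}" by auto
  thus ?thesis by (rule bounded_subset[OF bounded_closed_interval])
qed

lemma disjoint_unbounded_intervals:
  fixes P Q :: "real set"
  assumes P: "is_interval P" "\<not> bounded P" and Q: "is_interval Q" "\<not> bounded Q"
    and disj: "P \<inter> Q = {}" and lt: "p \<in> P" "q \<in> Q" "p < q"
  shows "bdd_above P" "\<forall>m. \<exists>x\<in>P. x < m" "\<forall>m. \<exists>x\<in>Q. m < x"
proof -
  have Pq: "x < q" if "x \<in> P" for x
  proof (rule ccontr)
    assume "\<not> x < q"
    hence "q \<in> P" using mem_is_interval_1_I[OF P(1) lt(1) that, of q] lt by auto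
    thus False using disj lt by auto
  qed
  have Qp: "p < x" if "x \<in> Q" for x
  proof (rule ccontr)
    assume "\<not> p < x"
    hence "p \<in> Q" using mem_is_interval_1_I[OF Q(1) that lt(2), of p] lt by auto
    thus False using disj lt by auto
  qed
  show a: "bdd_above P" using Pq by (auto intro!: bdd_aboveI[of _ q] less_imp_le)
  have b: "bdd_below Q" using Qp by (auto intro!: bdd_belowI[of _ p] less_imp_le)
  show "\<forall>m. \<exists>x\<in>P. x < m"
  proof (rule ccontr)
    assume "\<not> (\<forall>m. \<exists>x\<in>P. x < m)"
    hence "bdd_below P" by (auto simp: bdd_below_def not_less)
    thus False using a P(2) bounded_if_bdd by blast
  qed
  show "\<forall>m. \<exists>x\<in>Q. m < x"
  proof (rule ccontr)
    assume "\<not> (\<forall>m. \<exists>x\<in>Q. m < x)"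
    hence "bdd_above Q" by (auto simp: bdd_above_def not_less)
    thus False using b Q(2) bounded_if_bdd by blast
  qed
qed

text \<open>
  Removing its largest point leaves the half-line connected, whereas the line falls apart.
\<close>

lemma bounded_above_not_homeomorphic_line:
  fixes P :: "real set" and g :: "real \<Rightarrow> real"
  assumes P: "is_interval P" "bdd_above P" "P \<noteq> {}" and g: "continuous_on (closure P) g"
  shows "\<not> bij_betw g (closure P) UNIV"
proof
  assume bij: "bij_betw g (closure P) UNIV"
  define e where "e = Sup P"
  have e: "e \<in> closure P" unfolding e_def by (rule closure_contains_Sup[OF P(3,2)])
  have le: "x \<le> e" if "x \<in> closure P" for x
  proof -
    have "closure P \<subseteq> {..e}" unfolding e_def
      using P(2) by (intro closure_minimal) (auto intro: cSup_upper)
    thus ?thesis using that by auto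
  qed
  have "closure P - {e} = closure P \<inter> {..<e}" using le by force
  moreover have "is_interval (closure P)"
    using P(1) by (simp add: is_interval_convex_1 convex_closure)
  ultimately have "connected (closure P - {e})"
    by (simp add: is_interval_connected_1[symmetric] is_interval_Int is_interval_io)
  hence "connected (g ` (closure P - {e}))" by (intro connected_continuous_image continuous_on_subset[OF g]) auto
  moreover have "g ` (closure P - {e}) = UNIV - {g e}"
    using bij e by (subst inj_on_image_set_diff[where C = "closure P"]) (auto simp: bij_betw_def)
  ultimately have "is_interval (UNIV - {g e})" by (simp add: is_interval_connected_1)
  hence "g e \<in> UNIV - {g e}"
    by (rule mem_is_interval_1_I[of _ "g e - 1" "g e + 1"]) auto
  thus False by simp
qed

locale gibbs_interval =
  fixes I :: "real set" and \<P> :: "real set set"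
    and f \<phi> :: "real \<Rightarrow> real" and M :: "real measure"
  assumes fb: "full_branch_map I \<P> f"
    and bd: "bounded_distortion I \<P> f"
    and hol: "\<forall>P\<in>\<P>. holder_on P \<phi>"
    and bp: "borel_probability_on I M"
    and inv: "invariant_measure f M"
    and gibbs: "gibbs_measure I \<P> f \<phi> M"
    and full: "supp M = I"
begin

lemma prob_M: "prob_space M" using bp by (simp add: borel_probability_on_def)

sublocale prob_space M by (rule prob_M)

lemma sets_M: "sets M = sets (restrict_space borel I)" using bp by (simp add: borel_probability_on_def)

lemma space_M [simp]: "space M = I"
  using sets_eq_imp_space_eq[OF sets_M] by (simp add: space_restrict_space)

lemma I_borel_in_sets: "S \<in> sets borel \<Longrightarrow> S \<inter> I \<in> sets M"
  unfolding sets_M sets_restrict_space by blast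

lemma interval_in_sets: "is_interval S \<Longrightarrow> S \<subseteq> I \<Longrightarrow> S \<in> sets M"
  using I_borel_in_sets[of S] real_interval_borel_measurable[of S] by (simp add: Int_absorb2)

lemma f_measurable [measurable]: "f \<in> measurable M M" using inv by (simp add: invariant_measure_def)

lemma f_pow_measurable [measurable]: "f ^^ n \<in> measurable M M"
  by (induction n) (auto intro: measurable_comp simp: id_def)

lemma measure_vimage_f: "E \<in> sets M \<Longrightarrow> measure M ((f ^^ n) -` E \<inter> I) = measure M E"
proof (induction n)
  case 0
  thus ?case using sets.sets_into_space[of E M] by (simp add: Int_absorb2)
next
  case (Suc n)
  have *: "(f ^^ n) -` E \<inter> I \<in> sets M"
    using measurable_sets[OF f_pow_measurable Suc.prems, of n] by simp
  have d: "distr M M f = M" using inv by (simp add: invariant_measure_def)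
  have "measure M ((f ^^ n) -` E \<inter> I) = measure (distr M M f) ((f ^^ n) -` E \<inter> I)" by (simp add: d)
  also have "\<dots> = measure M (f -` ((f ^^ n) -` E \<inter> I) \<inter> I)" using * by (subst measure_distr) auto
  also have "f -` ((f ^^ n) -` E \<inter> I) \<inter> I = (f ^^ Suc n) -` E \<inter> I"
    using measurable_space[OF f_measurable] by (auto simp: funpow_Suc_right simp del: funpow.simps)
  finally show ?case using Suc.IH[OF Suc.prems] by (simp del: funpow.simps)
qed

lemma ball_measure_pos: "x \<in> I \<Longrightarrow> 0 < r \<Longrightarrow> 0 < measure M (ball x r \<inter> I)"
  using full unfolding supp_def ball_measure_def by auto

lemma I_interval: "is_interval I" and I_int: "interior I \<noteq> {}" and fin_P: "finite \<P>" and part: "partition_on I \<P>"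
  using fb by (auto simp: full_branch_map_def)

lemma P_facts:
  assumes "P \<in> \<P>"
  shows "is_interval P" "Ck_on 2 P f" "uniformly_expanding_on P f"
    "\<exists>g. (\<forall>x\<in>P. g x = f x) \<and> diffeomorphism_betw g (closure P) I"
  using fb assms by (auto simp: full_branch_map_def)

lemma P_sub: "P \<in> \<P> \<Longrightarrow> P \<subseteq> I" and P_ne: "P \<in> \<P> \<Longrightarrow> P \<noteq> {}"
  and P_cover: "x \<in> I \<Longrightarrow> \<exists>P\<in>\<P>. x \<in> P"
  and P_unique: "P \<in> \<P> \<Longrightarrow> Q \<in> \<P> \<Longrightarrow> x \<in> P \<Longrightarrow> x \<in> Q \<Longrightarrow> P = Q"
  using part by (auto simp: partition_on_def disjoint_def)

lemma I_two_points: "\<exists>x\<in>I. \<exists>y\<in>I. x < y"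
proof -
  obtain x where "x \<in> interior I" using I_int by auto
  then obtain e where "e > 0" "cball x e \<subseteq> I" using mem_interior_cball by blast
  moreover have "x \<in> cball x e" "x + e \<in> cball x e" using \<open>e > 0\<close> by (auto simp: dist_real_def)
  ultimately show ?thesis by (intro bexI[of _ x] bexI[of _ "x + e"]) auto
qed

text \<open>
  The continuous extension of the branch to the closed interval. It can differ from \<open>f\<close> at an
  end point that belongs to a neighbouring element of the partition.
\<close>

definition ext :: "real set \<Rightarrow> real \<Rightarrow> real" where
  "ext P = (SOME g. (\<forall>x\<in>P. g x = f x) \<and> diffeomorphism_betw g (closure P) I)"

definition inv_branch :: "real set \<Rightarrow> real \<Rightarrow> real" where
  "inv_branch P = inv_into (closure P) (ext P)"

lemma Ck1_continuous: "Ck_on 1 S g \<Longrightarrow> continuous_on S g"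
  by (auto simp: One_nat_def continuous_on_eq_continuous_within intro: DERIV_continuous)

lemma ext:
  assumes "P \<in> \<P>"
  shows "x \<in> P \<Longrightarrow> ext P x = f x" "bij_betw (ext P) (closure P) I" "continuous_on (closure P) (ext P)"
    "continuous_on I (inv_branch P)"
proof -
  have *: "(\<forall>x\<in>P. ext P x = f x) \<and> diffeomorphism_betw (ext P) (closure P) I"
    unfolding ext_def by (rule someI_ex[OF P_facts(4)[OF assms]])
  thus "x \<in> P \<Longrightarrow> ext P x = f x" "bij_betw (ext P) (closure P) I" by (auto simp: diffeomorphism_betw_def)
  have 1: "Ck_on 1 (closure P) (ext P)" and 2: "Ck_on 1 I (inv_branch P)"
    using * unfolding diffeomorphism_betw_def inv_branch_def by blast+
  show "continuous_on (closure P) (ext P)" by (rule Ck1_continuous[OF 1])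
  show "continuous_on I (inv_branch P)" by (rule Ck1_continuous[OF 2])
qed

lemma inv_branch:
  assumes "P \<in> \<P>" "x \<in> I"
  shows "inv_branch P x \<in> closure P" "ext P (inv_branch P x) = x"
  using ext(2)[OF assms(1)] assms(2) unfolding inv_branch_def
  by (auto simp: bij_betw_def inv_into_into f_inv_into_f)

lemma inv_branch_ext: "P \<in> \<P> \<Longrightarrow> y \<in> closure P \<Longrightarrow> inv_branch P (ext P y) = y"
  using ext(2) unfolding inv_branch_def by (auto simp: bij_betw_def)

lemma f_in_I: "x \<in> I \<Longrightarrow> f x \<in> I"
  using measurable_space[OF f_measurable] by simp

lemma f_pow_in_I: "x \<in> I \<Longrightarrow> (f ^^ n) x \<in> I"
  by (induction n) (auto intro: f_in_I)

lemma P_two_points: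
  assumes "P \<in> \<P>" "x \<in> P"
  shows "\<exists>y\<in>P. y \<noteq> x"
proof (rule ccontr)
  assume "\<not> (\<exists>y\<in>P. y \<noteq> x)"
  hence "P = {x}" using assms(2) by blast
  hence cl: "closure P = {x}" by simp
  have *: "ext P x = z" if "z \<in> I" for z
  proof -
    have e: "inv_branch P z = x" using inv_branch(1)[OF assms(1) that] unfolding cl by (rule singletonD)
    show ?thesis using inv_branch(2)[OF assms(1) that] by (simp only: e)
  qed
  obtain u v where uv: "u \<in> I" "v \<in> I" "u < v" using I_two_points by blast
  have "u = v" by (rule trans[OF *[OF uv(1), symmetric] *[OF uv(2)]])
  thus False using uv(3) by simp
qed

lemma f_deriv:
  assumes "P \<in> \<P>"
  shows "\<exists>f'. \<forall>x\<in>P. (f has_real_derivative f' x) (at x within P)"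
  using P_facts(2)[OF assms] by (auto simp: numeral_2_eq_2)

lemma f_expands_P:
  assumes P: "P \<in> \<P>"
  shows "\<exists>\<kappa>>1. \<forall>x\<in>P. \<forall>y\<in>P. \<kappa> * \<bar>x - y\<bar> \<le> \<bar>f x - f y\<bar>"
proof -
  obtain \<kappa> where \<kappa>: "\<kappa> > 1" "\<And>x. x \<in> P \<Longrightarrow> \<kappa> \<le> \<bar>vector_derivative f (at x within P)\<bar>"
    using P_facts(3)[OF P] by (auto simp: uniformly_expanding_on_def)
  obtain f' where f': "\<And>x. x \<in> P \<Longrightarrow> (f has_real_derivative f' x) (at x within P)" using f_deriv[OF P] by blast
  have k: "\<kappa> \<le> \<bar>f' x\<bar>" if x: "x \<in> P" for x
  proof -
    have nb: "at x within P \<noteq> bot"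
      using P_two_points[OF P x] at_within_interval_nontrivial[OF P_facts(1)[OF P] x] by auto
    show ?thesis using \<kappa>(2)[OF x] vector_derivative_within[OF nb f'[OF x, unfolded has_real_derivative_iff_has_vector_derivative]]
      by simp
  qed
  have "\<kappa> * \<bar>x - y\<bar> \<le> \<bar>f x - f y\<bar>" if xy: "x \<in> P" "y \<in> P" for x y
  proof (cases "x = y")
    case False
    obtain z where z: "z \<in> P" "f x - f y = f' z * (x - y)"
      using interval_mean_value[OF P_facts(1)[OF P] f' xy False] by blast
    show ?thesis unfolding z(2) abs_mult using k[OF z(1)] by (intro mult_right_mono) auto
  qed auto
  thus ?thesis using \<kappa>(1) by blast
qed

lemma uniform_expansion: "\<exists>\<kappa>>1. \<forall>P\<in>\<P>. \<forall>x\<in>P. \<forall>y\<in>P. \<kappa> * \<bar>x - y\<bar> \<le> \<bar>f x - f y\<bar>"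
proof -
  have "\<forall>P\<in>\<P>. \<exists>\<kappa>>1. \<forall>x\<in>P. \<forall>y\<in>P. \<kappa> * \<bar>x - y\<bar> \<le> \<bar>f x - f y\<bar>" using f_expands_P by blast
  then obtain k where k: "\<And>P. P \<in> \<P> \<Longrightarrow> k P > 1"
     "\<And>P x y. P \<in> \<P> \<Longrightarrow> x \<in> P \<Longrightarrow> y \<in> P \<Longrightarrow> k P * \<bar>x - y\<bar> \<le> \<bar>f x - f y\<bar>" by metis
  have ne: "\<P> \<noteq> {}" using P_cover I_two_points by blast
  define \<kappa> where "\<kappa> = Min (k ` \<P>)"
  have "\<kappa> > 1" unfolding \<kappa>_def using ne fin_P k(1) by (subst Min_gr_iff) auto
  moreover have "\<kappa> * \<bar>x - y\<bar> \<le> \<bar>f x - f y\<bar>" if "P \<in> \<P>" "x \<in> P" "y \<in> P" for P x y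
  proof -
    have "\<kappa> \<le> k P" unfolding \<kappa>_def using that fin_P by (intro Min_le) auto
    hence "\<kappa> * \<bar>x - y\<bar> \<le> k P * \<bar>x - y\<bar>" by (intro mult_right_mono) auto
    thus ?thesis using k(2)[OF that] by linarith
  qed
  ultimately show ?thesis by blast
qed

definition expansion :: real where
  "expansion = (SOME \<kappa>. \<kappa> > 1 \<and> (\<forall>P\<in>\<P>. \<forall>x\<in>P. \<forall>y\<in>P. \<kappa> * \<bar>x - y\<bar> \<le> \<bar>f x - f y\<bar>))"

lemma expansion: "1 < expansion"
  "P \<in> \<P> \<Longrightarrow> x \<in> P \<Longrightarrow> y \<in> P \<Longrightarrow> expansion * \<bar>x - y\<bar> \<le> \<bar>f x - f y\<bar>"
proof -
  have "expansion > 1 \<and> (\<forall>P\<in>\<P>. \<forall>x\<in>P. \<forall>y\<in>P. expansion * \<bar>x - y\<bar> \<le> \<bar>f x - f y\<bar>)"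
    unfolding expansion_def by (rule someI_ex) (rule uniform_expansion)
  thus "1 < expansion" "P \<in> \<P> \<Longrightarrow> x \<in> P \<Longrightarrow> y \<in> P \<Longrightarrow> expansion * \<bar>x - y\<bar> \<le> \<bar>f x - f y\<bar>" by auto
qed

text \<open>
  If \<open>f\<close> expanded all of \<open>I\<close> as a single branch, the preimages under \<open>f ^^ n\<close> of a bounded set
  of nearly full measure would have the same measure and diameters tending to zero, so they
  could not meet two fixed balls of positive measure.
\<close>

lemma several_branches: "I \<notin> \<P>"
proof
  assume IP: "I \<in> \<P>"
  have ex: "expansion ^ n * \<bar>x - y\<bar> \<le> \<bar>(f ^^ n) x - (f ^^ n) y\<bar>" if "x \<in> I" "y \<in> I" for n x y
  proof (induction n)
    case (Suc n)
    have "expansion * (expansion ^ n * \<bar>x - y\<bar>) \<le> expansion * \<bar>(f ^^ n) x - (f ^^ n) y\<bar>"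
      using Suc expansion(1) by (intro mult_left_mono) auto
    also have "\<dots> \<le> \<bar>f ((f ^^ n) x) - f ((f ^^ n) y)\<bar>"
      using that by (intro expansion(2)[OF IP]) (auto intro: f_pow_in_I)
    finally show ?case by (simp add: mult.assoc)
  qed simp
  obtain p q where pq: "p \<in> I" "q \<in> I" "p < q" using I_two_points by blast
  define \<rho> where "\<rho> = (q - p) / 3"
  have \<rho>: "\<rho> > 0" using pq by (simp add: \<rho>_def)
  \<comment> \<open>A set of measure above \<open>1 - \<beta>\<close> meets both balls, which are \<open>\<rho>\<close> apart.\<close>
  define \<beta> where "\<beta> = min (measure M (ball p \<rho> \<inter> I)) (measure M (ball q \<rho> \<inter> I))"
  have \<beta>: "0 < \<beta>" using ball_measure_pos \<rho> pq by (simp add: \<beta>_def)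
  have bs: "ball c r \<inter> I \<in> sets M" for c r by (rule I_borel_in_sets) simp
  define B where "B n = {- real n..real n} \<inter> I" for n :: nat
  have Bs: "B n \<in> sets M" for n unfolding B_def by (rule I_borel_in_sets) simp
  have "x \<in> (\<Union>n. B n)" if "x \<in> I" for x
  proof -
    obtain n where "\<bar>x\<bar> \<le> real n" using real_arch_simple by blast
    thus ?thesis using that by (auto simp: B_def abs_le_iff intro!: exI[of _ n])
  qed
  hence "(\<Union>n. B n) = I" by (auto simp: B_def)
  moreover have "incseq B" unfolding incseq_def B_def by (auto intro: order_trans[of _ "real _"])
  ultimately have "(\<lambda>n. measure M (B n)) \<longlonglongrightarrow> 1"
    using finite_Lim_measure_incseq[of B] Bs prob_space by (simp add: image_subset_iff)
  hence "eventually (\<lambda>n. 1 - \<beta> < measure M (B n)) sequentially"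
    using \<beta> by (intro order_tendstoD) auto
  then obtain m where m: "1 - \<beta> < measure M (B m)" by (auto simp: eventually_sequentially)
  have key: "expansion ^ n * \<rho> \<le> 2 * real m" for n
  proof -
    define E where "E = (f ^^ n) -` B m \<inter> I"
    have Es: "E \<in> sets M" using measurable_sets[OF f_pow_measurable Bs, of n m] by (simp add: E_def)
    have ME: "measure M E = measure M (B m)" unfolding E_def by (rule measure_vimage_f[OF Bs])
    have meet: "E \<inter> (ball c \<rho> \<inter> I) \<noteq> {}" if "\<beta> \<le> measure M (ball c \<rho> \<inter> I)" for c
    proof
      assume "E \<inter> (ball c \<rho> \<inter> I) = {}"
      hence "measure M (E \<union> (ball c \<rho> \<inter> I)) = measure M E + measure M (ball c \<rho> \<inter> I)"
        using Es bs by (intro finite_measure_Union) auto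
      thus False using prob_le_1[of "E \<union> (ball c \<rho> \<inter> I)"] m ME that by linarith
    qed
    obtain x where x: "x \<in> E" "x \<in> ball p \<rho>" using meet[of p] by (auto simp: \<beta>_def)
    obtain y where y: "y \<in> E" "y \<in> ball q \<rho>" using meet[of q] by (auto simp: \<beta>_def)
    have "x - p < \<rho>" "q - y < \<rho>" using x(2) y(2) by (auto simp: dist_real_def)
    moreover have "q - p = 3 * \<rho>" by (simp add: \<rho>_def)
    ultimately have "\<rho> \<le> \<bar>x - y\<bar>" by linarith
    hence "expansion ^ n * \<rho> \<le> expansion ^ n * \<bar>x - y\<bar>" using expansion(1) by (intro mult_left_mono) auto
    also have "\<dots> \<le> \<bar>(f ^^ n) x - (f ^^ n) y\<bar>" using x y by (intro ex) (auto simp: E_def)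
    also have "\<dots> \<le> 2 * real m" using x y unfolding E_def B_def by auto
    finally show ?thesis .
  qed
  obtain n where "2 * real m / \<rho> < expansion ^ n" using real_arch_pow[OF expansion(1)] by blast
  thus False using key[of n] \<rho> by (simp add: field_simps)
qed

text \<open>
  For bounded \<open>I\<close> this is the continuity of a branch on the compact closure of its domain.
  Otherwise all elements of the partition are unbounded, and as there are several of them \<open>I\<close>
  is the whole line, one of them being bounded above; but no half-line is mapped bijectively
  and continuously onto the line.
\<close>

lemma I_compact: "compact I"
proof (cases "bounded I")
  case True
  obtain P where P: "P \<in> \<P>" using P_cover I_two_points by blast
  have "bounded (closure P)" using True P_sub[OF P] bounded_subset bounded_closure by blast
  hence "compact (closure P)" by (simp add: compact_eq_bounded_closed)
  hence "compact (ext P ` closure P)" using ext(3)[OF P] by (intro compact_continuous_image)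
  thus ?thesis using ext(2)[OF P] by (simp add: bij_betw_def)
next
  case False
  have unb: "\<not> bounded P" if P: "P \<in> \<P>" for P
  proof
    assume "bounded P"
    hence "compact (closure P)" by (simp add: compact_eq_bounded_closed bounded_closure)
    hence "compact (ext P ` closure P)" using ext(3)[OF P] by (intro compact_continuous_image)
    thus False using ext(2)[OF P] False by (simp add: bij_betw_def compact_imp_bounded)
  qed
  have no: False if PQ: "P \<in> \<P>" "Q \<in> \<P>" "p \<in> P" "q \<in> Q" "p < q" "P \<inter> Q = {}" for P Q p q
  proof -
    note D = disjoint_unbounded_intervals[OF P_facts(1)[OF PQ(1)] unb[OF PQ(1)] P_facts(1)[OF PQ(2)] unb[OF PQ(2)] PQ(6,3-5)]
    have "x \<in> I" for x
    proof -
      obtain y z where "y \<in> P" "y < x" "z \<in> Q" "x < z" using D(2,3) by blast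
      thus ?thesis using mem_is_interval_1_I[OF I_interval, of y z x] P_sub[OF PQ(1)] P_sub[OF PQ(2)] by auto
    qed
    hence "I = UNIV" by auto
    thus False using bounded_above_not_homeomorphic_line[OF P_facts(1)[OF PQ(1)] D(1) P_ne[OF PQ(1)] ext(3)[OF PQ(1)]]
       ext(2)[OF PQ(1)] by simp
  qed
  obtain P p where P: "P \<in> \<P>" "p \<in> P" using P_cover I_two_points by blast
  have "P \<noteq> I" using several_branches P by auto
  then obtain q where q: "q \<in> I" "q \<notin> P" using P_sub[OF P(1)] by auto
  obtain Q where Q: "Q \<in> \<P>" "q \<in> Q" using P_cover[OF q(1)] by blast
  have disj: "P \<inter> Q = {}" using P_unique[OF P(1) Q(1)] Q q by blast
  have "p < q \<or> q < p" using disj P Q by (metis IntI empty_iff linorder_neqE)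
  thus ?thesis using no[OF P(1) Q(1) P(2) Q(2)] no[OF Q(1) P(1) Q(2) P(2)] disj by auto
qed

lemma I_eq: "\<exists>a b. a < b \<and> I = {a..b}"
proof -
  have "connected I" using I_interval by (simp add: is_interval_connected_1)
  then obtain a b where "I = {a..b}" using I_compact connected_compact_interval_1[of I] by auto
  moreover from this have "a < b" using I_two_points by force
  ultimately show ?thesis by blast
qed

section \<open>Cylinders\<close>

text \<open>
  The recursion makes cylinders available for induction on the word; \<open>cyl_eq\<close> identifies them
  with the sets that occur in \<open>cylinders\<close>.
\<close>

primrec cyl :: "real set list \<Rightarrow> real set" where
  "cyl [] = I"
| "cyl (P # w) = {x \<in> P. f x \<in> cyl w}"

lemma words_Cons: "P # w \<in> words A n \<Longrightarrow> \<exists>m. n = Suc m \<and> P \<in> A \<and> w \<in> words A m"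
  by (auto simp: words_def)

lemma words_ConsI: "P \<in> A \<Longrightarrow> w \<in> words A m \<Longrightarrow> P # w \<in> words A (Suc m)"
  by (auto simp: words_def)

lemma words_cases:
  assumes "w \<in> words A n"
  obtains "w = []" "n = 0" | P v m where "w = P # v" "n = Suc m" "P \<in> A" "v \<in> words A m"
  using assms words_Cons by (cases w) (auto simp: words_def)

lemma cyl_sub: "w \<in> words \<P> n \<Longrightarrow> cyl w \<subseteq> I"
  by (erule words_cases) (use P_sub in auto)

lemma cyl_eq: "w \<in> words \<P> n \<Longrightarrow> cyl w = {x \<in> I. \<forall>i<n. (f ^^ i) x \<in> w ! i}"
proof (induction w arbitrary: n)
  case Nil
  thus ?case by (auto simp: words_def)
next
  case (Cons P w)
  obtain m where m: "n = Suc m" "P \<in> \<P>" "w \<in> words \<P> m" using words_Cons[OF Cons.prems(1)] by blast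
  have "x \<in> cyl (P # w) \<longleftrightarrow> x \<in> I \<and> (\<forall>i<n. (f ^^ i) x \<in> (P # w) ! i)" for x
  proof -
    have "x \<in> cyl (P # w) \<longleftrightarrow> x \<in> I \<and> x \<in> P \<and> (\<forall>i<m. (f ^^ Suc i) x \<in> w ! i)"
    proof -
      have sh: "(f ^^ Suc i) x = (f ^^ i) (f x)" for i by (simp only: funpow_Suc_right o_apply)
      have "x \<in> P \<Longrightarrow> x \<in> I" using P_sub[OF m(2)] by blast
      thus ?thesis unfolding sh cyl.simps(2) Cons.IH[OF m(3)] mem_Collect_eq using f_in_I by blast
    qed
    also have "\<dots> \<longleftrightarrow> x \<in> I \<and> (\<forall>i<n. (f ^^ i) x \<in> (P # w) ! i)"
      unfolding m(1) All_less_Suc2 by simp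
    finally show ?thesis .
  qed
  thus ?case by blast
qed

lemma cyl_in_cylinders: "w \<in> words \<P> n \<Longrightarrow> cyl w \<noteq> {} \<Longrightarrow> cyl w \<in> cylinders I \<P> f n"
  unfolding cylinders_def using cyl_eq[of w n]
  by (intro CollectI conjI exI[of _ "\<lambda>i. w ! i"]) (auto simp: words_def)

lemma inv_branch_f: "P \<in> \<P> \<Longrightarrow> x \<in> P \<Longrightarrow> inv_branch P (f x) = x"
  using inv_branch_ext[of P x] ext(1)[of P x] closure_subset[of P] by auto

lemma f_inv_branch: "P \<in> \<P> \<Longrightarrow> x \<in> I \<Longrightarrow> inv_branch P x \<in> P \<Longrightarrow> f (inv_branch P x) = x"
  using inv_branch(2)[of P x] ext(1)[of P "inv_branch P x"] by simp

lemma cyl_Cons_image: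
  assumes P: "P \<in> \<P>" and w: "w \<in> words \<P> n"
  shows "cyl (P # w) = P \<inter> inv_branch P ` cyl w"
proof (intro set_eqI iffI)
  fix x assume "x \<in> cyl (P # w)"
  hence "x \<in> P" "f x \<in> cyl w" by auto
  thus "x \<in> P \<inter> inv_branch P ` cyl w" using inv_branch_f[OF P, of x] by (metis IntI imageI)
next
  fix x assume "x \<in> P \<inter> inv_branch P ` cyl w"
  then obtain y where y: "x \<in> P" "y \<in> cyl w" "x = inv_branch P y" by blast
  have "f x = y" unfolding y(3) using f_inv_branch[OF P] y cyl_sub[OF w] by auto
  thus "x \<in> cyl (P # w)" using y by simp
qed

text \<open>
  The cylinder is the intersection of an interval with the image of a shorter cylinder under a
  continuous inverse branch.
\<close>

lemma cyl_interval: "w \<in> words \<P> n \<Longrightarrow> is_interval (cyl w)"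
proof (induction w arbitrary: n)
  case Nil thus ?case by (simp add: I_interval)
next
  case (Cons P w)
  obtain m where m: "P \<in> \<P>" "w \<in> words \<P> m" using words_Cons[OF Cons.prems(1)] by blast
  have "connected (inv_branch P ` cyl w)"
    using Cons.IH[OF m(2)] ext(4)[OF m(1)] cyl_sub[OF m(2)]
    by (intro connected_continuous_image) (auto intro: continuous_on_subset simp: is_interval_connected_1)
  hence "is_interval (inv_branch P ` cyl w)" by (simp add: is_interval_connected_1)
  thus ?case unfolding cyl_Cons_image[OF m] by (intro is_interval_Int P_facts(1)[OF m(1)])
qed

lemma cyl_cover: "x \<in> I \<Longrightarrow> \<exists>w\<in>words \<P> n. x \<in> cyl w"
proof (induction n arbitrary: x)
  case (Suc n)
  obtain P where P: "P \<in> \<P>" "x \<in> P" using P_cover Suc by blast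
  obtain w where "w \<in> words \<P> n" "f x \<in> cyl w" using Suc f_in_I by blast
  thus ?case using P by (intro bexI[of _ "P # w"]) (auto intro: words_ConsI)
qed simp

lemma cyl_unique: "w \<in> words \<P> n \<Longrightarrow> w' \<in> words \<P> n \<Longrightarrow> x \<in> cyl w \<Longrightarrow> x \<in> cyl w' \<Longrightarrow> w = w'"
proof (induction n arbitrary: w w' x)
  case (Suc n)
  obtain P v where 1: "w = P # v" "P \<in> \<P>" "v \<in> words \<P> n" using Suc.prems(1) by (auto elim: words_cases)
  obtain P' v' where 2: "w' = P' # v'" "P' \<in> \<P>" "v' \<in> words \<P> n" using Suc.prems(2) by (auto elim: words_cases)
  have "x \<in> P" "x \<in> P'" "f x \<in> cyl v" "f x \<in> cyl v'" using Suc.prems 1 2 by auto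
  thus ?case using 1 2 Suc.IH[OF 1(3) 2(3)] P_unique by blast
qed simp

lemma cyl_expand:
  "w \<in> words \<P> n \<Longrightarrow> x \<in> cyl w \<Longrightarrow> y \<in> cyl w \<Longrightarrow> expansion ^ n * \<bar>x - y\<bar> \<le> \<bar>(f ^^ n) x - (f ^^ n) y\<bar>"
proof (induction w arbitrary: n x y)
  case (Cons P w)
  obtain m where m: "n = Suc m" "P \<in> \<P>" "w \<in> words \<P> m" using words_Cons[OF Cons.prems(1)] by blast
  have "expansion ^ n * \<bar>x - y\<bar> = expansion ^ m * (expansion * \<bar>x - y\<bar>)" by (simp add: m)
  also have "\<dots> \<le> expansion ^ m * \<bar>f x - f y\<bar>"
    using expansion Cons.prems m by (intro mult_left_mono) auto
  also have "\<dots> \<le> \<bar>(f ^^ m) (f x) - (f ^^ m) (f y)\<bar>" using Cons m by auto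
  finally show ?case by (simp add: m funpow_Suc_right del: funpow.simps)
qed (auto simp: words_def)

lemma cyl_inj: "w \<in> words \<P> n \<Longrightarrow> inj_on (f ^^ n) (cyl w)"
proof (rule inj_onI)
  fix x y assume "w \<in> words \<P> n" "x \<in> cyl w" "y \<in> cyl w" "(f ^^ n) x = (f ^^ n) y"
  hence "expansion ^ n * \<bar>x - y\<bar> \<le> 0" using cyl_expand[of w n x y] by simp
  moreover have "0 < expansion ^ n" using expansion(1) by simp
  ultimately show "x = y" by (simp add: mult_le_0_iff)
qed

lemma cyl_append:
  "v \<in> words \<P> k \<Longrightarrow> w \<in> words \<P> n \<Longrightarrow> x \<in> cyl (v @ w) \<longleftrightarrow> x \<in> cyl v \<and> (f ^^ k) x \<in> cyl w"
proof (induction v arbitrary: k x)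
  case Nil thus ?case using cyl_sub by (auto simp: words_def)
next
  case (Cons P v)
  obtain m where m: "k = Suc m" "P \<in> \<P>" "v \<in> words \<P> m" using words_Cons[OF Cons.prems(1)] by blast
  show ?case using Cons.IH[OF m(3) Cons.prems(2)] by (simp add: m(1) funpow_Suc_right del: funpow.simps)
qed

lemma cyl_take: "w \<in> words \<P> n \<Longrightarrow> k \<le> n \<Longrightarrow> take k w \<in> words \<P> k \<and> cyl w \<subseteq> cyl (take k w)"
proof -
  assume w: "w \<in> words \<P> n" and k: "k \<le> n"
  have 1: "take k w \<in> words \<P> k" "drop k w \<in> words \<P> (n - k)"
    using w k by (auto simp: words_def dest: in_set_takeD in_set_dropD)
  have "cyl w \<subseteq> cyl (take k w)" using cyl_append[OF 1] by auto
  thus ?thesis using 1 by blast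
qed

text \<open>
  The points whose orbits avoid the end points of \<open>I\<close>. Each inverse branch maps this set into
  itself and is inverted by \<open>f\<close> there, whatever the values of \<open>f\<close> at the end points of the
  branches; only countably many points of \<open>I\<close> are left out.
\<close>

definition core :: "real set" where
  "core = {x \<in> I. \<forall>n. (f ^^ n) x \<in> interior I}"

lemma core_I: "x \<in> core \<Longrightarrow> x \<in> I" by (simp add: core_def)

lemma f_core: "x \<in> core \<Longrightarrow> f x \<in> core"
proof -
  assume x: "x \<in> core"
  have "(f ^^ n) (f x) \<in> interior I" for n
  proof -
    have "(f ^^ Suc n) x \<in> interior I" using x unfolding core_def by blast
    thus ?thesis by (simp only: funpow_Suc_right o_apply)
  qed
  thus ?thesis using f_in_I x unfolding core_def by blast
qed

lemma f_pow_core: "x \<in> core \<Longrightarrow> (f ^^ n) x \<in> core"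
  by (induction n) (auto intro: f_core)

text \<open>
  By invariance of domain the image of the interior of \<open>I\<close> is an open subset of the closure of
  \<open>P\<close>.
\<close>

lemma inv_branch_interior:
  assumes P: "P \<in> \<P>" and x: "x \<in> interior I"
  shows "inv_branch P x \<in> interior P"
proof -
  have inj: "inj_on (inv_branch P) I" using inv_branch(2)[OF P] by (intro inj_onI) metis
  have "open (inv_branch P ` interior I)"
    by (rule invariance_of_domain) (auto intro: continuous_on_subset[OF ext(4)[OF P]] inj_on_subset[OF inj] subsetD[OF interior_subset])
  moreover have "inv_branch P ` interior I \<subseteq> closure P" using inv_branch(1)[OF P] interior_subset by blast
  ultimately have "inv_branch P ` interior I \<subseteq> interior (closure P)" by (rule interior_maximal[rotated])
  also have "\<dots> = interior P"
    using P_facts(1)[OF P] by (intro convex_interior_closure) (simp add: is_interval_convex_1)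
  finally show ?thesis using x by blast
qed

lemma inv_branch_core:
  assumes P: "P \<in> \<P>" and x: "x \<in> core"
  shows "inv_branch P x \<in> P" "f (inv_branch P x) = x" "inv_branch P x \<in> core"
proof -
  have "(f ^^ 0) x \<in> interior I" using x unfolding core_def by blast
  hence i: "inv_branch P x \<in> interior P" using inv_branch_interior[OF P] by simp
  thus 1: "inv_branch P x \<in> P" using interior_subset by blast
  show 2: "f (inv_branch P x) = x" by (rule f_inv_branch[OF P core_I[OF x] 1])
  have "(f ^^ n) (inv_branch P x) \<in> interior I" for n
  proof (cases n)
    case 0 thus ?thesis using i interior_mono[OF P_sub[OF P]] by auto
  next
    case (Suc m) thus ?thesis using x 2 by (simp add: core_def funpow_Suc_right del: funpow.simps)
  qed
  thus "inv_branch P x \<in> core" using 1 P_sub[OF P] by (auto simp: core_def)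
qed

lemma countable_noncore: "countable (I - core)"
proof -
  obtain a b where ab: "a < b" "I = {a..b}" using I_eq by blast
  have cI: "countable (I - interior I)"
  proof (rule countable_subset)
    show "I - interior I \<subseteq> {a, b}" unfolding ab(2) by auto
  qed simp
  have c: "countable {x \<in> cyl w. (f ^^ n) x \<in> I - interior I}" if w: "w \<in> words \<P> n" for w n
  proof (rule countable_image_inj_on)
    show "countable ((f ^^ n) ` {x \<in> cyl w. (f ^^ n) x \<in> I - interior I})"
      by (rule countable_subset[OF _ cI]) auto
    show "inj_on (f ^^ n) {x \<in> cyl w. (f ^^ n) x \<in> I - interior I}"
      by (rule inj_on_subset[OF cyl_inj[OF w]]) auto
  qed
  have "I - core \<subseteq> (\<Union>n. \<Union>w\<in>words \<P> n. {x \<in> cyl w. (f ^^ n) x \<in> I - interior I})"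
  proof
    fix x assume x: "x \<in> I - core"
    then obtain n where n: "(f ^^ n) x \<notin> interior I" by (auto simp: core_def)
    obtain w where w: "w \<in> words \<P> n" "x \<in> cyl w" using cyl_cover x by blast
    have "(f ^^ n) x \<in> I" using x f_pow_in_I by blast
    thus "x \<in> (\<Union>n. \<Union>w\<in>words \<P> n. {x \<in> cyl w. (f ^^ n) x \<in> I - interior I})" using n w by blast
  qed
  moreover have "countable (\<Union>n. \<Union>w\<in>words \<P> n. {x \<in> cyl w. (f ^^ n) x \<in> I - interior I})"
  proof (rule countable_UN)
    fix n show "countable (\<Union>w\<in>words \<P> n. {x \<in> cyl w. (f ^^ n) x \<in> I - interior I})"
      by (rule countable_UN) (use c countable_finite[OF finite_words[OF fin_P]] in auto)
  qed auto
  ultimately show ?thesis by (rule countable_subset)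
qed

lemma core_dense:
  assumes "c < d" "c \<in> I" "d \<in> I"
  shows "\<exists>x\<in>core. c < x \<and> x < d"
proof (rule ccontr)
  assume n: "\<not> ?thesis"
  have "{c<..<d} \<subseteq> I - core"
  proof
    fix x assume x: "x \<in> {c<..<d}"
    hence "x \<in> I" by (intro mem_is_interval_1_I[OF I_interval assms(2,3)]) auto
    thus "x \<in> I - core" using n x by auto
  qed
  hence "countable {c<..<d}" using countable_noncore countable_subset by blast
  thus False using assms uncountable_open_interval by blast
qed

lemma core_nonempty: "core \<noteq> {}"
  using I_two_points core_dense by blast

sublocale coded: branches core \<P> inv_branch
  by unfold_locales (use fin_P core_nonempty inv_branch_core in auto)

abbreviation pt :: "real set list \<Rightarrow> real \<Rightarrow> real" where "pt \<equiv> branch inv_branch"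

lemma pt:
  "w \<in> words \<P> n \<Longrightarrow> x \<in> core \<Longrightarrow> pt w x \<in> cyl w"
  "w \<in> words \<P> n \<Longrightarrow> x \<in> core \<Longrightarrow> (f ^^ n) (pt w x) = x"
proof -
  have "w \<in> words \<P> n \<Longrightarrow> x \<in> core \<Longrightarrow> pt w x \<in> cyl w \<and> (f ^^ n) (pt w x) = x"
  proof (induction w arbitrary: n)
    case Nil thus ?case by (auto simp: words_def core_I)
  next
    case (Cons P w)
    obtain m where m: "n = Suc m" "P \<in> \<P>" "w \<in> words \<P> m" using words_Cons[OF Cons.prems(1)] by blast
    note i = inv_branch_core[OF m(2) coded.branch_in[OF m(3) Cons.prems(2)]]
    show ?case using Cons.IH[OF m(3) Cons.prems(2)] i by (simp add: m(1) funpow_Suc_right del: funpow.simps)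
  qed
  thus "w \<in> words \<P> n \<Longrightarrow> x \<in> core \<Longrightarrow> pt w x \<in> cyl w"
    "w \<in> words \<P> n \<Longrightarrow> x \<in> core \<Longrightarrow> (f ^^ n) (pt w x) = x" by auto
qed

lemma cyl_nonempty: "w \<in> words \<P> n \<Longrightarrow> cyl w \<noteq> {}"
  using pt(1) core_nonempty by blast

lemma pt_f_pow:
  assumes w: "w \<in> words \<P> n" and x: "x \<in> cyl w" "x \<in> core"
  shows "pt w ((f ^^ n) x) = x"
proof (rule inj_onD[OF cyl_inj[OF w]])
  note c = f_pow_core[OF x(2), of n]
  show "(f ^^ n) (pt w ((f ^^ n) x)) = (f ^^ n) x" by (rule pt(2)[OF w c])
  show "pt w ((f ^^ n) x) \<in> cyl w" by (rule pt(1)[OF w c])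
qed (fact x)

abbreviation mass :: "real set list \<Rightarrow> real" where "mass w \<equiv> measure M (cyl w)"

lemma cyl_sets [measurable]: "w \<in> words \<P> n \<Longrightarrow> cyl w \<in> sets M"
  by (intro interval_in_sets cyl_interval cyl_sub)

lemma measure_cyl_split:
  assumes E: "E \<in> sets M"
  shows "measure M E = (\<Sum>w\<in>words \<P> n. measure M (E \<inter> cyl w))"
proof -
  have "E = (\<Union>w\<in>words \<P> n. E \<inter> cyl w)" using cyl_cover sets.sets_into_space[OF E] by auto
  hence "measure M E = measure M (\<Union>w\<in>words \<P> n. E \<inter> cyl w)" by simp
  also have "\<dots> = (\<Sum>w\<in>words \<P> n. measure M (E \<inter> cyl w))"
  proof (rule finite_measure_finite_Union)
    show "disjoint_family_on (\<lambda>w. E \<inter> cyl w) (words \<P> n)"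
      using cyl_unique unfolding disjoint_family_on_def by blast
    show "(\<lambda>w. E \<inter> cyl w) ` words \<P> n \<subseteq> sets M" using E cyl_sets by auto
  qed (simp add: fin_P)
  finally show ?thesis .
qed

lemma mass_sum: "(\<Sum>w\<in>words \<P> n. mass w) = 1"
proof -
  have "I \<in> sets M" using sets.top[of M] by simp
  from measure_cyl_split[OF this, of n] have "1 = (\<Sum>w\<in>words \<P> n. measure M (I \<inter> cyl w))"
    using prob_space by simp
  also have "\<dots> = (\<Sum>w\<in>words \<P> n. mass w)" using cyl_sub by (intro sum.cong) (auto simp: Int_absorb1)
  finally show ?thesis by simp
qed

lemma gibbs_constant:
  "\<exists>C\<ge>1. \<forall>n. \<forall>w\<in>words \<P> n. \<forall>x\<in>cyl w. mass w \<le> C * exp (birkhoff_sum f \<phi> n x) \<and> exp (birkhoff_sum f \<phi> n x) \<le> C * mass w"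
proof -
  obtain C where C: "C > 0" "\<And>n Q x. n \<ge> 1 \<Longrightarrow> Q \<in> cylinders I \<P> f n \<Longrightarrow> x \<in> Q \<Longrightarrow>
     1 / C \<le> measure M Q / exp (birkhoff_sum f \<phi> n x) \<and> measure M Q / exp (birkhoff_sum f \<phi> n x) \<le> C"
    using gibbs unfolding gibbs_measure_def by blast
  have "mass w \<le> max 1 C * exp (birkhoff_sum f \<phi> n x) \<and> exp (birkhoff_sum f \<phi> n x) \<le> max 1 C * mass w"
    if w: "w \<in> words \<P> n" and x: "x \<in> cyl w" for n w x
  proof (cases "n = 0")
    case True
    hence "mass w = 1" using w prob_space by simp
    thus ?thesis using True by (simp add: birkhoff_sum_def)
  next
    case False
    have "cyl w \<in> cylinders I \<P> f n" using cyl_in_cylinders[OF w] x by blast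
    from C(2)[OF _ this x] False
    have 1: "1 / C \<le> mass w / exp (birkhoff_sum f \<phi> n x)" "mass w / exp (birkhoff_sum f \<phi> n x) \<le> C" by auto
    have "mass w \<le> C * exp (birkhoff_sum f \<phi> n x)" using 1(2) by (simp add: field_simps)
    also have "\<dots> \<le> max 1 C * exp (birkhoff_sum f \<phi> n x)" by (intro mult_right_mono) auto
    finally have a: "mass w \<le> max 1 C * exp (birkhoff_sum f \<phi> n x)" .
    have "exp (birkhoff_sum f \<phi> n x) \<le> C * mass w" using 1(1) C(1) by (simp add: field_simps)
    also have "\<dots> \<le> max 1 C * mass w" by (intro mult_right_mono) auto
    finally show ?thesis using a by blast
  qed
  thus ?thesis by (intro exI[of _ "max 1 C"]) auto
qed

definition gibbs_const :: real where
  "gibbs_const = (SOME C. C \<ge> 1 \<and> (\<forall>n. \<forall>w\<in>words \<P> n. \<forall>x\<in>cyl w.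
     mass w \<le> C * exp (birkhoff_sum f \<phi> n x) \<and> exp (birkhoff_sum f \<phi> n x) \<le> C * mass w))"

lemma gibbs_const:
  "1 \<le> gibbs_const"
  "w \<in> words \<P> n \<Longrightarrow> x \<in> cyl w \<Longrightarrow> mass w \<le> gibbs_const * exp (birkhoff_sum f \<phi> n x)"
  "w \<in> words \<P> n \<Longrightarrow> x \<in> cyl w \<Longrightarrow> exp (birkhoff_sum f \<phi> n x) \<le> gibbs_const * mass w"
proof -
  have "gibbs_const \<ge> 1 \<and> (\<forall>n. \<forall>w\<in>words \<P> n. \<forall>x\<in>cyl w.
     mass w \<le> gibbs_const * exp (birkhoff_sum f \<phi> n x) \<and> exp (birkhoff_sum f \<phi> n x) \<le> gibbs_const * mass w)"
    unfolding gibbs_const_def by (rule someI_ex[OF gibbs_constant])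
  thus "1 \<le> gibbs_const"
    "w \<in> words \<P> n \<Longrightarrow> x \<in> cyl w \<Longrightarrow> mass w \<le> gibbs_const * exp (birkhoff_sum f \<phi> n x)"
    "w \<in> words \<P> n \<Longrightarrow> x \<in> cyl w \<Longrightarrow> exp (birkhoff_sum f \<phi> n x) \<le> gibbs_const * mass w" by blast+
qed

lemma mass_pos: "w \<in> words \<P> n \<Longrightarrow> 0 < mass w"
proof -
  assume w: "w \<in> words \<P> n"
  obtain x where "x \<in> cyl w" using cyl_nonempty[OF w] by blast
  hence "0 < gibbs_const * mass w" using gibbs_const(3)[OF w] less_le_trans[OF exp_gt_zero] by blast
  thus ?thesis using gibbs_const(1) by (simp add: zero_less_mult_iff)
qed

lemma birkhoff_sum_add:
  "birkhoff_sum f \<phi> (m + n) x = birkhoff_sum f \<phi> m x + birkhoff_sum f \<phi> n ((f ^^ m) x)"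
proof -
  have "birkhoff_sum f \<phi> (m + n) x = (\<Sum>i<m. \<phi> ((f ^^ i) x)) + (\<Sum>i\<in>{m..<m+n}. \<phi> ((f ^^ i) x))"
    unfolding birkhoff_sum_def by (subst sum.union_disjoint[symmetric]) (auto intro!: sum.cong)
  also have "(\<Sum>i\<in>{m..<m+n}. \<phi> ((f ^^ i) x)) = (\<Sum>i<n. \<phi> ((f ^^ (i + m)) x))"
    using sum.shift_bounds_nat_ivl[of "\<lambda>i. \<phi> ((f ^^ i) x)" 0 m n] by (simp add: lessThan_atLeast0 add.commute)
  finally show ?thesis by (simp add: birkhoff_sum_def funpow_add)
qed

text \<open>
  Together with the next lemma: up to a factor the measure is Bernoulli on cylinders, since
  Birkhoff sums are additive along concatenation.
\<close>

lemma mass_append_le: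
  assumes v: "v \<in> words \<P> k" and w: "w \<in> words \<P> n"
  shows "mass (v @ w) \<le> gibbs_const ^ 3 * mass v * mass w"
proof -
  note vw = words_append[OF v w]
  obtain x where x: "x \<in> cyl (v @ w)" using cyl_nonempty[OF vw] by blast
  hence xx: "x \<in> cyl v" "(f ^^ k) x \<in> cyl w" using cyl_append[OF v w] by auto
  have "mass (v @ w) \<le> gibbs_const * (exp (birkhoff_sum f \<phi> k x) * exp (birkhoff_sum f \<phi> n ((f ^^ k) x)))"
    using gibbs_const(2)[OF vw x] by (simp add: birkhoff_sum_add exp_add)
  also have "\<dots> \<le> gibbs_const * ((gibbs_const * mass v) * (gibbs_const * mass w))"
    using gibbs_const v w xx by (intro mult_left_mono mult_mono) auto
  finally show ?thesis by (simp add: power3_eq_cube mult_ac)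
qed

lemma mass_append_ge:
  assumes v: "v \<in> words \<P> k" and w: "w \<in> words \<P> n"
  shows "mass v * mass w \<le> gibbs_const ^ 3 * mass (v @ w)"
proof -
  note vw = words_append[OF v w]
  obtain x where x: "x \<in> cyl (v @ w)" using cyl_nonempty[OF vw] by blast
  hence xx: "x \<in> cyl v" "(f ^^ k) x \<in> cyl w" using cyl_append[OF v w] by auto
  have "mass v * mass w \<le> (gibbs_const * exp (birkhoff_sum f \<phi> k x)) * (gibbs_const * exp (birkhoff_sum f \<phi> n ((f ^^ k) x)))"
    using gibbs_const v w xx by (intro mult_mono) auto
  also have "\<dots> = gibbs_const\<^sup>2 * exp (birkhoff_sum f \<phi> (k + n) x)"
    by (simp add: birkhoff_sum_add exp_add power2_eq_square)
  also have "\<dots> \<le> gibbs_const\<^sup>2 * (gibbs_const * mass (v @ w))"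
    using gibbs_const(3)[OF vw x] by (intro mult_left_mono) auto
  finally show ?thesis by (simp add: power2_eq_square power3_eq_cube mult_ac)
qed

text \<open>
  A cylinder has at least two subcylinders of the next level, and each takes a definite
  proportion of its mass; hence no single one can keep all of it.
\<close>

lemma mass_decay: "\<exists>\<theta>. 0 < \<theta> \<and> \<theta> < 1 \<and> (\<forall>n. \<forall>w\<in>words \<P> n. mass w \<le> \<theta> ^ n)"
proof -
  have "\<exists>c>0. \<forall>P\<in>\<P>. c \<le> mass [P]"
  proof -
    have ne: "\<P> \<noteq> {}" using P_cover I_two_points by blast
    have p: "0 < mass [P]" if "P \<in> \<P>" for P using mass_pos[of "[P]" 1] that by (auto simp: words_def)
    show ?thesis
      by (rule exI[of _ "Min ((\<lambda>P. mass [P]) ` \<P>)"]) (use ne fin_P p in \<open>auto simp del: cyl.simps\<close>)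
  qed
  then obtain c where c: "c > 0" "\<And>P. P \<in> \<P> \<Longrightarrow> c \<le> mass [P]" by blast
  define c' where "c' = c / gibbs_const ^ 3"
  have G: "0 < gibbs_const ^ 3" using gibbs_const(1) by simp
  have c': "c' > 0" using c G by (simp add: c'_def)
  have low: "c' * mass w \<le> mass (w @ [P])" if w: "w \<in> words \<P> n" and P: "P \<in> \<P>" for w n P
  proof -
    have "mass w * c \<le> mass w * mass [P]" using c(2)[OF P] by (intro mult_left_mono) auto
    also have "\<dots> \<le> gibbs_const ^ 3 * mass (w @ [P])"
      using P by (intro mass_append_ge[OF w, of _ 1]) (auto simp: words_def)
    finally show ?thesis using G by (simp add: c'_def field_simps)
  qed
  have step: "mass (w @ [P]) \<le> (1 - c') * mass w" if w: "w \<in> words \<P> n" and P: "P \<in> \<P>" for w n P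
  proof -
    have "P \<noteq> I" using several_branches P by blast
    then obtain x where "x \<in> I" "x \<notin> P" using P_sub[OF P] by blast
    then obtain Q where Q: "Q \<in> \<P>" "Q \<noteq> P" using P_cover by blast
    have s: "[P] \<in> words \<P> 1" "[Q] \<in> words \<P> 1" using P Q by (auto simp: words_def)
    have sets: "cyl (w @ [P]) \<in> sets M" "cyl (w @ [Q]) \<in> sets M"
      using cyl_sets words_append[OF w s(1)] words_append[OF w s(2)] by blast+
    have "cyl (w @ [P]) \<inter> cyl (w @ [Q]) = {}"
      using cyl_unique[OF words_append[OF w s(1)] words_append[OF w s(2)]] Q by auto
    hence "mass (w @ [P]) + mass (w @ [Q]) = measure M (cyl (w @ [P]) \<union> cyl (w @ [Q]))"
      using sets by (intro finite_measure_Union[symmetric])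
    also have "\<dots> \<le> mass w"
      using cyl_append[OF w s(1)] cyl_append[OF w s(2)] cyl_sets[OF w] by (intro finite_measure_mono) auto
    finally show ?thesis using low[OF w Q(1)] by (simp add: algebra_simps)
  qed
  have c1: "c' < 1"
  proof (rule ccontr)
    assume "\<not> c' < 1"
    obtain P where P: "P \<in> \<P>" using P_cover I_two_points by blast
    have "mass ([] @ [P]) \<le> (1 - c') * mass []" by (rule step[of _ 0]) (use P in auto)
    also have "\<dots> \<le> 0" using \<open>\<not> c' < 1\<close> prob_space by simp
    finally show False using mass_pos[of "[P]" 1] P by (auto simp: words_def simp del: cyl.simps)
  qed
  have "mass w \<le> (1 - c') ^ n" if "w \<in> words \<P> n" for w n
    using that
  proof (induction w arbitrary: n rule: rev_induct)
    case Nil thus ?case using prob_space by (simp add: words_def)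
  next
    case (snoc P w)
    hence w: "w \<in> words \<P> (length w)" and P: "P \<in> \<P>" and n: "n = Suc (length w)" by (auto simp: words_def)
    have "mass (w @ [P]) \<le> (1 - c') * mass w" by (rule step[OF w P])
    also have "\<dots> \<le> (1 - c') * (1 - c') ^ length w" using snoc.IH[OF w] c1 by (intro mult_left_mono) auto
    finally show ?case by (simp add: n)
  qed
  thus ?thesis using c' c1 by (intro exI[of _ "1 - c'"]) auto
qed

lemma no_atoms: "x \<in> I \<Longrightarrow> measure M {x} = 0"
proof -
  assume x: "x \<in> I"
  obtain \<theta> where \<theta>: "0 < \<theta>" "\<theta> < 1" "\<And>n w. w \<in> words \<P> n \<Longrightarrow> mass w \<le> \<theta> ^ n" using mass_decay by blast
  have "measure M {x} \<le> \<theta> ^ n" for n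
  proof -
    obtain w where w: "w \<in> words \<P> n" "x \<in> cyl w" using cyl_cover[OF x] by blast
    have "measure M {x} \<le> mass w" using w cyl_sets[OF w(1)] by (intro finite_measure_mono) auto
    thus ?thesis using \<theta>(3)[OF w(1)] by simp
  qed
  hence "measure M {x} \<le> 0"
    using LIMSEQ_le_const[of "\<lambda>n. \<theta> ^ n" 0 "measure M {x}"] LIMSEQ_realpow_zero[of \<theta>] \<theta> by auto
  thus ?thesis by (simp add: antisym)
qed

lemma measure_core: "E \<in> sets M \<Longrightarrow> measure M (E \<inter> core) = measure M E"
proof -
  assume E: "E \<in> sets M"
  have s: "{x} \<in> sets M" if "x \<in> I" for x
    using I_borel_in_sets[of "{x}"] that by simp
  have "I - core \<in> null_sets M"
  proof -
    have "(\<Union>x\<in>I - core. {x}) \<in> null_sets M"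
      using countable_noncore s no_atoms
      by (intro null_sets_UN') (auto simp: null_sets_def emeasure_eq_measure)
    thus ?thesis by simp
  qed
  hence "measure M (E - (I - core)) = measure M E" using E by (simp add: measure_Diff_null_set)
  moreover have "E - (I - core) = E \<inter> core"
    using sets.sets_into_space[OF E] unfolding space_M by blast
  ultimately show ?thesis by simp
qed

section \<open>Coding of the Gibbs measure\<close>

definition I_len :: real where "I_len = Sup I - Inf I"

lemma I_len: "0 < I_len" "x \<in> I \<Longrightarrow> y \<in> I \<Longrightarrow> \<bar>x - y\<bar> \<le> I_len"
proof -
  obtain a b where ab: "a < b" "I = {a..b}" using I_eq by blast
  have S: "Sup I = b" "Inf I = a" unfolding ab(2) using ab(1) by simp_all
  hence l: "I_len = b - a" by (simp only: I_len_def)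
  show "0 < I_len" using ab(1) l by simp
  have mem: "a \<le> z \<and> z \<le> b" if "z \<in> I" for z using that unfolding ab(2) by simp
  show "\<bar>x - y\<bar> \<le> I_len" if "x \<in> I" "y \<in> I"
    unfolding l using mem[OF that(1)] mem[OF that(2)] by linarith
qed

lemma cyl_small:
  assumes "w \<in> words \<P> n" "x \<in> cyl w" "y \<in> cyl w"
  shows "\<bar>x - y\<bar> \<le> I_len * (1 / expansion) ^ n"
proof -
  have "expansion ^ n * \<bar>x - y\<bar> \<le> I_len"
    using cyl_expand[OF assms] I_len(2)[of "(f ^^ n) x" "(f ^^ n) y"] f_pow_in_I assms cyl_sub by force
  thus ?thesis using expansion(1) by (simp add: field_simps)
qed

text \<open>
  Cylinders shrink exponentially, so Hoelder continuity on each branch becomes exponential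
  decay of the variation in the length of the word. Words of length zero are excluded since
  \<open>\<phi>\<close> may jump between branches.
\<close>

lemma potential_variation:
  "\<exists>H\<ge>0. \<exists>\<theta>. 0 < \<theta> \<and> \<theta> < 1 \<and>
     (\<forall>n. \<forall>w\<in>words \<P> (Suc n). \<forall>x\<in>cyl w. \<forall>y\<in>cyl w. \<bar>\<phi> x - \<phi> y\<bar> \<le> H * \<theta> ^ Suc n)"
proof -
  have "\<exists>H \<theta>. 0 \<le> H \<and> 0 < \<theta> \<and> \<theta> < 1 \<and>
     (\<forall>n. \<forall>w\<in>words \<P> n. \<forall>x\<in>cyl w \<inter> P. \<forall>y\<in>cyl w \<inter> P. \<bar>\<phi> x - \<phi> y\<bar> \<le> H * \<theta> ^ n)"
    if P: "P \<in> \<P>" for P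
  proof -
    have "holder_on P \<phi>" using hol P by (rule bspec)
    then obtain \<alpha> H where a0: "0 < \<alpha>" and h0: "\<forall>x\<in>P. \<forall>y\<in>P. \<bar>\<phi> x - \<phi> y\<bar> \<le> H * \<bar>x - y\<bar> powr \<alpha>"
      unfolding holder_on_def by (elim exE conjE)
    have h: "0 < \<alpha>" "\<And>x y. x \<in> P \<Longrightarrow> y \<in> P \<Longrightarrow> \<bar>\<phi> x - \<phi> y\<bar> \<le> H * \<bar>x - y\<bar> powr \<alpha>"
      using a0 h0 by blast+
    define \<theta> where "\<theta> = (1 / expansion) powr \<alpha>"
    have t: "0 < \<theta>" "\<theta> < 1" 
      using expansion(1) h(1) powr01_less_one[of "1 / expansion" \<alpha>] by (auto simp: \<theta>_def)
    have "\<bar>\<phi> x - \<phi> y\<bar> \<le> (\<bar>H\<bar> * I_len powr \<alpha>) * \<theta> ^ n"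
      if w: "w \<in> words \<P> n" and x: "x \<in> cyl w \<inter> P" and y: "y \<in> cyl w \<inter> P" for n w x y
    proof -
      have "\<bar>\<phi> x - \<phi> y\<bar> \<le> H * \<bar>x - y\<bar> powr \<alpha>" using h(2) x y by blast
      also have "\<dots> \<le> \<bar>H\<bar> * \<bar>x - y\<bar> powr \<alpha>" by (intro mult_right_mono) auto
      also have "\<dots> \<le> \<bar>H\<bar> * (I_len * (1 / expansion) ^ n) powr \<alpha>"
        using cyl_small[OF w] x y h(1) by (intro mult_left_mono powr_mono2) auto
      also have "(I_len * (1 / expansion) ^ n) powr \<alpha> = I_len powr \<alpha> * \<theta> ^ n"
      proof -
        have "((1 / expansion) ^ n) powr \<alpha> = \<theta> ^ n"
          using expansion(1) unfolding \<theta>_def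
          by (simp add: powr_realpow[symmetric] powr_powr mult.commute powr_gt_zero)
        thus ?thesis using I_len(1) expansion(1) by (subst powr_mult) auto
      qed
      finally show ?thesis by (simp add: mult.assoc)
    qed
    thus ?thesis using t I_len(1) by (intro exI[of _ "\<bar>H\<bar> * I_len powr \<alpha>"] exI[of _ \<theta>]) auto
  qed
  then obtain HH tt where *: "\<And>P. P \<in> \<P> \<Longrightarrow> 0 \<le> HH P \<and> 0 < tt P \<and> tt P < 1 \<and>
     (\<forall>n. \<forall>w\<in>words \<P> n. \<forall>x\<in>cyl w \<inter> P. \<forall>y\<in>cyl w \<inter> P. \<bar>\<phi> x - \<phi> y\<bar> \<le> HH P * tt P ^ n)"
    by metis
  have ne: "\<P> \<noteq> {}" using P_cover I_two_points by blast
  define \<theta> where "\<theta> = Max (tt ` \<P>)"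
  define H where "H = (\<Sum>P\<in>\<P>. HH P)"
  have tin: "\<theta> \<in> tt ` \<P>" unfolding \<theta>_def using ne fin_P by (intro Max_in) auto
  have t: "0 < \<theta>" "\<theta> < 1" using tin * by auto
  have H: "0 \<le> H" unfolding H_def using * by (intro sum_nonneg) auto
  have "\<bar>\<phi> x - \<phi> y\<bar> \<le> H * \<theta> ^ Suc n"
    if w: "w \<in> words \<P> (Suc n)" and x: "x \<in> cyl w" and y: "y \<in> cyl w" for n w x y
  proof -
    obtain P v where P: "w = P # v" "P \<in> \<P>" using w by (auto elim: words_cases)
    have "x \<in> P" "y \<in> P" using x y P by auto
    hence "\<bar>\<phi> x - \<phi> y\<bar> \<le> HH P * tt P ^ Suc n" using *[OF P(2)] w x y by blast
    also have "\<dots> \<le> H * \<theta> ^ Suc n"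
    proof (intro mult_mono power_mono)
      show "HH P \<le> H" unfolding H_def using * P fin_P by (intro member_le_sum) auto
      show "tt P \<le> \<theta>" unfolding \<theta>_def using P fin_P by (intro Max_ge) auto
    qed (use * P H in \<open>auto simp: less_imp_le\<close>)
    finally show ?thesis .
  qed
  thus ?thesis using H t by blast
qed

lemma potential_bounded: "\<exists>F. \<forall>x\<in>I. \<bar>\<phi> x\<bar> \<le> F"
proof -
  obtain H \<theta> where h: "0 \<le> H" "0 < \<theta>" "\<theta> < 1"
    "\<And>n w x y. w \<in> words \<P> (Suc n) \<Longrightarrow> x \<in> cyl w \<Longrightarrow> y \<in> cyl w \<Longrightarrow> \<bar>\<phi> x - \<phi> y\<bar> \<le> H * \<theta> ^ Suc n"
    using potential_variation by blast
  define q where "q w = (SOME x. x \<in> cyl w)" for w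
  have q: "q w \<in> cyl w" if "w \<in> words \<P> 1" for w
    unfolding q_def using cyl_nonempty[OF that] by (simp add: some_in_eq)
  have "\<bar>\<phi> x\<bar> \<le> (\<Sum>w\<in>words \<P> 1. \<bar>\<phi> (q w)\<bar>) + H" if x: "x \<in> I" for x
  proof -
    obtain w where w: "w \<in> words \<P> 1" "x \<in> cyl w" using cyl_cover[OF x] by blast
    have "\<bar>\<phi> x - \<phi> (q w)\<bar> \<le> H * \<theta> ^ Suc 0" using h(4)[of w 0 x "q w"] w q by simp
    also have "\<dots> \<le> H" using h by (simp add: mult_left_le)
    finally have 1: "\<bar>\<phi> x - \<phi> (q w)\<bar> \<le> H" .
    have "\<bar>\<phi> (q w)\<bar> \<le> (\<Sum>w\<in>words \<P> 1. \<bar>\<phi> (q w)\<bar>)" using w fin_P by (intro member_le_sum) auto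
    thus ?thesis using 1 by linarith
  qed
  thus ?thesis by blast
qed

definition branch_weight :: "real set \<Rightarrow> real \<Rightarrow> real" where
  "branch_weight P x = exp (\<phi> (inv_branch P x))"

lemma weight_birkhoff:
  "w \<in> words \<P> n \<Longrightarrow> x \<in> core \<Longrightarrow> coded.weight branch_weight w x = exp (birkhoff_sum f \<phi> n (pt w x))"
proof (induction w arbitrary: n)
  case Nil thus ?case by (simp add: words_def birkhoff_sum_def)
next
  case (Cons P w)
  obtain m where m: "n = Suc m" "P \<in> \<P>" "w \<in> words \<P> m" using words_Cons[OF Cons.prems(1)] by blast
  have "birkhoff_sum f \<phi> (1 + m) (pt (P # w) x) = \<phi> (pt (P # w) x) + birkhoff_sum f \<phi> m (pt w x)"
    using inv_branch_core(2)[OF m(2) coded.branch_in[OF m(3) Cons.prems(2)]]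
    by (simp only: birkhoff_sum_add) (simp add: birkhoff_sum_def)
  thus ?case using Cons.IH[OF m(3) Cons.prems(2)] by (simp add: m(1) exp_add branch_weight_def)
qed

text \<open>
  One rate \<open>\<theta>\<close> serves both for the regularity of the weights and for the decay of the masses.
\<close>

definition coding :: "(real set \<Rightarrow> real \<Rightarrow> real) \<Rightarrow> real \<Rightarrow> real \<Rightarrow> real \<Rightarrow> bool" where
  "coding p B K \<theta> \<longleftrightarrow> markov_branches core \<P> inv_branch p B K \<theta> \<and>
     (\<forall>n. \<forall>w\<in>words \<P> n. mass w \<le> \<theta> ^ n \<and>
        (\<forall>x\<in>core. mass w \<le> B * coded.weight p w x \<and> coded.weight p w x \<le> B * mass w))"

lemma coding_exists: "\<exists>p B K \<theta>. coding p B K \<theta>"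
proof -
  obtain H \<theta>1 where h: "0 \<le> H" "0 < \<theta>1" "\<theta>1 < 1"
    "\<And>n w x y. w \<in> words \<P> (Suc n) \<Longrightarrow> x \<in> cyl w \<Longrightarrow> y \<in> cyl w \<Longrightarrow> \<bar>\<phi> x - \<phi> y\<bar> \<le> H * \<theta>1 ^ Suc n"
    using potential_variation by blast
  obtain \<theta>2 where t2: "0 < \<theta>2" "\<theta>2 < 1" "\<And>n w. w \<in> words \<P> n \<Longrightarrow> mass w \<le> \<theta>2 ^ n" using mass_decay by blast
  define \<theta> where "\<theta> = max \<theta>1 \<theta>2"
  have t: "0 < \<theta>" "\<theta> < 1" "\<theta>1 \<le> \<theta>" "\<theta>2 \<le> \<theta>" using h t2 by (auto simp: \<theta>_def)
  define K where "K = H / (1 - \<theta>)"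
  have K: "0 \<le> K" "K * (1 - \<theta>) = H" using h t by (auto simp: K_def)
  have var: "\<bar>\<phi> x - \<phi> y\<bar> \<le> H * \<theta> ^ Suc n" if "w \<in> words \<P> (Suc n)" "x \<in> cyl w" "y \<in> cyl w" for n w x y
  proof -
    have "H * \<theta>1 ^ Suc n \<le> H * \<theta> ^ Suc n" using h t by (intro mult_left_mono power_mono) auto
    thus ?thesis using h(4)[OF that] by linarith
  qed
  \<comment> \<open>The factor \<open>1 - \<theta> ^ k\<close> makes the bound reproduce itself when a letter is added,
      because \<open>K * (1 - \<theta>) = H\<close>.\<close>
  have dist: "birkhoff_sum f \<phi> k (pt v (pt w x)) - birkhoff_sum f \<phi> k (pt v (pt w y)) \<le> K * \<theta> ^ n * (1 - \<theta> ^ k)"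
    if w: "w \<in> words \<P> n" and x: "x \<in> core" and y: "y \<in> core" and v: "v \<in> words \<P> k" for w n x y v k
    using v
  proof (induction v arbitrary: k)
    case Nil thus ?case by (simp add: words_def birkhoff_sum_def)
  next
    case (Cons P v)
    obtain m where m: "k = Suc m" "P \<in> \<P>" "v \<in> words \<P> m" using words_Cons[OF Cons.prems(1)] by blast
    have st: "birkhoff_sum f \<phi> k (pt (P # v) (pt w z)) = \<phi> (pt (P # v) (pt w z)) + birkhoff_sum f \<phi> m (pt v (pt w z))"
      if z: "z \<in> core" for z
    proof -
      have "f (pt (P # v) (pt w z)) = pt v (pt w z)"
        using inv_branch_core(2)[OF m(2) coded.branch_in[OF m(3) coded.branch_in[OF w z]]] by simp
      hence "birkhoff_sum f \<phi> (1 + m) (pt (P # v) (pt w z)) = \<phi> (pt (P # v) (pt w z)) + birkhoff_sum f \<phi> m (pt v (pt w z))"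
        by (simp only: birkhoff_sum_add) (simp add: birkhoff_sum_def)
      thus ?thesis by (simp add: m(1))
    qed
    have W: "(P # v) @ w \<in> words \<P> (Suc (m + n))"
      using words_append[OF Cons.prems w] by (simp add: m(1))
    have "pt ((P # v) @ w) x \<in> cyl ((P # v) @ w)" "pt ((P # v) @ w) y \<in> cyl ((P # v) @ w)"
      by (rule pt(1)[OF W x], rule pt(1)[OF W y])
    from var[OF W this] have "\<phi> (pt (P # v) (pt w x)) - \<phi> (pt (P # v) (pt w y)) \<le> H * \<theta> ^ Suc (m + n)"
      by (simp only: branch_append)
    also have "\<dots> \<le> H * \<theta> ^ (m + n)" using h t by (intro mult_left_mono power_decreasing) auto
    also have "\<dots> = K * \<theta> ^ n * (\<theta> ^ m * (1 - \<theta>))" unfolding K(2)[symmetric] by (simp add: power_add mult_ac)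
    finally have "\<phi> (pt (P # v) (pt w x)) - \<phi> (pt (P # v) (pt w y)) \<le> K * \<theta> ^ n * (\<theta> ^ m * (1 - \<theta>))" .
    moreover have "K * \<theta> ^ n * (\<theta> ^ m * (1 - \<theta>)) + K * \<theta> ^ n * (1 - \<theta> ^ m) = K * \<theta> ^ n * (1 - \<theta> ^ k)"
      by (simp add: m(1) algebra_simps)
    ultimately show ?case using Cons.IH[OF m(3)] unfolding st[OF x] st[OF y] by linarith
  qed
  have gb: "gibbs_branches core \<P> inv_branch branch_weight mass gibbs_const K \<theta>"
  proof unfold_locales
    show "0 < branch_weight a x" for a x by (simp add: branch_weight_def)
    show "mass w \<le> gibbs_const * coded.weight branch_weight w x" if "w \<in> words \<P> n" "x \<in> core" for w n x
      unfolding weight_birkhoff[OF that] by (rule gibbs_const(2)[OF that(1) pt(1)[OF that]])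
    show "coded.weight branch_weight w x \<le> gibbs_const * mass w" if "w \<in> words \<P> n" "x \<in> core" for w n x
      unfolding weight_birkhoff[OF that] by (rule gibbs_const(3)[OF that(1) pt(1)[OF that]])
    show "coded.weight branch_weight v (pt w x) \<le> exp (K * \<theta> ^ n) * coded.weight branch_weight v (pt w y)"
      if v: "v \<in> words \<P> k" and w: "w \<in> words \<P> n" and x: "x \<in> core" and y: "y \<in> core" for v k w n x y
    proof -
      have "birkhoff_sum f \<phi> k (pt v (pt w x)) - birkhoff_sum f \<phi> k (pt v (pt w y)) \<le> K * \<theta> ^ n * (1 - \<theta> ^ k)"
        by (rule dist[OF w x y v])
      also have "\<dots> \<le> K * \<theta> ^ n * 1" using K t by (intro mult_left_mono) auto
      finally have "birkhoff_sum f \<phi> k (pt v (pt w x)) \<le> K * \<theta> ^ n + birkhoff_sum f \<phi> k (pt v (pt w y))" by simp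
      thus ?thesis unfolding weight_birkhoff[OF v coded.branch_in[OF w x]] weight_birkhoff[OF v coded.branch_in[OF w y]]
        by (simp flip: exp_add)
    qed
  qed (use mass_sum gibbs_const(1) K t in auto)
  obtain p B K' where p: "markov_branches core \<P> inv_branch p B K' \<theta>"
    "\<And>n w x. w \<in> words \<P> n \<Longrightarrow> x \<in> core \<Longrightarrow> mass w \<le> B * coded.weight p w x \<and> coded.weight p w x \<le> B * mass w"
    using gibbs_branches.normalised_weights[OF gb] by blast
  have "mass w \<le> \<theta> ^ n" if "w \<in> words \<P> n" for w n
    using t2(3)[OF that] power_mono[of \<theta>2 \<theta> n] t t2 by linarith
  thus ?thesis using p unfolding coding_def by blast
qed

definition cyl_union :: "real set list set \<Rightarrow> real set" where
  "cyl_union V = (\<Union>v\<in>V. cyl v)"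

lemma cyl_union_sets: "V \<subseteq> words \<P> m \<Longrightarrow> cyl_union V \<in> sets M"
  unfolding cyl_union_def using fin_P cyl_sets finite_subset[OF _ finite_words]
  by (intro sets.finite_UN) auto

lemma measure_cyl_union: "V \<subseteq> words \<P> m \<Longrightarrow> measure M (cyl_union V) = (\<Sum>v\<in>V. mass v)"
  unfolding cyl_union_def
proof (rule finite_measure_finite_Union)
  assume V: "V \<subseteq> words \<P> m"
  show "finite V" using V finite_subset finite_words[OF fin_P] by blast
  show "disjoint_family_on cyl V" using V cyl_unique unfolding disjoint_family_on_def by blast
  show "cyl ` V \<subseteq> sets M" using V cyl_sets by blast
qed

lemma pt_in_cyl_union:
  assumes "V \<subseteq> words \<P> m" "w \<in> words \<P> m" "x \<in> core"
  shows "pt w x \<in> cyl_union V \<longleftrightarrow> w \<in> V"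
  using assms cyl_unique[OF assms(2) _ pt(1)[OF assms(2,3)]] pt(1)[OF assms(2,3)]
  unfolding cyl_union_def by blast

lemma visits_measurable: "E \<in> sets M \<Longrightarrow> (\<lambda>x. \<Sum>i<N. indicat_real E ((f ^^ i) x)) \<in> borel_measurable M"
  by (intro borel_measurable_sum measurable_compose[OF f_pow_measurable]) simp

lemma visits_sets: "E \<in> sets M \<Longrightarrow> {x \<in> I. (\<Sum>i<N. indicat_real E ((f ^^ i) x)) \<le> c} \<in> sets M"
  using borel_measurable_le[OF visits_measurable borel_measurable_const, of E N c] by simp

lemma ball_visits_sets:
  "{x \<in> I. (\<Sum>i<N. indicat_real (ball y r) ((f ^^ i) x)) \<le> c} \<in> sets M"
proof -
  have "{x \<in> I. (\<Sum>i<N. indicat_real (ball y r) ((f ^^ i) x)) \<le> c}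
      = {x \<in> I. (\<Sum>i<N. indicat_real (ball y r \<inter> I) ((f ^^ i) x)) \<le> c}"
    using f_pow_in_I
    by (intro Collect_cong conj_cong refl arg_cong2[where f = "(\<le>)"] sum.cong) (auto simp: indicator_def)
  thus ?thesis using visits_sets[OF I_borel_in_sets[of "ball y r"], of N] by simp
qed

lemma coded_cylinder_function:
  assumes "coding p B K \<theta>" "V \<subseteq> words \<P> m"
  shows "markov_branches.cylinder_function core \<P> inv_branch m (indicat_real (cyl_union V))"
proof -
  interpret mk: markov_branches core \<P> inv_branch p B K \<theta> using assms(1) by (simp add: coding_def)
  show ?thesis unfolding mk.cylinder_function_def
  proof (intro conjI ballI)
    fix w x y assume "w \<in> words \<P> m" "x \<in> core" "y \<in> core"
    thus "indicat_real (cyl_union V) (pt w x) = indicat_real (cyl_union V) (pt w y)"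
      using pt_in_cyl_union[OF assms(2)] by (simp add: indicator_def)
  qed (auto simp: indicator_def)
qed

text \<open>
  The number of visits up to time \<open>N\<close> is constant on the points of the core in a cylinder of
  level \<open>m + N\<close>, so the measure of the event is a sum of masses and comparable with a sum of
  weights at a single point.
\<close>

lemma lower_deviation_union:
  assumes cod: "coding p B K \<theta>" and V: "V \<subseteq> words \<P> m" and \<epsilon>: "\<epsilon> \<in> {0<..<1}"
    and n0: "n0 = m + markov_branches.mixing_time core \<P> inv_branch p (\<epsilon> / 4)"
    and W: "\<And>x. x \<in> core \<Longrightarrow> (\<Sum>n=1..n0. (coded.transfer p ^^ n) (indicat_real (cyl_union V)) x) \<le> W" "0 \<le> W"
  defines "a \<equiv> markov_branches.equilibrium core \<P> inv_branch p (indicat_real (cyl_union V))"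
  shows "measure M {x \<in> I. (\<Sum>i<N. indicat_real (cyl_union V) ((f ^^ i) x)) \<le> (1 - \<epsilon>) * a * real N}
     \<le> 2 * B * exp (- (real N * a * \<epsilon>\<^sup>2 / (16 * (1 + W))))"
proof -
  interpret mk: markov_branches core \<P> inv_branch p B K \<theta> using cod by (simp add: coding_def)
  define u where "u = indicat_real (cyl_union V)"
  have u: "mk.cylinder_function m u" unfolding u_def by (rule coded_cylinder_function[OF cod V])
  have eta: "\<epsilon> / 4 \<in> {0<..<1}" using \<epsilon> by auto
  have a: "0 \<le> a" unfolding a_def u_def[symmetric] by (rule mk.equilibrium_bounds(1)[OF u])
  have low: "(1 - \<epsilon> / 4) * a \<le> (mk.T ^^ Suc n0) u x" if x: "x \<in> core" for x
  proof -
    define t where "t = (mk.T ^^ Suc n0) u x"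
    have t: "0 \<le> t" unfolding t_def by (rule mk.iterate_unit(1)[OF u x])
    have "a \<le> (1 + \<epsilon> / 4) * t"
      unfolding a_def u_def[symmetric] t_def by (rule mk.equilibrium_le[OF u eta _ x]) (simp add: n0)
    hence "(1 - \<epsilon> / 4) * a \<le> (1 - \<epsilon> / 4) * ((1 + \<epsilon> / 4) * t)"
      using \<epsilon> by (intro mult_left_mono) auto
    also have "\<dots> = t - (\<epsilon> / 4)\<^sup>2 * t" by (simp add: power2_eq_square field_simps)
    also have "\<dots> \<le> t" using t by simp
    finally show ?thesis by (simp only: t_def)
  qed
  define S where "S x = (\<Sum>i<N. u ((f ^^ i) x))" for x
  define Z where "Z = (1 - \<epsilon>) * a * real N"
  obtain x0 where x0: "x0 \<in> core" using core_nonempty by blast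
  define bad where "bad = {w. w \<in> words \<P> (m + N) \<and> S (pt w x0) \<le> Z}"
  have fbad: "finite bad" by (rule finite_subset[OF _ finite_words[OF fin_P, of "m + N"]]) (auto simp: bad_def)
  have const: "S (pt w x) = S (pt w y)" if w: "w \<in> words \<P> (m + N)" and x: "x \<in> core" and y: "y \<in> core" for w x y
    unfolding S_def
  proof (rule sum.cong[OF refl])
    fix i assume i: "i \<in> {..<N}"
    have "w \<in> words \<P> (i + (m + N - i))" using w i by simp
    then obtain w1 w2 where s: "w1 \<in> words \<P> i" "w2 \<in> words \<P> (m + N - i)" "w = w1 @ w2" by (rule words_split)
    have "(f ^^ i) (pt w z) = pt w2 z" if "z \<in> core" for z
      unfolding s(3) branch_append by (rule pt(2)[OF s(1) coded.branch_in[OF s(2) that]])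
    moreover have "mk.cylinder_function (m + N - i) u" by (rule mk.cylinder_function_mono[OF u]) (use i in auto)
    ultimately show "u ((f ^^ i) (pt w x)) = u ((f ^^ i) (pt w y))"
      using mk.cylinder_functionD(3)[OF _ s(2) x y] x y by simp
  qed
  define G where "G = {x \<in> I. S x \<le> Z}"
  have Gs: "G \<in> sets M" unfolding G_def S_def u_def by (rule visits_sets[OF cyl_union_sets[OF V]])
  have "G \<inter> core \<subseteq> cyl_union bad"
  proof
    fix x assume x: "x \<in> G \<inter> core"
    obtain w where w: "w \<in> words \<P> (m + N)" "x \<in> cyl w" using cyl_cover core_I x by blast
    have e: "pt w ((f ^^ (m + N)) x) = x" using pt_f_pow[OF w] x by blast
    have "S (pt w x0) = S (pt w ((f ^^ (m + N)) x))" using const[OF w(1) x0] f_pow_core x by blast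
    hence "w \<in> bad" using x w e unfolding bad_def G_def by simp
    thus "x \<in> cyl_union bad" using w unfolding cyl_union_def by blast
  qed
  hence "measure M (G \<inter> core) \<le> measure M (cyl_union bad)"
    by (intro finite_measure_mono cyl_union_sets[of _ "m + N"]) (auto simp: bad_def)
  also have "\<dots> = (\<Sum>w\<in>bad. mass w)" by (rule measure_cyl_union[of _ "m + N"]) (auto simp: bad_def)
  also have "\<dots> \<le> (\<Sum>w\<in>bad. B * coded.weight p w x0)"
    using cod x0 unfolding coding_def bad_def by (intro sum_mono) auto
  also have "\<dots> = B * (\<Sum>w | w \<in> words \<P> (m + N) \<and> S (pt w x0) \<le> Z. coded.weight p w x0)"
    unfolding bad_def sum_distrib_left ..
  also have "\<dots> \<le> B * (2 * exp (- (real N * a * \<epsilon>\<^sup>2 / (16 * (1 + W)))))"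
  proof (rule mult_left_mono)
    show "(\<Sum>w | w \<in> words \<P> (m + N) \<and> S (pt w x0) \<le> Z. coded.weight p w x0) \<le> 2 * exp (- (real N * a * \<epsilon>\<^sup>2 / (16 * (1 + W))))"
      unfolding S_def Z_def
      by (rule mk.lower_deviation_words[OF _ _ _ W(2) low a \<epsilon> x0])
         (use inv_branch_core(2) W(1) in \<open>auto simp: u_def indicator_def\<close>)
    show "0 \<le> B" using mk.B1 by simp
  qed
  finally show ?thesis using measure_core[OF Gs] unfolding G_def S_def Z_def u_def by simp
qed

section \<open>Visits to a ball\<close>

lemma integral_visits:
  assumes E: "E \<in> sets M"
  shows "integrable M (\<lambda>x. \<Sum>i<N. indicat_real E ((f ^^ i) x))"
    "(\<integral>x. (\<Sum>i<N. indicat_real E ((f ^^ i) x)) \<partial>M) = real N * measure M E"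
proof -
  have eq: "indicat_real E ((f ^^ i) x) = indicat_real ((f ^^ i) -` E \<inter> I) x" if "x \<in> space M" for i x
    using that by (simp add: indicator_def)
  have s: "(f ^^ i) -` E \<inter> I \<in> sets M" for i using measurable_sets[OF f_pow_measurable E, of i] by simp
  have i: "integrable M (\<lambda>x. indicat_real E ((f ^^ i) x))" for i
    by (subst Bochner_Integration.integrable_cong[OF refl eq]) (use s in \<open>auto simp: emeasure_eq_measure\<close>)
  thus "integrable M (\<lambda>x. \<Sum>i<N. indicat_real E ((f ^^ i) x))" by auto
  have "(\<integral>x. indicat_real E ((f ^^ i) x) \<partial>M) = measure M E" for i
    by (subst Bochner_Integration.integral_cong[OF refl eq]) (use s measure_vimage_f[OF E] sets.sets_into_space[OF s] in \<open>auto simp: Int_absorb2\<close>)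
  thus "(\<integral>x. (\<Sum>i<N. indicat_real E ((f ^^ i) x)) \<partial>M) = real N * measure M E"
    by (subst Bochner_Integration.integral_sum) (use i in auto)
qed

text \<open>
  The number of visits is at least \<open>(1 - \<epsilon>) * a * N\<close> outside a set of exponentially small
  measure, where \<open>a\<close> is the equilibrium value, while its mean is \<open>N\<close> times the measure of the
  set by invariance. Here the crude bound \<open>W = n0\<close> suffices.
\<close>

lemma equilibrium_le_measure:
  assumes cod: "coding p B K \<theta>" and V: "V \<subseteq> words \<P> m"
  shows "markov_branches.equilibrium core \<P> inv_branch p (indicat_real (cyl_union V)) \<le> measure M (cyl_union V)"
proof -
  interpret mk: markov_branches core \<P> inv_branch p B K \<theta> using cod by (simp add: coding_def)
  define u where "u = indicat_real (cyl_union V)"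
  define a where "a = mk.equilibrium u"
  define \<mu> where "\<mu> = measure M (cyl_union V)"
  have u: "mk.cylinder_function m u" unfolding u_def by (rule coded_cylinder_function[OF cod V])
  have a0: "0 \<le> a" unfolding a_def by (rule mk.equilibrium_bounds(1)[OF u])
  have "z * a \<le> \<mu>" if z: "0 < z" "z < 1" for z
  proof (cases "a = 0")
    case True thus ?thesis by (simp add: \<mu>_def)
  next
    case False
    define \<epsilon> where "\<epsilon> = 1 - z"
    have \<epsilon>: "\<epsilon> \<in> {0<..<1}" using z by (simp add: \<epsilon>_def)
    define n0 where "n0 = m + mk.mixing_time (\<epsilon> / 4)"
    define W where "W = real n0"
    have W: "(\<Sum>n=1..n0. (mk.T ^^ n) u x) \<le> W" if "x \<in> core" for x
    proof -
      have "(\<Sum>n=1..n0. (mk.T ^^ n) u x) \<le> (\<Sum>n=1..n0. 1)" using mk.iterate_unit(2)[OF u that] by (intro sum_mono)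
      thus ?thesis by (simp add: W_def)
    qed
    define \<gamma> where "\<gamma> = a * \<epsilon>\<^sup>2 / (16 * (1 + W))"
    have W0: "0 \<le> W" by (simp add: W_def)
    have g: "0 < \<gamma>" using a0 False \<epsilon> W0 by (auto simp: \<gamma>_def intro!: divide_pos_pos mult_pos_pos)
    have key: "z * a * (1 - 2 * B * exp (- \<gamma>) ^ N) \<le> \<mu>" if N: "0 < N" for N
    proof -
      define S where "S x = (\<Sum>i<N. u ((f ^^ i) x))" for x
      define G where "G = {x \<in> I. S x \<le> (1 - \<epsilon>) * a * real N}"
      have Gs: "G \<in> sets M" unfolding G_def S_def u_def by (rule visits_sets[OF cyl_union_sets[OF V]])
      have PG: "measure M G \<le> 2 * B * exp (- (real N * a * \<epsilon>\<^sup>2 / (16 * (1 + W))))"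
        unfolding G_def S_def u_def a_def
        by (rule lower_deviation_union[OF cod V \<epsilon> n0_def _ W0]) (use W in \<open>simp add: u_def\<close>)
      also have "\<dots> = 2 * B * exp (- \<gamma>) ^ N" by (simp add: \<gamma>_def flip: exp_of_nat_mult)
      finally have PG: "measure M G \<le> 2 * B * exp (- \<gamma>) ^ N" .
      have S0: "0 \<le> S x" for x unfolding S_def u_def by (intro sum_nonneg) auto
      have nG: "I - G \<in> sets M" using sets.compl_sets[OF Gs] by simp
      have "z * a * real N * (1 - measure M G) = (\<integral>x. z * a * real N * indicat_real (I - G) x \<partial>M)"
        using prob_compl[OF Gs] nG sets.sets_into_space[OF nG] by (simp add: Int_absorb2)
      also have "\<dots> \<le> (\<integral>x. S x \<partial>M)"
      proof (rule integral_mono)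
        show "integrable M (\<lambda>x. z * a * real N * indicat_real (I - G) x)"
          using nG by (simp add: emeasure_eq_measure)
        show "integrable M S" unfolding S_def u_def by (rule integral_visits(1)[OF cyl_union_sets[OF V]])
        show "z * a * real N * indicat_real (I - G) x \<le> S x" if "x \<in> space M" for x
          using that S0[of x] by (auto simp: indicator_def G_def \<epsilon>_def)
      qed
      also have "\<dots> = real N * \<mu>" unfolding S_def u_def \<mu>_def by (rule integral_visits(2)[OF cyl_union_sets[OF V]])
      finally have "z * a * (1 - measure M G) \<le> \<mu>" using N by (simp add: mult_ac)
      moreover have "z * a * (1 - 2 * B * exp (- \<gamma>) ^ N) \<le> z * a * (1 - measure M G)"
        using PG z a0 by (intro mult_left_mono) auto
      ultimately show ?thesis by simp
    qed
    have "(\<lambda>N. exp (- \<gamma>) ^ N) \<longlonglongrightarrow> 0" using g by (intro LIMSEQ_realpow_zero) auto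
    hence "(\<lambda>N. z * a * (1 - 2 * B * exp (- \<gamma>) ^ N)) \<longlonglongrightarrow> z * a * (1 - 2 * B * 0)"
      by (intro tendsto_mult tendsto_diff tendsto_const)
    hence "z * a * (1 - 2 * B * 0) \<le> \<mu>"
      by (rule LIMSEQ_le_const2) (use key in \<open>auto intro!: exI[of _ 1]\<close>)
    thus ?thesis by simp
  qed
  hence "a \<le> \<mu>" by (rule field_le_mult_one_interval)
  thus ?thesis by (simp add: a_def \<mu>_def u_def)
qed

text \<open>
  The inequality just proved holds for the complementary union as well, and both sides add up
  to one.
\<close>

lemma equilibrium_eq_measure:
  assumes cod: "coding p B K \<theta>" and V: "V \<subseteq> words \<P> m"
  shows "markov_branches.equilibrium core \<P> inv_branch p (indicat_real (cyl_union V)) = measure M (cyl_union V)"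
proof -
  interpret mk: markov_branches core \<P> inv_branch p B K \<theta> using cod by (simp add: coding_def)
  define u where "u = indicat_real (cyl_union V)"
  define V' where "V' = words \<P> m - V"
  have V': "V' \<subseteq> words \<P> m" by (auto simp: V'_def)
  have u: "mk.cylinder_function m u" unfolding u_def by (rule coded_cylinder_function[OF cod V])
  have eq: "indicat_real (cyl_union V') x = 1 - u x" if x: "x \<in> core" for x
  proof -
    obtain w where w: "w \<in> words \<P> m" "x \<in> cyl w" using cyl_cover core_I x by blast
    have e: "pt w ((f ^^ m) x) = x" by (rule pt_f_pow[OF w x])
    have "x \<in> cyl_union V \<longleftrightarrow> w \<in> V" "x \<in> cyl_union V' \<longleftrightarrow> w \<in> V'"
      using pt_in_cyl_union[OF V w(1) f_pow_core[OF x, of m]] pt_in_cyl_union[OF V' w(1) f_pow_core[OF x, of m]]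
      unfolding e by auto
    thus ?thesis using w by (simp add: u_def indicator_def V'_def)
  qed
  have "mk.equilibrium (indicat_real (cyl_union V')) = mk.equilibrium (\<lambda>x. 1 - u x)"
    unfolding mk.equilibrium_def by (simp only: coded.transfer_pow_cong[OF eq mk.base_point])
  also have "\<dots> = 1 - mk.equilibrium u" by (rule mk.equilibrium_complement[OF u])
  finally have "1 - mk.equilibrium u \<le> measure M (cyl_union V')"
    using equilibrium_le_measure[OF cod V'] by simp
  also have "\<dots> = 1 - measure M (cyl_union V)"
    unfolding measure_cyl_union[OF V'] measure_cyl_union[OF V]
    using sum.subset_diff[OF V finite_words[OF fin_P], of mass] mass_sum[of m] by (simp add: V'_def)
  finally show ?thesis using equilibrium_le_measure[OF cod V] by (simp add: u_def)
qed

text \<open>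
  Only the points of the core are tested, so that the images of inverse branches describe the
  cylinders exactly.
\<close>

definition inside_words :: "real set \<Rightarrow> nat \<Rightarrow> real set list set" where
  "inside_words S n = {v \<in> words \<P> n. pt v ` core \<subseteq> S}"

definition cut_words :: "real set \<Rightarrow> nat \<Rightarrow> real set list set" where
  "cut_words S n = {v \<in> words \<P> n. (\<exists>x\<in>core. pt v x \<in> S) \<and> \<not> pt v ` core \<subseteq> S}"

lemma finite_words_sub: "V \<subseteq> words \<P> n \<Longrightarrow> finite V"
  using finite_subset finite_words[OF fin_P] by blast

text \<open>
  A cylinder that is cut by the ball contains one of the end points of the ball, and each end
  point lies in at most one cylinder of level \<open>n\<close>.
\<close>

lemma cut_mass:
  assumes decay: "\<And>w. w \<in> words \<P> n \<Longrightarrow> mass w \<le> t" and t: "0 \<le> t"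
  shows "(\<Sum>v\<in>cut_words (ball y r) n. mass v) \<le> 2 * t"
proof -
  define At where "At z = {v \<in> words \<P> n. z \<in> cyl v}" for z
  have At: "(\<Sum>v\<in>At z. mass v) \<le> t" for z
  proof (cases "At z = {}")
    case True thus ?thesis using t by simp
  next
    case False
    then obtain v where v: "v \<in> At z" by blast
    hence "At z = {v}" unfolding At_def using cyl_unique by blast
    moreover have "mass v \<le> t" using v by (intro decay) (simp add: At_def)
    ultimately show ?thesis by simp
  qed
  have sub: "cut_words (ball y r) n \<subseteq> At (y - r) \<union> At (y + r)"
  proof
    fix v assume v: "v \<in> cut_words (ball y r) n"
    then obtain x x' where x: "x \<in> core" "pt v x \<in> ball y r" "x' \<in> core" "pt v x' \<notin> ball y r"
      and w: "v \<in> words \<P> n" unfolding cut_words_def by blast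
    note int = mem_is_interval_1_I[OF cyl_interval[OF w]]
    note c = pt(1)[OF w x(1)] pt(1)[OF w x(3)]
    have "y - r < pt v x" "pt v x < y + r" using x(2) by (auto simp: dist_real_def)
    moreover have "pt v x' \<le> y - r \<or> y + r \<le> pt v x'" using x(4) by (auto simp: dist_real_def)
    ultimately have "y - r \<in> cyl v \<or> y + r \<in> cyl v"
      using int[OF c(2,1), of "y - r"] int[OF c, of "y + r"] by auto
    thus "v \<in> At (y - r) \<union> At (y + r)" using w by (auto simp: At_def)
  qed
  have fin: "finite (At z)" for z unfolding At_def using fin_P by simp
  have "(\<Sum>v\<in>cut_words (ball y r) n. mass v) \<le> (\<Sum>v\<in>At (y - r) \<union> At (y + r). mass v)"
    using sub fin by (intro sum_mono2) auto
  also have "\<dots> \<le> (\<Sum>v\<in>At (y - r). mass v) + (\<Sum>v\<in>At (y + r). mass v)"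
    using sum_Un_nat fin sum.union_inter[of "At (y - r)" "At (y + r)" mass]
      sum_nonneg[of "At (y - r) \<inter> At (y + r)" mass] by force
  finally show ?thesis using At[of "y - r"] At[of "y + r"] by simp
qed

lemma inside_sub: "inside_words S n \<subseteq> words \<P> n" and cut_sub: "cut_words S n \<subseteq> words \<P> n"
  by (auto simp: inside_words_def cut_words_def)

lemma cyl_union_core:
  assumes V: "V \<subseteq> words \<P> n" and x: "x \<in> cyl_union V" "x \<in> core"
  obtains w where "w \<in> V" "w \<in> words \<P> n" "(f ^^ n) x \<in> core" "pt w ((f ^^ n) x) = x"
proof -
  obtain w where w: "w \<in> V" "x \<in> cyl w" using x unfolding cyl_union_def by blast
  hence "w \<in> words \<P> n" using V by blast
  thus ?thesis using that[OF w(1)] pt_f_pow[OF _ w(2) x(2)] f_pow_core[OF x(2)] by blast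
qed

lemma inside_mass_le:
  "S \<in> sets borel \<Longrightarrow> (\<Sum>v\<in>inside_words S n. mass v) \<le> measure M (S \<inter> I)"
proof -
  assume S: "S \<in> sets borel"
  have "cyl_union (inside_words S n) \<inter> core \<subseteq> S \<inter> I"
  proof
    fix x assume x: "x \<in> cyl_union (inside_words S n) \<inter> core"
    obtain w where w: "w \<in> inside_words S n" "(f ^^ n) x \<in> core" "pt w ((f ^^ n) x) = x"
      using x by (elim IntE cyl_union_core[OF inside_sub])
    hence "x \<in> S" unfolding inside_words_def by (metis (no_types, lifting) image_subset_iff mem_Collect_eq)
    thus "x \<in> S \<inter> I" using x core_I by blast
  qed
  hence "measure M (cyl_union (inside_words S n) \<inter> core) \<le> measure M (S \<inter> I)"
    by (rule finite_measure_mono) (rule I_borel_in_sets[OF S])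
  thus ?thesis
    using measure_core[OF cyl_union_sets[OF inside_sub]] measure_cyl_union[OF inside_sub] by simp
qed

lemma touch_mass_le:
  assumes decay: "\<And>w. w \<in> words \<P> n \<Longrightarrow> mass w \<le> t" and t: "0 \<le> t"
    and V: "V \<subseteq> words \<P> n" "\<And>v. v \<in> V \<Longrightarrow> \<exists>x\<in>core. pt v x \<in> ball y r"
  shows "(\<Sum>v\<in>V. mass v) \<le> ball_measure M y r + 2 * t"
proof -
  let ?in = "inside_words (ball y r) n" and ?cut = "cut_words (ball y r) n"
  have "V \<subseteq> ?in \<union> ?cut"
  proof
    fix v assume "v \<in> V"
    thus "v \<in> ?in \<union> ?cut" using V unfolding inside_words_def cut_words_def by blast
  qed
  hence "(\<Sum>v\<in>V. mass v) \<le> (\<Sum>v\<in>?in \<union> ?cut. mass v)"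
    using finite_words_sub[OF inside_sub] finite_words_sub[OF cut_sub] by (intro sum_mono2) auto
  also have "\<dots> = (\<Sum>v\<in>?in. mass v) + (\<Sum>v\<in>?cut. mass v)"
    by (rule sum.union_disjoint[OF finite_words_sub[OF inside_sub] finite_words_sub[OF cut_sub]])
       (auto simp: inside_words_def cut_words_def)
  also have "\<dots> \<le> ball_measure M y r + 2 * t"
    using inside_mass_le[of "ball y r" n] cut_mass[OF decay t] by (simp add: ball_measure_def add_mono)
  finally show ?thesis .
qed

lemma inside_mass_ge:
  assumes decay: "\<And>w. w \<in> words \<P> n \<Longrightarrow> mass w \<le> t" and t: "0 \<le> t"
  shows "ball_measure M y r - 2 * t \<le> (\<Sum>v\<in>inside_words (ball y r) n. mass v)"
proof -
  let ?in = "inside_words (ball y r) n" and ?cut = "cut_words (ball y r) n"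
  have sub: "?in \<union> ?cut \<subseteq> words \<P> n" using inside_sub cut_sub by blast
  have s: "ball y r \<inter> I \<in> sets M" by (rule I_borel_in_sets) simp
  have "(ball y r \<inter> I) \<inter> core \<subseteq> cyl_union (?in \<union> ?cut)"
  proof
    fix x assume x: "x \<in> (ball y r \<inter> I) \<inter> core"
    obtain w where w: "w \<in> words \<P> n" "x \<in> cyl w" using cyl_cover x by blast
    have "pt w ((f ^^ n) x) = x" "(f ^^ n) x \<in> core" using pt_f_pow[OF w] f_pow_core x by blast+
    hence "\<exists>z\<in>core. pt w z \<in> ball y r" using x by (metis IntD1)
    hence "w \<in> ?in \<union> ?cut" using w unfolding inside_words_def cut_words_def by blast
    thus "x \<in> cyl_union (?in \<union> ?cut)" using w unfolding cyl_union_def by blast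
  qed
  hence "measure M ((ball y r \<inter> I) \<inter> core) \<le> measure M (cyl_union (?in \<union> ?cut))"
    by (rule finite_measure_mono) (rule cyl_union_sets[OF sub])
  also have "\<dots> = (\<Sum>v\<in>?in \<union> ?cut. mass v)" by (rule measure_cyl_union[OF sub])
  also have "\<dots> = (\<Sum>v\<in>?in. mass v) + (\<Sum>v\<in>?cut. mass v)"
    by (rule sum.union_disjoint[OF finite_words_sub[OF inside_sub] finite_words_sub[OF cut_sub]])
       (auto simp: inside_words_def cut_words_def)
  finally show ?thesis using measure_core[OF s] cut_mass[OF decay t, of n y r] by (simp add: ball_measure_def)
qed

lemma ball_measure_le_1: "ball_measure M y r \<le> 1"
  by (simp add: ball_measure_def)

text \<open>
  The ball is replaced by the union of the cylinders of level \<open>m\<close> inside it, with \<open>m\<close> so large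
  that a proportion of at most \<open>\<epsilon> / 2\<close> of the measure is lost. The number \<open>W\<close> of expected
  short returns is bounded by a constant times \<open>n0 * \<mu> + 1\<close>. As \<open>n0\<close> is of order
  \<open>ln (1 / \<mu>) + (1 + ln (1 / \<epsilon>))\<^sup>2\<close> and \<open>\<mu> * ln (1 / \<mu>) \<le> 1\<close>, this does not depend on the size
  of the ball.
\<close>

lemma lower_deviation_ball:
  "\<exists>c>0. \<exists>C\<ge>1. \<forall>\<epsilon>\<in>{0<..<1}. \<forall>y r N. 0 < ball_measure M y r \<longrightarrow>
     measure M {x \<in> I. (\<Sum>i<N. indicat_real (ball y r) ((f ^^ i) x)) \<le> (1 - \<epsilon>) * ball_measure M y r * real N}
     \<le> C * exp (- (c * \<epsilon>\<^sup>2 / (1 + ln (1 / \<epsilon>))\<^sup>2 * ball_measure M y r * real N))"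
proof -
  obtain p B K \<theta> where cod: "coding p B K \<theta>" using coding_exists by blast
  interpret mk: markov_branches core \<P> inv_branch p B K \<theta> using cod by (simp add: coding_def)
  have decay: "mass w \<le> \<theta> ^ n" if "w \<in> words \<P> n" for w n using cod that by (simp add: coding_def)
  have \<theta>0: "0 \<le> \<theta> ^ n" for n using mk.\<theta> by simp
  obtain Cm where Cm: "Cm \<ge> 0" "\<And>\<eta>. \<eta> \<in> {0<..<1} \<Longrightarrow> real (mk.mixing_time \<eta>) \<le> Cm * (1 + ln (1 / \<eta>))\<^sup>2"
    using mk.mixing_time by blast
  obtain C1 where C1: "C1 \<ge> 0" "\<And>\<eta>. \<eta> \<in> {0<..1} \<Longrightarrow> \<exists>i::nat. real i \<le> C1 * (1 + ln (1 / \<eta>)) \<and> 2 * \<theta> ^ i \<le> \<eta>"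
    using geometric_reach[of \<theta> 2] mk.\<theta> by auto
  define W0 where "W0 = B * (3 * C1 + 16 * Cm + 2 / (1 - \<theta>))"
  have W0: "0 \<le> W0" unfolding W0_def using mk.B1 C1(1) Cm(1) mk.\<theta> by (intro mult_nonneg_nonneg add_nonneg_nonneg) auto
  define c where "c = 1 / (128 * (1 + W0))"
  have c: "c > 0" using W0 by (simp add: c_def)
  have "measure M {x \<in> I. (\<Sum>i<N. indicat_real (ball y r) ((f ^^ i) x)) \<le> (1 - \<epsilon>) * ball_measure M y r * real N}
     \<le> 2 * B * exp (- (c * \<epsilon>\<^sup>2 / (1 + ln (1 / \<epsilon>))\<^sup>2 * ball_measure M y r * real N))"
    if \<epsilon>: "\<epsilon> \<in> {0<..<1}" and pos: "0 < ball_measure M y r" for \<epsilon> y r N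
  proof -
    define \<mu> where "\<mu> = ball_measure M y r"
    have \<mu>: "0 < \<mu>" "\<mu> \<le> 1" using pos ball_measure_le_1 by (auto simp: \<mu>_def)
    define L where "L = 1 + ln (1 / \<epsilon>)"
    have L: "1 \<le> L" using \<epsilon> by (simp add: L_def)
    have LL: "L \<le> L\<^sup>2" using L mult_left_mono[of 1 L L] by (simp add: power2_eq_square)
    have \<eta>: "\<epsilon> / 2 * \<mu> \<in> {0<..1}" using \<epsilon> \<mu> mult_mono[of "\<epsilon> / 2" 1 \<mu> 1] by auto
    obtain m where m: "real m \<le> C1 * (1 + ln (1 / (\<epsilon> / 2 * \<mu>)))" "2 * \<theta> ^ m \<le> \<epsilon> / 2 * \<mu>"
      using C1(2)[OF \<eta>] by blast
    have ln2: "ln 2 \<le> (1::real)" using ln_le_minus_one[of "2::real"] by simp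
    have m\<mu>: "real m * \<mu> \<le> 3 * C1 * L\<^sup>2"
    proof -
      have "ln (1 / (\<epsilon> / 2 * \<mu>)) = ln 2 + ln (1 / \<epsilon>) + ln (1 / \<mu>)"
        using \<epsilon> \<mu> by (simp add: ln_div ln_mult)
      hence "(1 + ln (1 / (\<epsilon> / 2 * \<mu>))) * \<mu> = (1 + ln 2 + ln (1 / \<epsilon>)) * \<mu> + ln (1 / \<mu>) * \<mu>" by (simp add: algebra_simps)
      also have "\<dots> \<le> (1 + L) * 1 + (1 / \<mu> - 1) * \<mu>"
      proof (rule add_mono)
        show "(1 + ln 2 + ln (1 / \<epsilon>)) * \<mu> \<le> (1 + L) * 1"
          using ln2 \<mu> L by (intro mult_mono) (auto simp: L_def)
        have "ln (1 / \<mu>) \<le> 1 / \<mu> - 1" using \<mu> by (intro ln_le_minus_one) simp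
        thus "ln (1 / \<mu>) * \<mu> \<le> (1 / \<mu> - 1) * \<mu>" using \<mu> by (intro mult_right_mono) auto
      qed
      also have "\<dots> \<le> 3 * L\<^sup>2" using \<mu> L LL by (simp add: algebra_simps)
      finally have "C1 * ((1 + ln (1 / (\<epsilon> / 2 * \<mu>))) * \<mu>) \<le> C1 * (3 * L\<^sup>2)" using C1(1) by (intro mult_left_mono)
      moreover have "real m * \<mu> \<le> C1 * (1 + ln (1 / (\<epsilon> / 2 * \<mu>))) * \<mu>" using m(1) \<mu> by (intro mult_right_mono) auto
      ultimately show ?thesis by (simp add: mult_ac)
    qed
    define k where "k = mk.mixing_time (\<epsilon> / 2 / 4)"
    have k\<mu>: "real k * \<mu> \<le> 16 * Cm * L\<^sup>2"
    proof -
      have "ln (8::real) = 3 * ln 2" using ln_realpow[of 2 3] by simp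
      hence "ln (1 / (\<epsilon> / 2 / 4)) \<le> 3 + ln (1 / \<epsilon>)" using \<epsilon> ln2 by (simp add: ln_div)
      hence "1 + ln (1 / (\<epsilon> / 2 / 4)) \<le> 4 * L" using L by (simp add: L_def)
      moreover have "0 \<le> 1 + ln (1 / (\<epsilon> / 2 / 4))" using \<epsilon> by (simp add: add_nonneg_nonneg)
      ultimately have "(1 + ln (1 / (\<epsilon> / 2 / 4)))\<^sup>2 \<le> (4 * L)\<^sup>2" by (intro power_mono)
      hence "Cm * (1 + ln (1 / (\<epsilon> / 2 / 4)))\<^sup>2 \<le> Cm * (4 * L)\<^sup>2" using Cm(1) by (intro mult_left_mono)
      hence "real k \<le> 16 * Cm * L\<^sup>2" using Cm(2)[of "\<epsilon> / 2 / 4"] \<epsilon> by (simp add: k_def power_mult_distrib mult_ac)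
      moreover have "real k * \<mu> \<le> real k * 1" using \<mu> by (intro mult_left_mono) auto
      ultimately show ?thesis by simp
    qed
    define V where "V = inside_words (ball y r) m"
    have V: "V \<subseteq> words \<P> m" unfolding V_def by (rule inside_sub)
    define u where "u = indicat_real (cyl_union V)"
    define a where "a = measure M (cyl_union V)"
    have "\<mu> - 2 * \<theta> ^ m \<le> a"
      unfolding \<mu>_def a_def measure_cyl_union[OF V] unfolding V_def by (rule inside_mass_ge[OF decay \<theta>0])
    hence a: "(1 - \<epsilon> / 2) * \<mu> \<le> a" using m(2) by (simp add: algebra_simps)
    have uball: "u x \<le> indicat_real (ball y r) x" if x: "x \<in> core" for x
    proof (cases "x \<in> cyl_union V")
      case True
      then obtain w where "w \<in> V" "(f ^^ m) x \<in> core" "pt w ((f ^^ m) x) = x"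
        using x by (rule cyl_union_core[OF V])
      hence "x \<in> ball y r" unfolding V_def inside_words_def by (metis (no_types, lifting) image_subset_iff mem_Collect_eq)
      thus ?thesis by (simp add: u_def indicator_def)
    qed (simp add: u_def)
    \<comment> \<open>Words that lead from \<open>x\<close> into the ball are inside it or cut by it.\<close>
    have Tn: "(mk.T ^^ n) u x \<le> B * (\<mu> + 2 * \<theta> ^ n)" if x: "x \<in> core" for x n
    proof -
      define V1 where "V1 = {w \<in> words \<P> n. pt w x \<in> ball y r}"
      have "(mk.T ^^ n) u x = (\<Sum>w\<in>words \<P> n. coded.weight p w x * u (pt w x))" by (rule coded.transfer_pow)
      also have "\<dots> \<le> (\<Sum>w\<in>words \<P> n. if pt w x \<in> ball y r then B * mass w else 0)"
      proof (rule sum_mono)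
        fix w assume w: "w \<in> words \<P> n"
        have "coded.weight p w x * u (pt w x) \<le> coded.weight p w x * indicat_real (ball y r) (pt w x)"
          using uball[OF coded.branch_in[OF w x]] mk.weight_nonneg[OF w x] by (intro mult_left_mono)
        also have "\<dots> \<le> (if pt w x \<in> ball y r then B * mass w else 0)"
          using cod w x unfolding coding_def by simp
        finally show "coded.weight p w x * u (pt w x) \<le> (if pt w x \<in> ball y r then B * mass w else 0)" .
      qed
      also have "\<dots> = (\<Sum>w\<in>V1. B * mass w)"
        unfolding V1_def by (rule sum.mono_neutral_cong_right) (use fin_P in auto)
      also have "\<dots> = B * (\<Sum>w\<in>V1. mass w)" by (simp add: sum_distrib_left)
      also have "\<dots> \<le> B * (\<mu> + 2 * \<theta> ^ n)" unfolding \<mu>_def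
        by (intro mult_left_mono touch_mass_le[OF decay \<theta>0]) (use x mk.B1 in \<open>auto simp: V1_def\<close>)
      finally show ?thesis .
    qed
    define n0 where "n0 = m + k"
    have geo: "(\<Sum>n=1..n0. \<theta> ^ n) \<le> 1 / (1 - \<theta>)"
    proof -
      have "(\<Sum>n=1..n0. \<theta> ^ n) \<le> (\<Sum>n<Suc n0. \<theta> ^ n)" using mk.\<theta> by (intro sum_mono2) auto
      also have "\<dots> = (1 - \<theta> ^ Suc n0) / (1 - \<theta>)" using mk.\<theta> by (simp only: sum_gp_strict) simp
      also have "\<dots> \<le> 1 / (1 - \<theta>)" using mk.\<theta> by (intro divide_right_mono) auto
      finally show ?thesis .
    qed
    have W: "(\<Sum>n=1..n0. (mk.T ^^ n) u x) \<le> W0 * L\<^sup>2" if x: "x \<in> core" for x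
    proof -
      have "(\<Sum>n=1..n0. (mk.T ^^ n) u x) \<le> (\<Sum>n=1..n0. B * (\<mu> + 2 * \<theta> ^ n))" using Tn[OF x] by (intro sum_mono)
      also have "\<dots> = B * (real n0 * \<mu> + 2 * (\<Sum>n=1..n0. \<theta> ^ n))"
        by (simp add: sum.distrib flip: sum_distrib_left)
      also have "\<dots> \<le> B * ((3 * C1 + 16 * Cm) * L\<^sup>2 + 2 / (1 - \<theta>) * L\<^sup>2)"
      proof (intro mult_left_mono add_mono)
        show "real n0 * \<mu> \<le> (3 * C1 + 16 * Cm) * L\<^sup>2" using m\<mu> k\<mu> by (simp add: n0_def distrib_right)
        have "2 * (\<Sum>n=1..n0. \<theta> ^ n) \<le> 2 / (1 - \<theta>) * 1" using geo by simp
        also have "\<dots> \<le> 2 / (1 - \<theta>) * L\<^sup>2" using L LL mk.\<theta> by (intro mult_left_mono) auto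
        finally show "2 * (\<Sum>n=1..n0. \<theta> ^ n) \<le> 2 / (1 - \<theta>) * L\<^sup>2" .
      qed (use mk.B1 in auto)
      also have "\<dots> = W0 * L\<^sup>2" by (simp add: W0_def algebra_simps)
      finally show ?thesis .
    qed
    define Z where "Z = {x \<in> I. (\<Sum>i<N. u ((f ^^ i) x)) \<le> (1 - \<epsilon> / 2) * a * real N}"
    have Zs: "Z \<in> sets M" unfolding Z_def u_def by (rule visits_sets[OF cyl_union_sets[OF V]])
    define G where "G = {x \<in> I. (\<Sum>i<N. indicat_real (ball y r) ((f ^^ i) x)) \<le> (1 - \<epsilon>) * \<mu> * real N}"
    have Gs: "G \<in> sets M" unfolding G_def by (rule ball_visits_sets)
    have "G \<inter> core \<subseteq> Z"
    proof
      fix x assume x: "x \<in> G \<inter> core"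
      have "(\<Sum>i<N. u ((f ^^ i) x)) \<le> (\<Sum>i<N. indicat_real (ball y r) ((f ^^ i) x))"
        using x by (intro sum_mono uball f_pow_core) auto
      also have "\<dots> \<le> (1 - \<epsilon>) * \<mu> * real N" using x by (simp add: G_def)
      also have "\<dots> \<le> (1 - \<epsilon> / 2) * a * real N"
      proof (rule mult_right_mono)
        have "(1 - \<epsilon>) * \<mu> \<le> (1 - \<epsilon> / 2) * ((1 - \<epsilon> / 2) * \<mu>)"
        proof -
          have "(1 - \<epsilon> / 2) * ((1 - \<epsilon> / 2) * \<mu>) - (1 - \<epsilon>) * \<mu> = (\<epsilon> / 2)\<^sup>2 * \<mu>"
            by (simp add: power2_eq_square field_simps)
          moreover have "0 \<le> (\<epsilon> / 2)\<^sup>2 * \<mu>" using \<mu> by simp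
          ultimately show ?thesis by linarith
        qed
        also have "\<dots> \<le> (1 - \<epsilon> / 2) * a" using a \<epsilon> by (intro mult_left_mono) auto
        finally show "(1 - \<epsilon>) * \<mu> \<le> (1 - \<epsilon> / 2) * a" .
      qed simp
      finally show "x \<in> Z" using x by (simp add: G_def Z_def)
    qed
    hence "measure M G \<le> measure M Z" using measure_core[OF Gs] finite_measure_mono[OF _ Zs] by metis
    also have "\<dots> \<le> 2 * B * exp (- (real N * a * (\<epsilon> / 2)\<^sup>2 / (16 * (1 + W0 * L\<^sup>2))))"
      unfolding Z_def u_def a_def equilibrium_eq_measure[OF cod V, symmetric]
      by (rule lower_deviation_union[OF cod V _ n0_def[unfolded k_def]])
         (use \<epsilon> W W0 in \<open>auto simp: u_def\<close>)
    also have "\<dots> \<le> 2 * B * exp (- (c * \<epsilon>\<^sup>2 / L\<^sup>2 * \<mu> * real N))"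
    proof -
      have "c * \<epsilon>\<^sup>2 / L\<^sup>2 * \<mu> * real N = real N * (1 / 2 * \<mu>) * (\<epsilon> / 2)\<^sup>2 / (16 * ((1 + W0) * L\<^sup>2))"
        using W0 by (simp add: c_def power2_eq_square divide_simps)
      also have "\<dots> \<le> real N * a * (\<epsilon> / 2)\<^sup>2 / (16 * (1 + W0 * L\<^sup>2))"
      proof (intro frac_le mult_right_mono mult_left_mono)
        have "1 / 2 * \<mu> \<le> (1 - \<epsilon> / 2) * \<mu>" using \<epsilon> \<mu> by (intro mult_right_mono) auto
        thus "1 / 2 * \<mu> \<le> a" using a by simp
        show "1 + W0 * L\<^sup>2 \<le> (1 + W0) * L\<^sup>2" using L LL by (simp add: algebra_simps)
        show "0 < 16 * (1 + W0 * L\<^sup>2)" using W0 by (simp add: add_pos_nonneg)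
      qed (auto simp: a_def)
      finally show ?thesis using mk.B1 by (intro mult_left_mono) auto
    qed
    finally show ?thesis by (simp add: G_def \<mu>_def L_def)
  qed
  moreover have "1 \<le> 2 * B" using mk.B1 by simp
  ultimately show ?thesis using c by blast
qed

end

section \<open>Distortion and stopping words\<close>

text \<open>
  Fekete's lemma for \<open>b t = - ln (g (exp (- t)))\<close>. The limit is positive as soon as \<open>g\<close> tends
  to zero, since otherwise the upper bound for \<open>b\<close> would be a constant.
\<close>

lemma power_law_of_submultiplicative:
  fixes g :: "real \<Rightarrow> real"
  assumes \<delta>1: "0 < \<delta>1" "\<delta>1 < 1" and c: "0 < c" "c \<le> 1" and C: "0 < C"
    and pos: "\<And>\<delta>. 0 < \<delta> \<Longrightarrow> 0 < g \<delta>" and le1: "\<And>\<delta>. g \<delta> \<le> 1"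
    and mono: "\<And>\<delta> \<eta>. 0 < \<delta> \<Longrightarrow> \<delta> \<le> \<eta> \<Longrightarrow> g \<delta> \<le> g \<eta>"
    and sub: "\<And>\<delta> \<eta>. 0 < \<delta> \<Longrightarrow> \<delta> \<le> \<delta>1 \<Longrightarrow> 0 < \<eta> \<Longrightarrow> \<eta> \<le> \<delta>1 \<Longrightarrow> g (c * \<delta> * \<eta>) \<le> C * g \<delta> * g \<eta>"
    and poly: "\<And>\<delta>. 0 < \<delta> \<Longrightarrow> \<delta> \<le> \<delta>1 \<Longrightarrow> - ln (g \<delta>) \<le> A * - ln \<delta> + A'"
  shows "\<exists>L\<ge>0. ((\<lambda>\<delta>. ln (g \<delta>) / ln \<delta>) \<longlongrightarrow> L) (at_right 0) \<and>
     (\<exists>k>0. \<forall>\<delta>. 0 < \<delta> \<longrightarrow> \<delta> \<le> \<delta>1 \<longrightarrow> k * \<delta> powr L \<le> g \<delta>) \<and>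
     ((\<forall>e>0. \<exists>\<delta>>0. \<delta> \<le> \<delta>1 \<and> g \<delta> < e) \<longrightarrow> 0 < L)"
proof -
  define b where "b t = - ln (g (exp (- t)))" for t
  define t0 where "t0 = - ln \<delta>1"
  have t0: "0 < t0" using \<delta>1 by (simp add: t0_def)
  have small: "exp (- t) \<le> \<delta>1" if "t0 \<le> t" for t
  proof -
    have "exp (- t) \<le> exp (ln \<delta>1)" using that by (simp add: t0_def)
    thus ?thesis using \<delta>1 by simp
  qed
  have "\<exists>L. ((\<lambda>t. b t / t) \<longlongrightarrow> L) at_top \<and> (\<forall>t\<ge>t0. b t \<le> L * (t + (- ln c)) + ln C)"
  proof (rule superadditive_limit[where A = A and A' = A'])
    show "b s \<le> b t" if "t0 \<le> s" "s \<le> t" for s t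
      using mono[of "exp (- t)" "exp (- s)"] pos[of "exp (- t)"] pos[of "exp (- s)"] that by (simp add: b_def)
    show "b s + b t - ln C \<le> b (s + t + - ln c)" if "t0 \<le> s" "t0 \<le> t" for s t
    proof -
      have e: "exp (- (s + t + - ln c)) = c * exp (- s) * exp (- t)"
        using c by (simp add: exp_diff exp_minus field_simps exp_add)
      have "g (c * exp (- s) * exp (- t)) \<le> C * g (exp (- s)) * g (exp (- t))"
        using small that by (intro sub) auto
      hence "ln (g (c * exp (- s) * exp (- t))) \<le> ln (C * g (exp (- s)) * g (exp (- t)))"
        using pos c C by (intro ln_mono) auto
      also have "\<dots> = ln C + ln (g (exp (- s))) + ln (g (exp (- t)))" 
        using pos[of "exp (- t)"] pos[of "exp (- s)"] C by (simp add: ln_mult)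
      finally show ?thesis unfolding b_def e by simp
    qed
    show "b t \<le> A * t + A'" if "t0 \<le> t" for t using poly[of "exp (- t)"] small[OF that] by (simp add: b_def)
    show "0 \<le> - ln c" using c by simp
  qed (rule t0)
  then obtain L where L: "((\<lambda>t. b t / t) \<longlongrightarrow> L) at_top" "\<And>t. t0 \<le> t \<Longrightarrow> b t \<le> L * (t + (- ln c)) + ln C" by blast
  have b0: "0 \<le> b t" for t using le1[of "exp (- t)"] pos[of "exp (- t)"] by (simp add: b_def)
  have L0: "0 \<le> L"
  proof (rule tendsto_lowerbound[OF L(1)])
    show "\<forall>\<^sub>F t in at_top. 0 \<le> b t / t" 
      by (rule eventually_mono[OF eventually_gt_at_top[of 0]]) (simp add: b0)
  qed simp
  have "filterlim (\<lambda>\<delta>. - ln \<delta>) at_top (at_right (0::real))"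
    using ln_at_0 by (simp add: filterlim_uminus_at_bot)
  from filterlim_compose[OF L(1) this]
  have "((\<lambda>\<delta>. b (- ln \<delta>) / - ln \<delta>) \<longlongrightarrow> L) (at_right 0)" .
  moreover have "\<forall>\<^sub>F \<delta> in at_right 0. b (- ln \<delta>) / - ln \<delta> = ln (g \<delta>) / ln \<delta>"
    using eventually_at_right_less[of "0::real"] by eventually_elim (simp add: b_def)
  ultimately have lim: "((\<lambda>\<delta>. ln (g \<delta>) / ln \<delta>) \<longlongrightarrow> L) (at_right 0)" by (subst (asm) tendsto_cong) auto
  have lower: "exp (L * ln c - ln C) * \<delta> powr L \<le> g \<delta>" if "0 < \<delta>" "\<delta> \<le> \<delta>1" for \<delta>
  proof -
    have "t0 \<le> - ln \<delta>" using that by (simp add: t0_def)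
    from L(2)[OF this] have "- ln (g \<delta>) \<le> L * (- ln \<delta> - ln c) + ln C" using that by (simp add: b_def)
    hence "(L * ln c - ln C) + L * ln \<delta> \<le> ln (g \<delta>)" by (simp add: algebra_simps)
    hence "exp ((L * ln c - ln C) + L * ln \<delta>) \<le> g \<delta>" using pos[OF that(1)] by (simp add: ln_ge_iff)
    thus ?thesis using that by (simp add: powr_def exp_add)
  qed
  have "0 < L" if small: "\<forall>e>0. \<exists>\<delta>>0. \<delta> \<le> \<delta>1 \<and> g \<delta> < e"
  proof (rule ccontr)
    assume "\<not> 0 < L"
    hence [simp]: "L = 0" using L0 by simp
    obtain \<delta> where d: "0 < \<delta>" "\<delta> \<le> \<delta>1" "g \<delta> < exp (- ln C)" using small by (metis exp_gt_zero)
    thus False using lower[OF d(1,2)] by simp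
  qed
  thus ?thesis using L0 lim lower exp_gt_zero by blast
qed

context gibbs_interval
begin

lemma cyl_derivative:
  "w \<in> words \<P> n \<Longrightarrow> \<exists>D. \<forall>x\<in>cyl w. ((f ^^ n) has_real_derivative D x) (at x within cyl w)"
proof (induction w arbitrary: n)
  case Nil
  have "((\<lambda>x. x) has_real_derivative 1) (at x within cyl [])" for x :: real by (rule DERIV_ident)
  thus ?case using Nil by (intro exI[of _ "\<lambda>_. 1"]) (simp add: words_def id_def)
next
  case (Cons P w)
  obtain m where m: "n = Suc m" "P \<in> \<P>" "w \<in> words \<P> m" using words_Cons[OF Cons.prems] by blast
  obtain D where D: "\<And>x. x \<in> cyl w \<Longrightarrow> ((f ^^ m) has_real_derivative D x) (at x within cyl w)"
    using Cons.IH[OF m(3)] by blast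
  obtain f' where f': "\<And>x. x \<in> P \<Longrightarrow> (f has_real_derivative f' x) (at x within P)" using f_deriv[OF m(2)] by blast
  have "((f ^^ n) has_real_derivative D (f x) * f' x) (at x within cyl (P # w))" if x: "x \<in> cyl (P # w)" for x
  proof -
    have 1: "(f has_real_derivative f' x) (at x within cyl (P # w))"
      by (rule has_field_derivative_subset[OF f']) (use x in auto)
    have 2: "((f ^^ m) has_real_derivative D (f x)) (at (f x) within f ` cyl (P # w))"
      by (rule has_field_derivative_subset[OF D]) (use x in auto)
    have "((f ^^ m) \<circ> f has_real_derivative D (f x) * f' x) (at x within cyl (P # w))"
      by (rule DERIV_image_chain[OF 2 1])
    thus ?thesis by (simp only: m(1) funpow_Suc_right)
  qed
  thus ?case by (intro exI[of _ "\<lambda>x. D (f x) * f' x"] ballI)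
qed

lemma core_two_points: "\<exists>x\<in>core. \<exists>y\<in>core. x < y"
proof -
  obtain a b where ab: "a \<in> I" "b \<in> I" "a < b" using I_two_points by blast
  obtain x where x: "x \<in> core" "a < x" "x < b" using core_dense[OF ab(3,1,2)] by blast
  obtain y where "y \<in> core" "x < y" using core_dense[OF x(3) core_I[OF x(1)] ab(2)] by blast
  thus ?thesis using x(1) by (intro bexI)
qed

lemma pt_inj: "w \<in> words \<P> n \<Longrightarrow> x \<in> core \<Longrightarrow> y \<in> core \<Longrightarrow> pt w x = pt w y \<Longrightarrow> x = y"
  by (metis pt(2))

lemma cyl_nontrivial:
  assumes w: "w \<in> words \<P> n" and x: "x \<in> cyl w"
  shows "at x within cyl w \<noteq> bot"
proof -
  obtain u v where uv: "u \<in> core" "v \<in> core" "u < v" using core_two_points by blast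
  have "pt w u \<noteq> pt w v" using pt_inj[OF w uv(1,2)] uv(3) by auto
  then obtain y where "y \<in> cyl w" "y \<noteq> x" using pt(1)[OF w uv(1)] pt(1)[OF w uv(2)] by metis
  thus ?thesis by (rule at_within_interval_nontrivial[OF cyl_interval[OF w] x])
qed

text \<open>
  Two applications of the mean value theorem: on the pair \<open>u\<close>, \<open>v\<close> the derivative of \<open>f ^^ n\<close>
  is at most \<open>I_len / \<bar>u - v\<bar>\<close> at some point, and by bounded distortion at most \<open>L\<close> times as
  large everywhere in the cylinder.
\<close>

lemma distortion_exists:
  "\<exists>L\<ge>1. \<forall>n. \<forall>w\<in>words \<P> n. \<forall>x\<in>cyl w. \<forall>y\<in>cyl w. \<forall>u\<in>cyl w. \<forall>v\<in>cyl w.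
     \<bar>(f ^^ n) x - (f ^^ n) y\<bar> * \<bar>u - v\<bar> \<le> L * I_len * \<bar>x - y\<bar>"
proof -
  obtain L0 where L0: "\<And>n Q x y. 1 \<le> n \<Longrightarrow> Q \<in> cylinders I \<P> f n \<Longrightarrow> x \<in> Q \<Longrightarrow> y \<in> Q \<Longrightarrow>
     \<bar>vector_derivative (f ^^ n) (at x within Q)\<bar> / \<bar>vector_derivative (f ^^ n) (at y within Q)\<bar> \<le> L0"
    using bd unfolding bounded_distortion_def by blast
  define L where "L = max 1 L0"
  have main: "\<bar>(f ^^ n) x - (f ^^ n) y\<bar> * \<bar>u - v\<bar> \<le> L * I_len * \<bar>x - y\<bar>"
    if w: "w \<in> words \<P> n" and x: "x \<in> cyl w" and y: "y \<in> cyl w" and u: "u \<in> cyl w" and v: "v \<in> cyl w" for n w x y u v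
  proof -
    have uI: "\<bar>(f ^^ n) u - (f ^^ n) v\<bar> \<le> I_len"
      using I_len(2) f_pow_in_I cyl_sub[OF w] u v by blast
    obtain D where D: "\<And>x. x \<in> cyl w \<Longrightarrow> ((f ^^ n) has_real_derivative D x) (at x within cyl w)"
      using cyl_derivative[OF w] by blast
    have Dratio: "\<bar>D s\<bar> \<le> L * \<bar>D t\<bar>" if st: "s \<in> cyl w" "t \<in> cyl w" "D t \<noteq> 0" for s t
    proof (cases "n = 0")
      case True
      have "D s = 1" if s: "s \<in> cyl w" for s
      proof -
        have "((\<lambda>x. x) has_vector_derivative D s) (at s within cyl w)"
          using D[OF s] True by (simp add: id_def has_real_derivative_iff_has_vector_derivative)
        moreover have "((\<lambda>x. x) has_vector_derivative 1) (at s within cyl w)"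
          using DERIV_ident[of "at s within cyl w"] by (simp add: has_real_derivative_iff_has_vector_derivative)
        ultimately show ?thesis by (rule vector_derivative_unique_within[OF cyl_nontrivial[OF w s]])
      qed
      thus ?thesis using st by (simp add: L_def)
    next
      case False
      have cw: "cyl w \<in> cylinders I \<P> f n" using cyl_in_cylinders[OF w] x by blast
      have vd: "vector_derivative (f ^^ n) (at s within cyl w) = D s" if "s \<in> cyl w" for s
        using vector_derivative_within[OF cyl_nontrivial[OF w that]] D[OF that]
        by (simp add: has_real_derivative_iff_has_vector_derivative)
      have "\<bar>D s\<bar> / \<bar>D t\<bar> \<le> L0" using L0[OF _ cw st(1,2)] False vd st by simp
      also have "\<dots> \<le> L" by (simp add: L_def)
      finally show ?thesis using st(3) by (simp add: field_simps)
    qed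
    show ?thesis
    proof (cases "x = y \<or> u = v")
      case True thus ?thesis using I_len(1) by (auto simp: L_def)
    next
      case False
      obtain s where s: "s \<in> cyl w" "(f ^^ n) x - (f ^^ n) y = D s * (x - y)"
        using interval_mean_value[OF cyl_interval[OF w] D x y] False by blast
      obtain t where t: "t \<in> cyl w" "(f ^^ n) u - (f ^^ n) v = D t * (u - v)"
        using interval_mean_value[OF cyl_interval[OF w] D u v] False by blast
      have "D t \<noteq> 0" using t(2) inj_onD[OF cyl_inj[OF w] _ u v] False by auto
      hence "\<bar>D s\<bar> * \<bar>x - y\<bar> * \<bar>u - v\<bar> \<le> L * \<bar>D t\<bar> * \<bar>x - y\<bar> * \<bar>u - v\<bar>"
        using Dratio[OF s(1) t(1)] by (intro mult_right_mono) auto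
      also have "\<dots> = L * \<bar>x - y\<bar> * \<bar>(f ^^ n) u - (f ^^ n) v\<bar>" by (simp add: t(2) abs_mult)
      also have "\<dots> \<le> L * \<bar>x - y\<bar> * I_len" using uI by (intro mult_left_mono) (auto simp: L_def)
      finally show ?thesis by (simp add: s(2) abs_mult mult_ac)
    qed
  qed
  show ?thesis by (intro exI[of _ L] conjI allI ballI main) (simp_all add: L_def)
qed

definition len :: "real set list \<Rightarrow> real" where "len w = diameter (cyl w)"

lemma cyl_bounded: "w \<in> words \<P> n \<Longrightarrow> bounded (cyl w)"
  by (rule bounded_subset[OF compact_imp_bounded[OF I_compact] cyl_sub])

lemma len_upper: "w \<in> words \<P> n \<Longrightarrow> x \<in> cyl w \<Longrightarrow> y \<in> cyl w \<Longrightarrow> \<bar>x - y\<bar> \<le> len w"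
  using diameter_bounded_bound[OF cyl_bounded, of w n x y] by (simp add: len_def dist_real_def)

lemma len_least:
  "w \<in> words \<P> n \<Longrightarrow> (\<And>x y. x \<in> cyl w \<Longrightarrow> y \<in> cyl w \<Longrightarrow> \<bar>x - y\<bar> \<le> c) \<Longrightarrow> len w \<le> c"
  unfolding len_def using cyl_nonempty by (intro diameter_le) auto

lemma len_small: "w \<in> words \<P> n \<Longrightarrow> len w \<le> I_len * (1 / expansion) ^ n"
  by (rule len_least) (auto intro: cyl_small)

lemma len_pos: "w \<in> words \<P> n \<Longrightarrow> 0 < len w"
proof -
  assume w: "w \<in> words \<P> n"
  obtain u v where uv: "u \<in> core" "v \<in> core" "u < v" using core_two_points by blast
  have "pt w u \<noteq> pt w v" using pt_inj[OF w uv(1,2)] uv(3) by auto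
  thus ?thesis using len_upper[OF w pt(1)[OF w uv(1)] pt(1)[OF w uv(2)]] by auto
qed

lemma len_take: "w \<in> words \<P> n \<Longrightarrow> k \<le> n \<Longrightarrow> len w \<le> len (take k w)"
  unfolding len_def using cyl_take[of w n k] cyl_bounded by (intro diameter_subset) auto

lemma len_distortion:
  "\<exists>L\<ge>1. \<forall>n. \<forall>w\<in>words \<P> n. \<forall>x\<in>cyl w. \<forall>y\<in>cyl w. \<bar>(f ^^ n) x - (f ^^ n) y\<bar> * len w \<le> L * \<bar>x - y\<bar>"
proof -
  obtain L where L: "1 \<le> L" "\<And>n w x y u v. w \<in> words \<P> n \<Longrightarrow> x \<in> cyl w \<Longrightarrow> y \<in> cyl w \<Longrightarrow> u \<in> cyl w \<Longrightarrow> v \<in> cyl w \<Longrightarrow>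
     \<bar>(f ^^ n) x - (f ^^ n) y\<bar> * \<bar>u - v\<bar> \<le> L * I_len * \<bar>x - y\<bar>" using distortion_exists by blast
  define L' where "L' = max 1 (L * I_len)"
  have main: "\<bar>(f ^^ n) x - (f ^^ n) y\<bar> * len w \<le> L' * \<bar>x - y\<bar>"
    if w: "w \<in> words \<P> n" and x: "x \<in> cyl w" and y: "y \<in> cyl w" for n w x y
  proof (cases "(f ^^ n) x = (f ^^ n) y")
    case True thus ?thesis by (simp add: L'_def)
  next
    case False
    hence p: "0 < \<bar>(f ^^ n) x - (f ^^ n) y\<bar>" by simp
    have "len w \<le> L * I_len * \<bar>x - y\<bar> / \<bar>(f ^^ n) x - (f ^^ n) y\<bar>"
    proof (rule len_least[OF w])
      fix u v assume "u \<in> cyl w" "v \<in> cyl w"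
      from L(2)[OF w x y this] p
      show "\<bar>u - v\<bar> \<le> L * I_len * \<bar>x - y\<bar> / \<bar>(f ^^ n) x - (f ^^ n) y\<bar>"
        by (simp add: pos_le_divide_eq mult.commute)
    qed
    hence "\<bar>(f ^^ n) x - (f ^^ n) y\<bar> * len w \<le> L * I_len * \<bar>x - y\<bar>" using p by (simp add: pos_le_divide_eq mult.commute)
    also have "\<dots> \<le> L' * \<bar>x - y\<bar>" by (intro mult_right_mono) (auto simp: L'_def)
    finally show ?thesis .
  qed
  show ?thesis by (intro exI[of _ L'] conjI allI ballI main) (simp_all add: L'_def)
qed

definition dist_const :: real where
  "dist_const = (SOME L. L \<ge> 1 \<and> (\<forall>n. \<forall>w\<in>words \<P> n. \<forall>x\<in>cyl w. \<forall>y\<in>cyl w. \<bar>(f ^^ n) x - (f ^^ n) y\<bar> * len w \<le> L * \<bar>x - y\<bar>))"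

lemma dist_const: "1 \<le> dist_const"
  "w \<in> words \<P> n \<Longrightarrow> x \<in> cyl w \<Longrightarrow> y \<in> cyl w \<Longrightarrow> \<bar>(f ^^ n) x - (f ^^ n) y\<bar> * len w \<le> dist_const * \<bar>x - y\<bar>"
proof -
  have *: "dist_const \<ge> 1 \<and> (\<forall>n. \<forall>w\<in>words \<P> n. \<forall>x\<in>cyl w. \<forall>y\<in>cyl w. \<bar>(f ^^ n) x - (f ^^ n) y\<bar> * len w \<le> dist_const * \<bar>x - y\<bar>)"
    unfolding dist_const_def by (rule someI_ex[OF len_distortion])
  show "1 \<le> dist_const" by (rule conjunct1[OF *])
  show "w \<in> words \<P> n \<Longrightarrow> x \<in> cyl w \<Longrightarrow> y \<in> cyl w \<Longrightarrow> \<bar>(f ^^ n) x - (f ^^ n) y\<bar> * len w \<le> dist_const * \<bar>x - y\<bar>"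
    by (rule conjunct2[OF *, rule_format])
qed

text \<open>
  Lengths of cylinders do not collapse from one level to the next: the image of the
  subcylinder under \<open>f ^^ n\<close> contains two points of \<open>P\<close> chosen once and for all, and \<open>f ^^ n\<close>
  stretches by at most \<open>dist_const / len w\<close>.
\<close>

lemma len_child: "\<exists>c>0. c \<le> 1 \<and> (\<forall>n. \<forall>w\<in>words \<P> n. \<forall>P\<in>\<P>. c * len w \<le> len (w @ [P]))"
proof -
  obtain u v where uv: "u \<in> core" "v \<in> core" "u < v" using core_two_points by blast
  have ne: "\<P> \<noteq> {}" using P_cover I_two_points by blast
  define gap where "gap P = \<bar>inv_branch P u - inv_branch P v\<bar>" for P
  have gap: "0 < gap P" if "P \<in> \<P>" for P
  proof -
    have "pt [P] u \<noteq> pt [P] v" using pt_inj[of "[P]" 1 u v] uv that by (auto simp: words_def)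
    thus ?thesis by (simp add: gap_def)
  qed
  define c where "c = min 1 (Min (gap ` \<P>) / dist_const)"
  have c: "0 < c" "c \<le> 1" using gap ne fin_P dist_const(1) by (auto simp: c_def)
  have "c * len w \<le> len (w @ [P])" if w: "w \<in> words \<P> n" and P: "P \<in> \<P>" for n w P
  proof -
    have p1: "[P] \<in> words \<P> 1" using P by (simp add: words_def)
    note wP = words_append[OF w p1]
    define x where "x = pt w (inv_branch P u)"
    define y where "y = pt w (inv_branch P v)"
    have xy: "x \<in> cyl (w @ [P])" "y \<in> cyl (w @ [P])"
      using pt(1)[OF wP uv(1)] pt(1)[OF wP uv(2)] by (simp_all add: x_def y_def branch_append)
    hence xyw: "x \<in> cyl w" "y \<in> cyl w" using cyl_append[OF w p1] by auto
    have fx: "(f ^^ n) x = inv_branch P u" "(f ^^ n) y = inv_branch P v"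
      unfolding x_def y_def using pt(2)[OF w] inv_branch_core(3)[OF P] uv by auto
    have "c \<le> gap P / dist_const"
    proof -
      have "c \<le> Min (gap ` \<P>) / dist_const" by (simp add: c_def)
      also have "\<dots> \<le> gap P / dist_const" using P fin_P dist_const(1) by (intro divide_right_mono) auto
      finally show ?thesis .
    qed
    hence "c * len w \<le> gap P / dist_const * len w" using len_pos[OF w] by (intro mult_right_mono) auto
    also have "\<dots> \<le> \<bar>x - y\<bar>"
      using dist_const(2)[OF w xyw] dist_const(1) by (simp add: fx gap_def field_simps)
    also have "\<dots> \<le> len (w @ [P])" by (rule len_upper[OF wP xy])
    finally show ?thesis .
  qed
  thus ?thesis using c by blast
qed

text \<open>
  The first cylinder along an itinerary that is shorter than \<open>\<delta>\<close>. Its length is comparable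
  with \<open>\<delta>\<close> (\<open>stopping_len\<close>), and the stopping cylinders at a given scale are disjoint
  (\<open>stopping_unique\<close>).
\<close>

definition stopping :: "real \<Rightarrow> nat \<Rightarrow> real set list \<Rightarrow> bool" where
  "stopping \<delta> n w \<longleftrightarrow> w \<in> words \<P> (Suc n) \<and> len w < \<delta> \<and> \<delta> \<le> len (take n w)"

lemma stopping_exists:
  assumes x: "x \<in> I" and \<delta>: "0 < \<delta>" "\<delta> \<le> len []"
  shows "\<exists>n w. stopping \<delta> n w \<and> x \<in> cyl w"
proof -
  define Q where "Q n \<longleftrightarrow> (\<exists>w\<in>words \<P> n. x \<in> cyl w \<and> len w < \<delta>)" for n
  have "\<exists>n. Q n"
  proof -
    obtain n where n: "(1 / expansion) ^ n < \<delta> / I_len"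
      using real_arch_pow_inv[of "\<delta> / I_len" "1 / expansion"] \<delta> I_len(1) expansion(1) by auto
    obtain w where w: "w \<in> words \<P> n" "x \<in> cyl w" using cyl_cover[OF x] by blast
    have "len w \<le> I_len * (1 / expansion) ^ n" by (rule len_small[OF w(1)])
    also have "\<dots> < \<delta>" using n I_len(1) by (simp add: field_simps)
    finally show ?thesis using w unfolding Q_def by blast
  qed
  then obtain N where N: "Q N" "\<And>m. m < N \<Longrightarrow> \<not> Q m" using exists_least_iff[of Q] by blast
  then obtain w where w: "w \<in> words \<P> N" "x \<in> cyl w" "len w < \<delta>" unfolding Q_def by blast
  have "N \<noteq> 0" using w \<delta> by (auto simp: words_def)
  then obtain n where n: "N = Suc n" by (cases N) auto
  have t: "take n w \<in> words \<P> n" "x \<in> cyl (take n w)" using cyl_take[OF w(1), of n] w n by auto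
  have "\<not> Q n" using N(2) n by simp
  hence "\<delta> \<le> len (take n w)" using t unfolding Q_def by force
  thus ?thesis using w n unfolding stopping_def by blast
qed

lemma stopping_unique:
  assumes "stopping \<delta> n w" "stopping \<delta> m v" "x \<in> cyl w" "x \<in> cyl v"
  shows "w = v"
proof -
  have less: False if s: "stopping \<delta> n w" "stopping \<delta> m v" "x \<in> cyl w" "x \<in> cyl v" "n < m" for n m w v
  proof -
    have wv: "w \<in> words \<P> (Suc n)" "v \<in> words \<P> (Suc m)" using s by (auto simp: stopping_def)
    have t: "take (Suc n) v \<in> words \<P> (Suc n)" "x \<in> cyl (take (Suc n) v)"
      using cyl_take[OF wv(2), of "Suc n"] s by auto
    have e: "take (Suc n) v = w" by (rule cyl_unique[OF t(1) wv(1) t(2) s(3)])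
    have tm: "take m v \<in> words \<P> m" using cyl_take[OF wv(2), of m] by simp
    have "len (take m v) \<le> len (take (Suc n) (take m v))" using len_take[OF tm, of "Suc n"] s by simp
    also have "take (Suc n) (take m v) = w" using e s(5) by (simp add: min_def)
    finally show False using s by (simp add: stopping_def)
  qed
  have "n = m" using less[OF assms] less[OF assms(2,1,4,3)] by force
  thus ?thesis using assms cyl_unique[of w "Suc n" v x] by (simp add: stopping_def)
qed

lemma pullback_sets:
  assumes w: "w \<in> words \<P> n"
  shows "{x \<in> cyl w. (f ^^ n) x \<in> ball z \<eta>} \<in> sets M"
proof -
  have "{x \<in> cyl w. (f ^^ n) x \<in> ball z \<eta>} = cyl w \<inter> ((f ^^ n) -` (ball z \<eta> \<inter> I) \<inter> I)"
    using cyl_sub[OF w] f_pow_in_I by blast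
  thus ?thesis
    using cyl_sets[OF w] measurable_sets[OF f_pow_measurable I_borel_in_sets[of "ball z \<eta>"], of n] by simp
qed

text \<open>
  The estimate \<open>mass_append_le\<close> extends from cylinders to balls by covering the ball with
  cylinders of level \<open>k\<close>. The excess over the measure of the ball comes from two cut cylinders
  and vanishes as \<open>k\<close> grows.
\<close>

lemma pullback_ball:
  assumes w: "w \<in> words \<P> n"
  shows "measure M {x \<in> cyl w. (f ^^ n) x \<in> ball z \<eta>} \<le> gibbs_const ^ 3 * mass w * ball_measure M z \<eta>"
proof -
  obtain \<theta> where \<theta>: "0 < \<theta>" "\<theta> < 1" "\<And>n w. w \<in> words \<P> n \<Longrightarrow> mass w \<le> \<theta> ^ n" using mass_decay by blast
  define E where "E = {x \<in> cyl w. (f ^^ n) x \<in> ball z \<eta>}"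
  have Es: "E \<in> sets M" unfolding E_def by (rule pullback_sets[OF w])
  have "measure M E \<le> gibbs_const ^ 3 * mass w * (ball_measure M z \<eta> + 2 * \<theta> ^ k)" for k
  proof -
    define V where "V = {v \<in> words \<P> k. \<exists>x\<in>core. pt v x \<in> ball z \<eta>}"
    have V: "V \<subseteq> words \<P> k" by (auto simp: V_def)
    define V' where "V' = (\<lambda>v. w @ v) ` V"
    have V': "V' \<subseteq> words \<P> (n + k)" unfolding V'_def using V words_append[OF w] by blast
    have "E \<inter> core \<subseteq> cyl_union V'"
    proof
      fix x assume x: "x \<in> E \<inter> core"
      define y where "y = (f ^^ n) x"
      have y: "y \<in> core" "y \<in> ball z \<eta>" using x f_pow_core by (auto simp: y_def E_def)
      obtain v where v: "v \<in> words \<P> k" "y \<in> cyl v" using cyl_cover core_I y by blast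
      have "pt v ((f ^^ k) y) = y" by (rule pt_f_pow[OF v y(1)])
      hence "v \<in> V" unfolding V_def using v(1) f_pow_core[OF y(1), of k] y(2)
        by (intro CollectI conjI bexI[of _ "(f ^^ k) y"]) simp_all
      moreover have "x \<in> cyl (w @ v)" using cyl_append[OF w v(1)] v(2) x by (auto simp: E_def y_def)
      ultimately show "x \<in> cyl_union V'" unfolding cyl_union_def V'_def by blast
    qed
    hence "measure M (E \<inter> core) \<le> measure M (cyl_union V')"
      by (rule finite_measure_mono) (rule cyl_union_sets[OF V'])
    also have "\<dots> = (\<Sum>v\<in>V. mass (w @ v))"
      unfolding measure_cyl_union[OF V'] unfolding V'_def by (subst sum.reindex) (auto simp: inj_on_def)
    also have "\<dots> \<le> (\<Sum>v\<in>V. gibbs_const ^ 3 * mass w * mass v)"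
      using V mass_append_le[OF w] by (intro sum_mono) blast
    also have "\<dots> = gibbs_const ^ 3 * mass w * (\<Sum>v\<in>V. mass v)" by (simp add: sum_distrib_left)
    also have "\<dots> \<le> gibbs_const ^ 3 * mass w * (ball_measure M z \<eta> + 2 * \<theta> ^ k)"
      using gibbs_const(1) \<theta> by (intro mult_left_mono touch_mass_le[OF \<theta>(3) _ V]) (auto simp: V_def)
    finally show ?thesis using measure_core[OF Es] by simp
  qed
  moreover have "(\<lambda>k. gibbs_const ^ 3 * mass w * (ball_measure M z \<eta> + 2 * \<theta> ^ k)) \<longlonglongrightarrow> gibbs_const ^ 3 * mass w * (ball_measure M z \<eta> + 2 * 0)"
    using \<theta> by (intro tendsto_mult tendsto_add tendsto_const LIMSEQ_realpow_zero) auto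
  ultimately have "measure M E \<le> gibbs_const ^ 3 * mass w * (ball_measure M z \<eta> + 2 * 0)"
    by (intro LIMSEQ_le_const) auto
  thus ?thesis by (simp add: E_def)
qed

lemma stopping_in_ball:
  assumes "stopping \<delta> n w" "x \<in> cyl w"
  shows "cyl w \<subseteq> ball x \<delta> \<inter> I" "mass w \<le> ball_measure M x \<delta>"
proof -
  have w: "w \<in> words \<P> (Suc n)" "len w < \<delta>" using assms by (auto simp: stopping_def)
  show 1: "cyl w \<subseteq> ball x \<delta> \<inter> I"
  proof
    fix y assume "y \<in> cyl w"
    thus "y \<in> ball x \<delta> \<inter> I" using len_upper[OF w(1) assms(2)] w(2) cyl_sub[OF w(1)] by (force simp: dist_real_def)
  qed
  show "mass w \<le> ball_measure M x \<delta>"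
    unfolding ball_measure_def space_M by (rule finite_measure_mono[OF 1]) (rule I_borel_in_sets, simp)
qed

lemma ball_lower_bound:
  "\<exists>A A'. \<forall>x\<in>I. \<forall>\<delta>. 0 < \<delta> \<longrightarrow> \<delta> \<le> len [] \<longrightarrow> - ln (ball_measure M x \<delta>) \<le> A * - ln \<delta> + A'"
proof -
  obtain F where F: "\<And>x. x \<in> I \<Longrightarrow> \<bar>\<phi> x\<bar> \<le> F" using potential_bounded by blast
  obtain x0 where "x0 \<in> core" using core_nonempty by blast
  hence F0: "0 \<le> F" using F[OF core_I, of x0] by linarith
  define l where "l = ln expansion"
  have l: "0 < l" using expansion(1) by (simp add: l_def)
  have "- ln (ball_measure M x \<delta>) \<le> (F / l) * - ln \<delta> + (F / l * ln I_len + F + ln gibbs_const)"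
    if x: "x \<in> I" and \<delta>: "0 < \<delta>" "\<delta> \<le> len []" for x \<delta>
  proof -
    obtain n w where w: "stopping \<delta> n w" "x \<in> cyl w" using stopping_exists[OF x \<delta>] by blast
    have ww: "w \<in> words \<P> (Suc n)" using w by (simp add: stopping_def)
    have "take n w \<in> words \<P> n" using cyl_take[OF ww, of n] by simp
    hence "\<delta> \<le> I_len * (1 / expansion) ^ n" using w(1) len_small[of "take n w" n] by (simp add: stopping_def)
    hence "ln \<delta> \<le> ln (I_len * (1 / expansion) ^ n)" using \<delta> by (intro ln_mono) auto
    also have "\<dots> = ln I_len - real n * l"
      using I_len(1) expansion(1) by (simp add: ln_mult ln_realpow ln_div l_def)
    finally have n: "real n \<le> (ln I_len - ln \<delta>) / l" using l by (simp add: field_simps)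
    have "birkhoff_sum f \<phi> (Suc n) x \<ge> (\<Sum>i<Suc n. - F)" unfolding birkhoff_sum_def
    proof (rule sum_mono)
      fix i show "- F \<le> \<phi> ((f ^^ i) x)" using F[OF f_pow_in_I[OF x, of i]] by (simp add: abs_le_iff)
    qed
    hence "- ((real n + 1) * F) \<le> birkhoff_sum f \<phi> (Suc n) x" by (simp add: algebra_simps)
    also have "\<dots> = ln (exp (birkhoff_sum f \<phi> (Suc n) x))" by simp
    also have "\<dots> \<le> ln (gibbs_const * mass w)"
      using gibbs_const(3)[OF ww w(2)] by (intro ln_mono) auto
    also have "\<dots> = ln gibbs_const + ln (mass w)" using gibbs_const(1) mass_pos[OF ww] by (simp add: ln_mult)
    also have "ln (mass w) \<le> ln (ball_measure M x \<delta>)"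
      using stopping_in_ball(2)[OF w] mass_pos[OF ww] by (intro ln_mono) auto
    finally have "- ln (ball_measure M x \<delta>) \<le> real n * F + F + ln gibbs_const" by (simp add: algebra_simps)
    also have "real n * F \<le> (ln I_len - ln \<delta>) / l * F" using n F0 by (intro mult_right_mono)
    finally show ?thesis by (simp add: diff_divide_distrib algebra_simps)
  qed
  thus ?thesis by blast
qed

section \<open>Measures of balls and the two dimensions\<close>

lemma cyl_between:
  assumes w: "w \<in> words \<P> n" and pr: "p \<in> cyl w" "r \<in> cyl w" and q: "p < q" "q < r"
  shows "(f ^^ n) p < (f ^^ n) q \<and> (f ^^ n) q < (f ^^ n) r \<or> (f ^^ n) r < (f ^^ n) q \<and> (f ^^ n) q < (f ^^ n) p"
proof -
  obtain D where D: "\<And>x. x \<in> cyl w \<Longrightarrow> ((f ^^ n) has_real_derivative D x) (at x within cyl w)"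
    using cyl_derivative[OF w] by blast
  have c: "continuous_on (cyl w) (f ^^ n)" by (rule DERIV_continuous_on[OF D])
  have sub: "{p..r} \<subseteq> cyl w"
  proof
    fix x assume "x \<in> {p..r}"
    thus "x \<in> cyl w" using mem_is_interval_1_I[OF cyl_interval[OF w] pr, of x] by simp
  qed
  show ?thesis
    by (rule continuous_inj_imp_mono[OF q continuous_on_subset[OF c sub] inj_on_subset[OF cyl_inj[OF w] sub]])
qed

text \<open>
  Three well separated points of a ball, such that the interval spanned by the outer ones lies
  in the ball and in \<open>I\<close>. The ball may extend beyond \<open>I\<close>, in which case the points are taken
  on one side of the centre.
\<close>

lemma core_triple:
  assumes z: "z \<in> I" and \<eta>: "0 < \<eta>" "\<eta> \<le> I_len"
  shows "\<exists>z1\<in>core. \<exists>z2\<in>core. \<exists>z3\<in>core. z1 \<in> ball z \<eta> \<and> z3 \<in> ball z \<eta> \<and> \<eta> / 10 \<le> z2 - z1 \<and> \<eta> / 10 \<le> z3 - z2"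
proof -
  obtain a b where ab: "a < b" "I = {a..b}" using I_eq by blast
  have S: "Sup I = b" "Inf I = a" unfolding ab(2) using ab(1) by simp_all
  have len: "I_len = b - a" by (simp only: I_len_def S)
  have memI: "x \<in> I \<longleftrightarrow> a \<le> x \<and> x \<le> b" for x unfolding ab(2) by simp
  obtain p where p: "a \<le> p" "p + \<eta> / 2 \<le> b" "z - \<eta> / 2 \<le> p" "p \<le> z"
  proof (cases "z + \<eta> / 2 \<le> b")
    case True
    show ?thesis by (rule that[of z]) (use z True \<eta> in \<open>auto simp: memI\<close>)
  next
    case False
    show ?thesis by (rule that[of "z - \<eta> / 2"]) (use z False \<eta> len in \<open>auto simp: memI\<close>)
  qed
  have ex: "\<exists>x\<in>core. p + s < x \<and> x < p + t" if "0 \<le> s" "s < t" "t \<le> \<eta> / 2" for s t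
    by (rule core_dense) (use p that in \<open>auto simp: memI\<close>)
  obtain z1 where z1: "z1 \<in> core" "p + 0 < z1" "z1 < p + \<eta> / 10" using ex[of 0 "\<eta> / 10"] \<eta> by auto
  obtain z2 where z2: "z2 \<in> core" "p + 2 * \<eta> / 10 < z2" "z2 < p + 3 * \<eta> / 10"
    using ex[of "2 * \<eta> / 10" "3 * \<eta> / 10"] \<eta> by auto
  obtain z3 where z3: "z3 \<in> core" "p + 4 * \<eta> / 10 < z3" "z3 < p + \<eta> / 2"
    using ex[of "4 * \<eta> / 10" "\<eta> / 2"] \<eta> by auto
  have "z1 \<in> ball z \<eta>" "z3 \<in> ball z \<eta>" using z1 z3 p \<eta> by (auto simp: dist_real_def)
  moreover have "\<eta> / 10 \<le> z2 - z1" "\<eta> / 10 \<le> z3 - z2" using z1 z2 z3 by auto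
  ultimately show ?thesis using z1(1) z2(1) z3(1) by blast
qed

definition min_ball :: "real \<Rightarrow> real" where "min_ball \<delta> = (INF x\<in>I. ball_measure M x \<delta>)"
definition max_ball :: "real \<Rightarrow> real" where "max_ball \<delta> = (SUP x\<in>I. ball_measure M x \<delta>)"

lemma I_ne: "I \<noteq> {}" using core_nonempty core_I by blast

lemma ball_measure_nonneg: "0 \<le> ball_measure M x \<delta>" by (simp add: ball_measure_def)

lemma bdd_balls: "bdd_below ((\<lambda>x. ball_measure M x \<delta>) ` S)" "bdd_above ((\<lambda>x. ball_measure M x \<delta>) ` S)"
  by (rule bdd_belowI2[of _ 0], rule ball_measure_nonneg) (rule bdd_aboveI2[of _ _ 1], rule ball_measure_le_1)

lemma min_ball_le: "x \<in> I \<Longrightarrow> min_ball \<delta> \<le> ball_measure M x \<delta>"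
  unfolding min_ball_def by (rule cINF_lower[OF bdd_balls(1)])

lemma max_ball_ge: "x \<in> I \<Longrightarrow> ball_measure M x \<delta> \<le> max_ball \<delta>"
  unfolding max_ball_def by (rule cSUP_upper[OF _ bdd_balls(2)])

lemma max_ball_least: "(\<And>x. x \<in> I \<Longrightarrow> ball_measure M x \<delta> \<le> c) \<Longrightarrow> max_ball \<delta> \<le> c"
  unfolding max_ball_def by (rule cSUP_least[OF I_ne])

lemma min_ball_greatest: "(\<And>x. x \<in> I \<Longrightarrow> c \<le> ball_measure M x \<delta>) \<Longrightarrow> c \<le> min_ball \<delta>"
  unfolding min_ball_def by (rule cINF_greatest[OF I_ne])

lemma ball_measure_mono: "\<delta> \<le> \<eta> \<Longrightarrow> ball_measure M x \<delta> \<le> ball_measure M x \<eta>"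
  unfolding ball_measure_def using I_borel_in_sets[of "ball x \<eta>"]
  by (intro finite_measure_mono) (auto simp: dist_real_def)

lemma min_ball_mono:
  assumes "\<delta> \<le> \<eta>"
  shows "min_ball \<delta> \<le> min_ball \<eta>"
  by (rule min_ball_greatest) (rule order_trans[OF min_ball_le ball_measure_mono[OF assms]])

lemma max_ball_mono:
  assumes "\<delta> \<le> \<eta>"
  shows "max_ball \<delta> \<le> max_ball \<eta>"
  by (rule max_ball_least) (rule order_trans[OF ball_measure_mono[OF assms] max_ball_ge])

lemma min_le_max_ball: "min_ball \<delta> \<le> max_ball \<delta>"
proof -
  obtain x where "x \<in> I" using I_ne by blast
  thus ?thesis using min_ball_le max_ball_ge order_trans by blast
qed

definition scale :: real where "scale = min (1 / 2) (len [])"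

lemma scale: "0 < scale" "scale < 1" "scale \<le> len []" "scale \<le> I_len"
  using len_pos[of "[]" 0] len_small[of "[]" 0] by (auto simp: scale_def)

lemma min_ball_poly:
  "\<exists>A A'. \<forall>\<delta>. 0 < \<delta> \<longrightarrow> \<delta> \<le> scale \<longrightarrow> 0 < min_ball \<delta> \<and> - ln (min_ball \<delta>) \<le> A * - ln \<delta> + A'"
proof -
  obtain A A' where A: "\<And>x \<delta>. x \<in> I \<Longrightarrow> 0 < \<delta> \<Longrightarrow> \<delta> \<le> len [] \<Longrightarrow> - ln (ball_measure M x \<delta>) \<le> A * - ln \<delta> + A'"
    using ball_lower_bound by blast
  have "0 < min_ball \<delta> \<and> - ln (min_ball \<delta>) \<le> A * - ln \<delta> + A'" if d: "0 < \<delta>" "\<delta> \<le> scale" for \<delta>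
  proof -
    have "exp (- (A * - ln \<delta> + A')) \<le> min_ball \<delta>"
    proof (rule min_ball_greatest)
      fix x assume x: "x \<in> I"
      have "0 < ball_measure M x \<delta>" using ball_measure_pos[OF x d(1)] by (simp add: ball_measure_def)
      moreover have "- (A * - ln \<delta> + A') \<le> ln (ball_measure M x \<delta>)" using A[OF x d(1)] d(2) scale(3) by simp
      ultimately show "exp (- (A * - ln \<delta> + A')) \<le> ball_measure M x \<delta>" by (simp add: ln_ge_iff)
    qed
    moreover from this have "0 < min_ball \<delta>" using exp_gt_zero less_le_trans by blast
    ultimately show ?thesis by (simp add: ln_ge_iff flip: minus_le_iff[of _ "ln (min_ball \<delta>)"])
  qed
  thus ?thesis by blast
qed

lemma min_ball_pos: "0 < \<delta> \<Longrightarrow> 0 < min_ball \<delta>"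
proof -
  assume d: "0 < \<delta>"
  have "0 < min_ball (min \<delta> scale)" using min_ball_poly d scale(1) by (metis min.cobounded2 min_less_iff_conj)
  also have "\<dots> \<le> min_ball \<delta>" by (rule min_ball_mono) simp
  finally show ?thesis .
qed

lemma max_ball_pos: "0 < \<delta> \<Longrightarrow> 0 < max_ball \<delta>"
  using min_ball_pos min_le_max_ball less_le_trans by blast

lemma min_ball_le_1: "min_ball \<delta> \<le> 1" and max_ball_le_1: "max_ball \<delta> \<le> 1"
proof -
  show "max_ball \<delta> \<le> 1" by (rule max_ball_least) (rule ball_measure_le_1)
  thus "min_ball \<delta> \<le> 1" using min_le_max_ball order_trans by blast
qed

lemma near_minimal_ball: "0 < \<delta> \<Longrightarrow> \<exists>x\<in>I. ball_measure M x \<delta> < 2 * min_ball \<delta>"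
proof -
  assume "0 < \<delta>"
  hence "min_ball \<delta> < 2 * min_ball \<delta>" using min_ball_pos by simp
  thus ?thesis unfolding min_ball_def[of \<delta>] using cINF_less_iff[OF I_ne bdd_balls(1)] by blast
qed

lemma stopping_len: "\<exists>c>0. c \<le> 1 \<and> (\<forall>\<delta> n w. stopping \<delta> n w \<longrightarrow> c * \<delta> \<le> len w)"
proof -
  obtain c where c: "0 < c" "c \<le> 1" "\<And>n w P. w \<in> words \<P> n \<Longrightarrow> P \<in> \<P> \<Longrightarrow> c * len w \<le> len (w @ [P])"
    using len_child by blast
  have "c * \<delta> \<le> len w" if s: "stopping \<delta> n w" for \<delta> n w
  proof -
    have w: "w \<in> words \<P> (n + 1)" "\<delta> \<le> len (take n w)" using s by (auto simp: stopping_def)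
    obtain v u where uv: "v \<in> words \<P> n" "u \<in> words \<P> 1" "w = v @ u" using words_split[OF w(1)] .
    obtain P where P: "P \<in> \<P>" "u = [P]" using uv(2) by (auto simp: words_def length_Suc_conv)
    have "take n w = v" using uv by (simp add: words_def)
    hence "c * \<delta> \<le> c * len v" using w(2) c(1) by simp
    also have "\<dots> \<le> len w" using c(3)[OF uv(1) P(1)] uv(3) P(2) by simp
    finally show ?thesis .
  qed
  thus ?thesis using c by blast
qed

text \<open>
  Inside a \<open>\<delta>\<close>-ball of almost minimal measure there is a stopping cylinder; pulling back an
  \<open>\<eta>\<close>-ball of almost minimal measure into it gives a set of measure at most a constant times
  the product of the two minima. This set contains a ball of radius \<open>c * \<delta> * \<eta>\<close>: the centre is
  the preimage of the middle point of a triple, and the preimages of the outer points keep the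
  small ball away from the ends of the cylinder, beyond which the measure is not under
  control.
\<close>

lemma min_ball_submultiplicative:
  "\<exists>c>0. c \<le> 1 \<and> (\<exists>C>0. \<forall>\<delta> \<eta>. 0 < \<delta> \<longrightarrow> \<delta> \<le> scale \<longrightarrow> 0 < \<eta> \<longrightarrow> \<eta> \<le> scale \<longrightarrow>
      min_ball (c * \<delta> * \<eta>) \<le> C * min_ball \<delta> * min_ball \<eta>)"
proof -
  obtain c1 where c1: "0 < c1" "c1 \<le> 1" "\<And>\<delta> n w. stopping \<delta> n w \<Longrightarrow> c1 * \<delta> \<le> len w" using stopping_len by blast
  define c where "c = c1 / (10 * dist_const)"
  have c: "0 < c" "c \<le> 1" using c1 dist_const(1) by (auto simp: c_def)
  have G: "0 < gibbs_const ^ 3" using gibbs_const(1) by simp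
  have "min_ball (c * \<delta> * \<eta>) \<le> (4 * gibbs_const ^ 3) * min_ball \<delta> * min_ball \<eta>"
    if \<delta>: "0 < \<delta>" "\<delta> \<le> scale" and \<eta>: "0 < \<eta>" "\<eta> \<le> scale" for \<delta> \<eta>
  proof -
    obtain x where x: "x \<in> I" "ball_measure M x \<delta> < 2 * min_ball \<delta>" using near_minimal_ball[OF \<delta>(1)] by blast
    obtain z where z: "z \<in> I" "ball_measure M z \<eta> < 2 * min_ball \<eta>" using near_minimal_ball[OF \<eta>(1)] by blast
    obtain n w where w: "stopping \<delta> n w" "x \<in> cyl w"
      using stopping_exists[OF x(1) \<delta>(1) order_trans[OF \<delta>(2) scale(3)]] by blast
    have ww: "w \<in> words \<P> (Suc n)" using w(1) by (simp add: stopping_def)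
    obtain z1 z2 z3 where zz: "z1 \<in> core" "z2 \<in> core" "z3 \<in> core" "z1 \<in> ball z \<eta>" "z3 \<in> ball z \<eta>"
      "\<eta> / 10 \<le> z2 - z1" "\<eta> / 10 \<le> z3 - z2"
      using core_triple[OF z(1) \<eta>(1) order_trans[OF \<eta>(2) scale(4)]] by blast
    define y1 y2 y3 where "y1 = pt w z1" and "y2 = pt w z2" and "y3 = pt w z3"
    have y: "y1 \<in> cyl w" "y2 \<in> cyl w" "y3 \<in> cyl w"
      unfolding y1_def y2_def y3_def using pt(1)[OF ww] zz by blast+
    have fy: "(f ^^ Suc n) y1 = z1" "(f ^^ Suc n) y2 = z2" "(f ^^ Suc n) y3 = z3"
      unfolding y1_def y2_def y3_def using pt(2)[OF ww] zz by blast+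
    have far: "c * \<delta> * \<eta> \<le> \<bar>y2 - y\<bar>" if "y \<in> cyl w" "\<eta> / 10 \<le> \<bar>z2 - (f ^^ Suc n) y\<bar>" for y
    proof -
      have "\<eta> / 10 * (c1 * \<delta>) \<le> \<bar>(f ^^ Suc n) y2 - (f ^^ Suc n) y\<bar> * len w"
        unfolding fy(2) using that(2) c1(3)[OF w(1)] c1(1) \<delta> by (intro mult_mono) auto
      also have "\<dots> \<le> dist_const * \<bar>y2 - y\<bar>" by (rule dist_const(2)[OF ww y(2) that(1)])
      finally show ?thesis using dist_const(1) by (simp add: c_def field_simps)
    qed
    define \<rho> where "\<rho> = c * \<delta> * \<eta>"
    have \<rho>: "0 < \<rho>" using c \<delta> \<eta> by (simp add: \<rho>_def)
    have g1: "\<rho> \<le> \<bar>y2 - y1\<bar>" and g3: "\<rho> \<le> \<bar>y2 - y3\<bar>"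
      unfolding \<rho>_def by (rule far; use y fy zz \<eta> in simp)+
    have ord: "z1 < z2" "z2 < z3" using zz \<eta> by auto
    have yne: "y1 \<noteq> y3" using fy ord by auto
    \<comment> \<open>The iterate preserves betweenness on a cylinder, and \<open>z2\<close> lies between \<open>z1\<close> and
        \<open>z3\<close>.\<close>
    have bt: "min y1 y3 < y2 \<and> y2 < max y1 y3"
    proof (rule ccontr)
      assume n: "\<not> ?thesis"
      have ne: "y2 \<noteq> y1" "y2 \<noteq> y3" using g1 g3 \<rho> by auto
      consider "y2 < y1" "y1 < y3" | "y2 < y3" "y3 < y1" | "y1 < y3" "y3 < y2" | "y3 < y1" "y1 < y2"
        using n ne yne by (auto simp: min_def max_def split: if_splits)
      thus False
      proof cases
        case 1 thus ?thesis using cyl_between[OF ww y(2,3), of y1] ord unfolding fy by auto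
      next
        case 2 thus ?thesis using cyl_between[OF ww y(2,1), of y3] ord unfolding fy by auto
      next
        case 3 thus ?thesis using cyl_between[OF ww y(1,2), of y3] ord unfolding fy by auto
      next
        case 4 thus ?thesis using cyl_between[OF ww y(3,2), of y1] ord unfolding fy by auto
      qed
    qed
    have sub: "ball y2 \<rho> \<inter> I \<subseteq> {t \<in> cyl w. (f ^^ Suc n) t \<in> ball z \<eta>}"
    proof
      fix t assume "t \<in> ball y2 \<rho> \<inter> I"
      hence t: "min y1 y3 < t" "t < max y1 y3" using bt g1 g3 by (auto simp: dist_real_def min_def max_def split: if_splits)
      have m: "min y1 y3 \<in> cyl w" "max y1 y3 \<in> cyl w" using y by (auto simp: min_def max_def)
      have tc: "t \<in> cyl w" by (rule mem_is_interval_1_I[OF cyl_interval[OF ww] m]) (use t in auto)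
      have "z1 < (f ^^ Suc n) t \<and> (f ^^ Suc n) t < z3"
      proof (cases "y1 < y3")
        case True
        thus ?thesis using cyl_between[OF ww y(1,3), of t] t ord unfolding fy by auto
      next
        case False
        thus ?thesis using cyl_between[OF ww y(3,1), of t] t ord unfolding fy by auto
      qed
      hence "(f ^^ Suc n) t \<in> ball z \<eta>" using zz(4,5) by (auto simp: dist_real_def abs_less_iff)
      thus "t \<in> {t \<in> cyl w. (f ^^ Suc n) t \<in> ball z \<eta>}" using tc by blast
    qed
    have "min_ball \<rho> \<le> ball_measure M y2 \<rho>" using y(2) cyl_sub[OF ww] by (intro min_ball_le) blast
    also have "\<dots> \<le> measure M {t \<in> cyl w. (f ^^ Suc n) t \<in> ball z \<eta>}"
      unfolding ball_measure_def space_M by (rule finite_measure_mono[OF sub pullback_sets[OF ww]])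
    also have "\<dots> \<le> gibbs_const ^ 3 * mass w * ball_measure M z \<eta>" by (rule pullback_ball[OF ww])
    also have "\<dots> \<le> gibbs_const ^ 3 * (2 * min_ball \<delta>) * (2 * min_ball \<eta>)"
      using stopping_in_ball(2)[OF w] x(2) z(2) G min_ball_pos[OF \<delta>(1)]
      by (intro mult_mono mult_nonneg_nonneg ball_measure_nonneg) auto
    finally show ?thesis by (simp add: \<rho>_def mult_ac)
  qed
  thus ?thesis using c G by (intro exI[of _ c]) (auto intro!: exI[of _ "4 * gibbs_const ^ 3"])
qed

text \<open>
  A ball of radius \<open>r = c * \<delta> * \<eta>\<close> is shorter than every stopping cylinder at scale \<open>\<delta>\<close>, so
  the stopping cylinders that it meets contain one of its end points and are at most two in
  number. An iterate of \<open>f\<close> spreads the part of the ball in such a cylinder over a set that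
  fits into an \<open>\<eta>\<close>-ball.
\<close>

lemma max_ball_submultiplicative:
  "\<exists>c>0. c \<le> 1 \<and> (\<exists>C>0. \<forall>\<delta> \<eta>. 0 < \<delta> \<longrightarrow> \<delta> \<le> scale \<longrightarrow> 0 < \<eta> \<longrightarrow> \<eta> \<le> scale \<longrightarrow>
      max_ball (c * \<delta> * \<eta>) \<le> C * max_ball \<delta> * max_ball \<eta>)"
proof -
  obtain c1 where c1: "0 < c1" "c1 \<le> 1" "\<And>\<delta> n w. stopping \<delta> n w \<Longrightarrow> c1 * \<delta> \<le> len w" using stopping_len by blast
  define c where "c = c1 / (4 * dist_const)"
  have c: "0 < c" "c \<le> 1" using c1 dist_const(1) by (auto simp: c_def)
  define G where "G = gibbs_const ^ 3"
  have G: "0 < G" using gibbs_const(1) by (simp add: G_def)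
  have "max_ball (c * \<delta> * \<eta>) \<le> (2 * G) * max_ball \<delta> * max_ball \<eta>"
    if \<delta>: "0 < \<delta>" "\<delta> \<le> scale" and \<eta>: "0 < \<eta>" "\<eta> \<le> scale" for \<delta> \<eta>
  proof (rule max_ball_least)
    fix x assume x: "x \<in> I"
    define r where "r = c * \<delta> * \<eta>"
    have "4 * dist_const * r = c1 * \<delta> * \<eta>" using dist_const(1) by (simp add: r_def c_def)
    moreover have r0: "0 < r" using c \<delta> \<eta> by (simp add: r_def)
    ultimately have r: "dist_const * (2 * r) < c1 * \<delta> * \<eta>"
      using mult_pos_pos[of dist_const r] dist_const(1) by linarith
    have "2 * r \<le> dist_const * (2 * r)" using dist_const(1) r0 by simp
    also have "\<dots> < c1 * \<delta> * \<eta>" by (rule r)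
    also have "\<dots> \<le> c1 * \<delta> * 1" using c1 \<delta> \<eta> scale(2) by (intro mult_left_mono) auto
    finally have r2: "2 * r < c1 * \<delta>" by simp
    define Bx where "Bx = ball x r \<inter> I"
    have Bs: "Bx \<in> sets M" unfolding Bx_def by (rule I_borel_in_sets) simp
    have one: "measure M (Bx \<inter> cyl w) \<le> G * max_ball \<delta> * max_ball \<eta>" if w: "stopping \<delta> n w" for n w
    proof (cases "Bx \<inter> cyl w = {}")
      case True
      thus ?thesis using G max_ball_pos[OF \<delta>(1)] max_ball_pos[OF \<eta>(1)] by simp
    next
      case False
      then obtain q0 where q0: "q0 \<in> Bx" "q0 \<in> cyl w" by blast
      have ww: "w \<in> words \<P> (Suc n)" using w by (simp add: stopping_def)
      define z where "z = (f ^^ Suc n) q0"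
      have z: "z \<in> I" "q0 \<in> I" unfolding z_def using q0(1) f_pow_in_I[of q0 "Suc n"] by (auto simp: Bx_def simp del: funpow.simps)
      have sub: "Bx \<inter> cyl w \<subseteq> {t \<in> cyl w. (f ^^ Suc n) t \<in> ball z \<eta>}"
      proof
        fix t assume t: "t \<in> Bx \<inter> cyl w"
        have "\<bar>q0 - t\<bar> < 2 * r" using q0(1) t unfolding Bx_def by (auto simp: dist_real_def)
        hence "dist_const * \<bar>q0 - t\<bar> \<le> dist_const * (2 * r)" using dist_const(1) by (intro mult_left_mono) auto
        moreover have "\<bar>z - (f ^^ Suc n) t\<bar> * len w \<le> dist_const * \<bar>q0 - t\<bar>"
          unfolding z_def by (rule dist_const(2)[OF ww q0(2)]) (use t in blast)
        moreover have "\<bar>z - (f ^^ Suc n) t\<bar> * (c1 * \<delta>) \<le> \<bar>z - (f ^^ Suc n) t\<bar> * len w"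
          using c1(3)[OF w] by (intro mult_left_mono) auto
        ultimately have "\<bar>z - (f ^^ Suc n) t\<bar> * (c1 * \<delta>) < \<eta> * (c1 * \<delta>)" using r by (simp add: mult_ac)
        hence "\<bar>z - (f ^^ Suc n) t\<bar> < \<eta>" using c1 \<delta> by (simp add: mult_less_cancel_right)
        thus "t \<in> {t \<in> cyl w. (f ^^ Suc n) t \<in> ball z \<eta>}" using t by (simp add: dist_real_def del: funpow.simps)
      qed
      have "measure M (Bx \<inter> cyl w) \<le> measure M {t \<in> cyl w. (f ^^ Suc n) t \<in> ball z \<eta>}"
        by (rule finite_measure_mono[OF sub pullback_sets[OF ww]])
      also have "\<dots> \<le> G * mass w * ball_measure M z \<eta>" unfolding G_def by (rule pullback_ball[OF ww])
      also have "\<dots> \<le> G * max_ball \<delta> * max_ball \<eta>"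
        using stopping_in_ball(2)[OF w q0(2)] max_ball_ge[OF z(2), of \<delta>] max_ball_ge[OF z(1), of \<eta>] G max_ball_pos[OF \<delta>(1)]
        by (intro mult_mono mult_nonneg_nonneg ball_measure_nonneg) auto
      finally show ?thesis .
    qed
    have piece: "\<exists>E\<in>sets M. (\<forall>n w. stopping \<delta> n w \<and> e \<in> cyl w \<longrightarrow> cyl w \<subseteq> E) \<and>
        measure M (Bx \<inter> E) \<le> G * max_ball \<delta> * max_ball \<eta>" for e
    proof (cases "\<exists>n w. stopping \<delta> n w \<and> e \<in> cyl w")
      case True
      then obtain n w where w: "stopping \<delta> n w" "e \<in> cyl w" by blast
      have "cyl w \<in> sets M" using w(1) cyl_sets by (auto simp: stopping_def)
      moreover have "cyl v \<subseteq> cyl w" if "stopping \<delta> m v" "e \<in> cyl v" for m v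
        using stopping_unique[OF that(1) w(1) that(2) w(2)] by simp
      ultimately show ?thesis using one[OF w(1)] by blast
    next
      case False
      show ?thesis
        by (rule bexI[of _ "{}"]) (use False G max_ball_pos[OF \<delta>(1)] max_ball_pos[OF \<eta>(1)] in auto)
    qed
    obtain E1 where E1: "E1 \<in> sets M" "\<And>n w. stopping \<delta> n w \<Longrightarrow> x - r \<in> cyl w \<Longrightarrow> cyl w \<subseteq> E1"
      "measure M (Bx \<inter> E1) \<le> G * max_ball \<delta> * max_ball \<eta>" using piece[of "x - r"] by blast
    obtain E2 where E2: "E2 \<in> sets M" "\<And>n w. stopping \<delta> n w \<Longrightarrow> x + r \<in> cyl w \<Longrightarrow> cyl w \<subseteq> E2"
      "measure M (Bx \<inter> E2) \<le> G * max_ball \<delta> * max_ball \<eta>" using piece[of "x + r"] by blast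
    have "Bx \<subseteq> (Bx \<inter> E1) \<union> (Bx \<inter> E2)"
    proof
      fix q assume q: "q \<in> Bx"
      have qI: "q \<in> I" and qb: "x - r < q" "q < x + r" using q by (auto simp: Bx_def dist_real_def)
      obtain n w where w: "stopping \<delta> n w" "q \<in> cyl w"
        using stopping_exists[OF qI \<delta>(1) order_trans[OF \<delta>(2) scale(3)]] by blast
      have ww: "w \<in> words \<P> (Suc n)" using w(1) by (simp add: stopping_def)
      have "\<not> (\<forall>t\<in>cyl w. x - r < t \<and> t < x + r)"
      proof
        assume a: "\<forall>t\<in>cyl w. x - r < t \<and> t < x + r"
        have "len w \<le> 2 * r"
        proof (rule len_least[OF ww])
          fix s t assume "s \<in> cyl w" "t \<in> cyl w"
          hence "x - r < s \<and> s < x + r" "x - r < t \<and> t < x + r" using a by blast+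
          thus "\<bar>s - t\<bar> \<le> 2 * r" by linarith
        qed
        thus False using c1(3)[OF w(1)] r2 by simp
      qed
      then obtain t where t: "t \<in> cyl w" "t \<le> x - r \<or> x + r \<le> t" by (auto simp: not_less)
      have "x - r \<in> cyl w \<or> x + r \<in> cyl w"
        using t(2) qb mem_is_interval_1_I[OF cyl_interval[OF ww] t(1) w(2), of "x - r"]
          mem_is_interval_1_I[OF cyl_interval[OF ww] w(2) t(1), of "x + r"] by auto
      thus "q \<in> (Bx \<inter> E1) \<union> (Bx \<inter> E2)" using E1(2)[OF w(1)] E2(2)[OF w(1)] w(2) q by blast
    qed
    hence "measure M Bx \<le> measure M ((Bx \<inter> E1) \<union> (Bx \<inter> E2))" using Bs E1 E2 by (intro finite_measure_mono) auto
    also have "\<dots> \<le> measure M (Bx \<inter> E1) + measure M (Bx \<inter> E2)" using Bs E1 E2 by (intro measure_Un_le) auto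
    finally show "ball_measure M x (c * \<delta> * \<eta>) \<le> (2 * G) * max_ball \<delta> * max_ball \<eta>"
      using E1(3) E2(3) by (simp add: ball_measure_def Bx_def r_def)
  qed
  thus ?thesis using c G by (intro exI[of _ c]) (auto intro!: exI[of _ "2 * G"])
qed

text \<open>
  A ball that is too short to contain a cylinder of level \<open>n\<close> meets at most two of them, of
  total mass at most \<open>2 * \<theta> ^ n\<close>.
\<close>

lemma max_ball_vanishes: "0 < e \<Longrightarrow> \<exists>\<delta>>0. \<delta> \<le> scale \<and> max_ball \<delta> < e"
proof -
  assume e: "0 < e"
  obtain \<theta> where \<theta>: "0 < \<theta>" "\<theta> < 1" "\<And>n w. w \<in> words \<P> n \<Longrightarrow> mass w \<le> \<theta> ^ n" using mass_decay by blast
  obtain n where n: "\<theta> ^ n < e / 2" using real_arch_pow_inv[of "e / 2" \<theta>] e \<theta> by auto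
  obtain u v where uv: "u \<in> core" "v \<in> core" "u < v" using core_two_points by blast
  define gap where "gap w = \<bar>pt w u - pt w v\<bar>" for w
  have gap: "0 < gap w" if "w \<in> words \<P> n" for w using pt_inj[OF that uv(1,2)] uv(3) by (auto simp: gap_def)
  have wne: "words \<P> n \<noteq> {}" using cyl_cover[of u n] core_I[OF uv(1)] by blast
  define g where "g = Min (gap ` words \<P> n)"
  have g: "0 < g" unfolding g_def using gap wne fin_P by (subst Min_gr_iff) auto
  define \<delta> where "\<delta> = min scale (g / 2)"
  have d: "0 < \<delta>" "\<delta> \<le> scale" "2 * \<delta> \<le> g" using g scale by (auto simp: \<delta>_def)
  have "max_ball \<delta> \<le> 2 * \<theta> ^ n"
  proof (rule max_ball_least)
    fix x assume "x \<in> I"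
    have "inside_words (ball x \<delta>) n = {}"
    proof (rule ccontr)
      assume "inside_words (ball x \<delta>) n \<noteq> {}"
      then obtain w where w: "w \<in> words \<P> n" "pt w ` core \<subseteq> ball x \<delta>" by (auto simp: inside_words_def)
      have "pt w u \<in> ball x \<delta>" "pt w v \<in> ball x \<delta>" using w(2) uv by blast+
      hence "gap w < 2 * \<delta>" unfolding gap_def by (auto simp: dist_real_def)
      moreover have "g \<le> gap w" unfolding g_def using w(1) fin_P by (intro Min_le) auto
      ultimately show False using d by simp
    qed
    thus "ball_measure M x \<delta> \<le> 2 * \<theta> ^ n"
      using inside_mass_ge[of n "\<theta> ^ n" x \<delta>] \<theta> by simp
  qed
  thus ?thesis using d n by (intro exI[of _ \<delta>]) auto
qed

lemma min_dimension:
  "0 \<le> dim_min_ball M \<and> (\<exists>k>0. \<forall>\<delta>. 0 < \<delta> \<longrightarrow> \<delta> \<le> scale \<longrightarrow> k * \<delta> powr dim_min_ball M \<le> min_ball \<delta>)"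
proof -
  obtain A A' where A: "\<And>\<delta>. 0 < \<delta> \<Longrightarrow> \<delta> \<le> scale \<Longrightarrow> - ln (min_ball \<delta>) \<le> A * - ln \<delta> + A'" using min_ball_poly by blast
  obtain c C where c: "0 < c" "c \<le> 1" "0 < C" "\<And>\<delta> \<eta>. 0 < \<delta> \<Longrightarrow> \<delta> \<le> scale \<Longrightarrow> 0 < \<eta> \<Longrightarrow> \<eta> \<le> scale \<Longrightarrow>
      min_ball (c * \<delta> * \<eta>) \<le> C * min_ball \<delta> * min_ball \<eta>" using min_ball_submultiplicative by blast
  obtain L where L: "0 \<le> L" "((\<lambda>\<delta>. ln (min_ball \<delta>) / ln \<delta>) \<longlongrightarrow> L) (at_right 0)"
      "\<exists>k>0. \<forall>\<delta>. 0 < \<delta> \<longrightarrow> \<delta> \<le> scale \<longrightarrow> k * \<delta> powr L \<le> min_ball \<delta>"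
    using power_law_of_submultiplicative[OF scale(1,2) c(1-3) min_ball_pos min_ball_le_1 min_ball_mono c(4) A] by blast
  have "dim_min_ball M = L" unfolding dim_min_ball_def
    using tendsto_Lim[OF _ L(2)] by (simp add: min_ball_def)
  thus ?thesis using L by simp
qed

lemma max_dimension:
  "0 < dim_max_ball M \<and> (\<exists>r1>0. \<forall>r. 0 < r \<longrightarrow> r < r1 \<longrightarrow> max_ball r \<le> r powr (dim_max_ball M / 2))"
proof -
  obtain A A' where A0: "\<And>\<delta>. 0 < \<delta> \<Longrightarrow> \<delta> \<le> scale \<Longrightarrow> - ln (min_ball \<delta>) \<le> A * - ln \<delta> + A'" using min_ball_poly by blast
  have A: "- ln (max_ball \<delta>) \<le> A * - ln \<delta> + A'" if "0 < \<delta>" "\<delta> \<le> scale" for \<delta>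
    using A0[OF that] ln_mono[OF min_le_max_ball min_ball_pos[OF that(1)]] max_ball_pos[OF that(1)] by simp
  obtain c C where c: "0 < c" "c \<le> 1" "0 < C" "\<And>\<delta> \<eta>. 0 < \<delta> \<Longrightarrow> \<delta> \<le> scale \<Longrightarrow> 0 < \<eta> \<Longrightarrow> \<eta> \<le> scale \<Longrightarrow>
      max_ball (c * \<delta> * \<eta>) \<le> C * max_ball \<delta> * max_ball \<eta>" using max_ball_submultiplicative by blast
  have v: "\<forall>e>0. \<exists>\<delta>>0. \<delta> \<le> scale \<and> max_ball \<delta> < e" using max_ball_vanishes by blast
  obtain L where L: "((\<lambda>\<delta>. ln (max_ball \<delta>) / ln \<delta>) \<longlongrightarrow> L) (at_right 0)" "0 < L"
    using power_law_of_submultiplicative[OF scale(1,2) c(1-3) max_ball_pos max_ball_le_1 max_ball_mono c(4) A] v by blast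
  have dL: "dim_max_ball M = L" unfolding dim_max_ball_def
    using tendsto_Lim[OF _ L(1)] by (simp add: max_ball_def)
  have "\<forall>\<^sub>F r in at_right 0. L / 2 < ln (max_ball r) / ln r" by (rule order_tendstoD(1)[OF L(1)]) (use L in simp)
  then obtain r0 where r0: "0 < r0" "\<And>r. 0 < r \<Longrightarrow> r < r0 \<Longrightarrow> L / 2 < ln (max_ball r) / ln r"
    unfolding eventually_at_right_field by auto
  have "max_ball r \<le> r powr (L / 2)" if r: "0 < r" "r < min r0 1" for r
  proof -
    have "ln r < 0" using r by simp
    hence "ln (max_ball r) < L / 2 * ln r" using r0(2)[of r] r by (simp add: less_divide_eq)
    hence "exp (ln (max_ball r)) \<le> exp (L / 2 * ln r)" by simp
    thus ?thesis using max_ball_pos[OF r(1)] r(1) by (simp add: powr_def)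
  qed
  thus ?thesis unfolding dL using L(2) r0(1) by (intro conjI exI[of _ "min r0 1"]) auto
qed

end

section \<open>The expected blanket time\<close>

text \<open>
  The first bound is used for the terms with \<open>N < ln Q / \<gamma>\<close> and the second, geometric from
  there on, for the others.
\<close>

lemma suminf_min_geometric:
  fixes a :: "nat \<Rightarrow> real"
  assumes a: "\<And>N. 0 \<le> a N" "\<And>N. a N \<le> 1" "\<And>N. a N \<le> Q * exp (- (\<gamma> * real N))"
    and Q: "1 \<le> Q" and \<gamma>: "0 < \<gamma>"
  shows "summable a" "suminf a \<le> 2 + (1 + ln Q) / \<gamma>"
proof -
  define N0 where "N0 = nat \<lceil>ln Q / \<gamma>\<rceil>"
  have lnQ: "0 \<le> ln Q / \<gamma>" using Q \<gamma> by simp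
  have N0: "ln Q / \<gamma> \<le> real N0" "real N0 \<le> ln Q / \<gamma> + 1" using lnQ unfolding N0_def by linarith+
  define q where "q = exp (- \<gamma>)"
  have q: "0 < q" "q < 1" using \<gamma> by (auto simp: q_def)
  define b where "b N = (if N < N0 then 1 else q ^ (N - N0))" for N
  have ab: "a N \<le> b N" for N
  proof (cases "N < N0")
    case True thus ?thesis using a(2) by (simp add: b_def)
  next
    case False
    have "Q = exp (ln Q)" using Q by simp
    also have "\<dots> \<le> exp (\<gamma> * real N0)" using N0(1) \<gamma> by (simp add: field_simps)
    finally have "Q * exp (- (\<gamma> * real N)) \<le> exp (\<gamma> * real N0) * exp (- (\<gamma> * real N))" by (intro mult_right_mono) auto
    also have "\<dots> = q ^ (N - N0)"
      using False by (simp add: q_def of_nat_diff algebra_simps flip: exp_add exp_of_nat_mult)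
    finally show ?thesis using a(3)[of N] False by (simp add: b_def)
  qed
  have "(\<lambda>n. b (n + N0)) sums (1 / (1 - q))" using geometric_sums[of q] q by (simp add: b_def)
  hence bs: "b sums (1 / (1 - q) + (\<Sum>i<N0. b i))" by (simp add: sums_iff_shift)
  have sumb: "(\<Sum>i<N0. b i) = real N0" by (simp add: b_def)
  show sa: "summable a" by (rule summable_comparison_test'[OF sums_summable[OF bs], of 0]) (use ab a in simp)
  have "suminf a \<le> suminf b" by (rule suminf_le[OF ab sa sums_summable[OF bs]])
  also have "\<dots> = 1 / (1 - q) + real N0" using sums_unique[OF bs] sumb by simp
  also have "1 / (1 - q) \<le> 1 + 1 / \<gamma>"
  proof -
    have "(1 + \<gamma>) * q \<le> exp \<gamma> * q" using exp_ge_add_one_self[of \<gamma>] q by (intro mult_right_mono) auto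
    hence "(1 + \<gamma>) * q \<le> 1" by (simp add: q_def flip: exp_add)
    thus ?thesis using q \<gamma> by (simp add: field_simps)
  qed
  also have "1 + 1 / \<gamma> + real N0 \<le> 2 + (1 + ln Q) / \<gamma>" using N0(2) by (simp add: add_divide_distrib)
  finally show "suminf a \<le> 2 + (1 + ln Q) / \<gamma>" by simp
qed

text \<open>
  Blanketing need not be monotone in \<open>N\<close>, but every time before the blanket time fails. If no
  time is a success, the series diverges.
\<close>

lemma blanket_time_le_suminf:
  assumes bad: "\<And>N. 1 \<le> N \<Longrightarrow> \<not> blanketed f M \<epsilon> \<delta> x N \<Longrightarrow> x \<in> Bad N"
  shows "blanket_time f M \<epsilon> \<delta> x \<le> 1 + (\<Sum>N. indicator (Bad N) x)"
proof -
  define S where "S = (\<Sum>N. indicator (Bad N) x :: ennreal)"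
  have S: "of_nat m \<le> S" if "\<And>N. 1 \<le> N \<Longrightarrow> N \<le> m \<Longrightarrow> \<not> blanketed f M \<epsilon> \<delta> x N" for m
  proof -
    have one: "indicator (Bad N) x = (1::ennreal)" if "N \<in> {1..m}" for N
      using bad[of N] \<open>\<And>N. 1 \<le> N \<Longrightarrow> N \<le> m \<Longrightarrow> \<not> blanketed f M \<epsilon> \<delta> x N\<close>[of N] that
      by (simp add: indicator_def)
    have "of_nat m = (\<Sum>N=1..m. indicator (Bad N) x :: ennreal)"
      by (subst sum.cong[OF refl one]) auto
    also have "\<dots> \<le> S" unfolding S_def by (intro sum_le_suminf) auto
    finally show ?thesis .
  qed
  show ?thesis
  proof (cases "\<exists>N\<ge>1. blanketed f M \<epsilon> \<delta> x N")
    case True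
    define k where "k = (LEAST N. 1 \<le> N \<and> blanketed f M \<epsilon> \<delta> x N)"
    have k: "1 \<le> k \<and> blanketed f M \<epsilon> \<delta> x k" 
      unfolding k_def
      by (rule LeastI_ex[of "\<lambda>N. 1 \<le> N \<and> blanketed f M \<epsilon> \<delta> x N"]) (rule True)
    have "of_nat (k - 1) \<le> S"
    proof (rule S)
      fix N assume "1 \<le> N" "N \<le> k - 1"
      thus "\<not> blanketed f M \<epsilon> \<delta> x N" 
        using not_less_Least[of N "\<lambda>N. 1 \<le> N \<and> blanketed f M \<epsilon> \<delta> x N", folded k_def] k by auto
    qed
    hence "1 + of_nat (k - 1) \<le> 1 + S" by (rule add_left_mono)
    moreover have "(of_nat k :: ennreal) = of_nat (1 + (k - 1))" using k by simp
    hence "(of_nat k :: ennreal) = 1 + of_nat (k - 1)" by (simp only: of_nat_add of_nat_1)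
    ultimately show ?thesis using True by (simp add: blanket_time_def k_def S_def)
  next
    case False
    hence "of_nat m \<le> S" for m using S by blast
    hence "S = top"
      using ennreal_Ex_less_of_nat[of S] by (cases "S = top") (auto simp: top.not_eq_extremum not_less[symmetric])
    thus ?thesis by (simp add: S_def)
  qed
qed

context gibbs_interval
begin

lemma short_set_measure:
  assumes E: "E \<subseteq> I" and \<tau>: "0 < \<tau>" and short: "\<And>s t. s \<in> E \<Longrightarrow> t \<in> E \<Longrightarrow> \<bar>s - t\<bar> < \<tau>"
  shows "measure M E \<le> max_ball \<tau>"
proof (cases "E = {}")
  case True thus ?thesis using max_ball_pos[OF \<tau>] by simp
next
  case False
  then obtain s where s: "s \<in> E" by blast
  have "E \<subseteq> ball s \<tau> \<inter> I" using short[OF s] E by (auto simp: dist_real_def)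
  hence "measure M E \<le> ball_measure M s \<tau>"
    unfolding ball_measure_def space_M by (rule finite_measure_mono) (rule I_borel_in_sets, simp)
  also have "\<dots> \<le> max_ball \<tau>" using s E by (intro max_ball_ge) blast
  finally show ?thesis .
qed

text \<open>
  The smaller ball lies in the larger one and misses at most two intervals of length less than
  \<open>\<tau>\<close>.
\<close>

lemma grid_ball:
  assumes z: "z \<le> y" "y < z + \<rho>" and \<rho>: "0 < \<rho>" "3 * \<rho> = \<tau>"
  shows "ball_measure M y \<delta> \<le> ball_measure M z (\<delta> - \<rho>) + 2 * max_ball \<tau>"
    "ball z (\<delta> - \<rho>) \<subseteq> ball y \<delta>"
proof -
  show "ball z (\<delta> - \<rho>) \<subseteq> ball y \<delta>" using z by (auto simp: dist_real_def)
  define E1 where "E1 = {y - \<delta><..z - (\<delta> - \<rho>)} \<inter> I"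
  define E2 where "E2 = {z + (\<delta> - \<rho>)..<y + \<delta>} \<inter> I"
  have s: "ball z (\<delta> - \<rho>) \<inter> I \<in> sets M" "E1 \<in> sets M" "E2 \<in> sets M"
    unfolding E1_def E2_def by (auto intro: I_borel_in_sets)
  have m: "measure M E1 \<le> max_ball \<tau>" "measure M E2 \<le> max_ball \<tau>"
    by (rule short_set_measure; use z \<rho> in \<open>auto simp: E1_def E2_def\<close>)+
  have "ball y \<delta> \<inter> I \<subseteq> (ball z (\<delta> - \<rho>) \<inter> I) \<union> (E1 \<union> E2)"
    by (auto simp: E1_def E2_def dist_real_def)
  hence "measure M (ball y \<delta> \<inter> I) \<le> measure M ((ball z (\<delta> - \<rho>) \<inter> I) \<union> (E1 \<union> E2))"
    using s by (intro finite_measure_mono) auto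
  also have "\<dots> \<le> measure M (ball z (\<delta> - \<rho>) \<inter> I) + measure M (E1 \<union> E2)" using s by (intro measure_Un_le) auto
  also have "measure M (E1 \<union> E2) \<le> measure M E1 + measure M E2" using s by (intro measure_Un_le) auto
  finally show "ball_measure M y \<delta> \<le> ball_measure M z (\<delta> - \<rho>) + 2 * max_ball \<tau>"
    using m by (simp add: ball_measure_def)
qed

lemma grid:
  assumes \<rho>: "0 < \<rho>"
  shows "\<exists>Y. finite Y \<and> Y \<subseteq> I \<and> real (card Y) \<le> I_len / \<rho> + 1 \<and> (\<forall>y\<in>I. \<exists>z\<in>Y. z \<le> y \<and> y < z + \<rho>)"
proof -
  obtain a b where ab: "a < b" "I = {a..b}" using I_eq by blast
  have S: "Sup I = b" "Inf I = a" unfolding ab(2) using ab(1) by simp_all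
  have len: "I_len = b - a" by (simp only: I_len_def S)
  have memI: "x \<in> I \<longleftrightarrow> a \<le> x \<and> x \<le> b" for x unfolding ab(2) by simp
  define J where "J = nat \<lfloor>I_len / \<rho>\<rfloor>"
  define g where "g j = a + real j * \<rho>" for j
  define Y where "Y = g ` {..J} \<inter> I"
  have "card Y \<le> card (g ` {..J})" unfolding Y_def by (intro card_mono) auto
  also have "\<dots> \<le> J + 1" using card_image_le[of "{..J}" g] by simp
  finally have "real (card Y) \<le> real J + 1" by simp
  also have "real J \<le> I_len / \<rho>" using I_len(1) \<rho> by (simp add: J_def)
  finally have c: "real (card Y) \<le> I_len / \<rho> + 1" by simp
  have "\<exists>z\<in>Y. z \<le> y \<and> y < z + \<rho>" if y: "y \<in> I" for y
  proof -
    define j where "j = nat \<lfloor>(y - a) / \<rho>\<rfloor>"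
    have y0: "0 \<le> (y - a) / \<rho>" using y \<rho> by (simp add: memI)
    have j: "real j \<le> (y - a) / \<rho>" "(y - a) / \<rho> < real j + 1" using y0 unfolding j_def by linarith+
    have b: "g j \<le> y" "y < g j + \<rho>" using j \<rho> by (auto simp: g_def field_simps)
    have "a \<le> g j" using \<rho> by (simp add: g_def)
    hence "g j \<in> I" using b y by (simp add: memI)
    moreover have "j \<le> J" unfolding j_def J_def len
      using y \<rho> by (intro nat_mono floor_mono divide_right_mono) (auto simp: memI)
    ultimately have "g j \<in> Y" by (auto simp: Y_def)
    thus ?thesis using b by blast
  qed
  thus ?thesis using c by (intro exI[of _ Y]) (auto simp: Y_def)
qed

text \<open>
  Union bound over the grid, with the deviation estimate at \<open>\<epsilon> / 2\<close>: the passage to grid balls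
  costs a factor \<open>1 - \<epsilon> / 4\<close>, and \<open>1 - \<epsilon> \<le> (1 - \<epsilon> / 2) * (1 - \<epsilon> / 4)\<close>.
\<close>

theorem expected_blanket_time:
  "\<exists>\<delta>\<^sub>0\<in>{0<..<1}. \<exists>C>0. \<forall>\<epsilon>\<in>{0<..<1}. \<forall>\<delta>\<in>{0<..<\<delta>\<^sub>0}.
     (\<integral>\<^sup>+x. blanket_time f M \<epsilon> \<delta> x \<partial>M)
       \<le> ennreal (C * (1 + ln (1 / \<epsilon>)) ^ 3 / \<epsilon>\<^sup>2 * \<delta> powr (- dim_min_ball M) * ln (1 / \<delta>))"
proof -
  define D where "D = dim_min_ball M"
  define d where "d = dim_max_ball M"
  obtain c C where c: "0 < c" and C: "1 \<le> C" and dev: "\<And>\<epsilon> y r N. \<epsilon> \<in> {0<..<1} \<Longrightarrow> 0 < ball_measure M y r \<Longrightarrow>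
     measure M {x \<in> I. (\<Sum>i<N. indicat_real (ball y r) ((f ^^ i) x)) \<le> (1 - \<epsilon>) * ball_measure M y r * real N}
     \<le> C * exp (- (c * \<epsilon>\<^sup>2 / (1 + ln (1 / \<epsilon>))\<^sup>2 * ball_measure M y r * real N))"
    using lower_deviation_ball by blast
  obtain k where D0: "0 \<le> D" and k: "0 < k" "\<And>\<delta>. 0 < \<delta> \<Longrightarrow> \<delta> \<le> scale \<Longrightarrow> k * \<delta> powr D \<le> min_ball \<delta>"
    using min_dimension unfolding D_def by blast
  obtain r1 where d0: "0 < d" and r1: "0 < r1" "\<And>r. 0 < r \<Longrightarrow> r < r1 \<Longrightarrow> max_ball r \<le> r powr (d / 2)"
    using max_dimension unfolding d_def by blast
  define \<delta>0 where "\<delta>0 = min scale (exp (- 1))"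
  have \<delta>0: "\<delta>0 \<in> {0<..<1}" using scale by (auto simp: \<delta>0_def)
  define C2 where "C2 = \<bar>ln (r1 / 2)\<bar> + 1 + 2 / d * (1 + \<bar>ln (8 / k)\<bar> + D)"
  have C2: "0 \<le> C2" unfolding C2_def using d0 D0 by (intro add_nonneg_nonneg mult_nonneg_nonneg) auto
  define C3 where "C3 = ln C + ln (3 * I_len + 1) + C2"
  have C3: "0 \<le> C3" unfolding C3_def using C C2 I_len(1) by (intro add_nonneg_nonneg) auto
  define C4 where "C4 = 16 * 2 powr D / (c * k)"
  have C4: "0 \<le> C4" unfolding C4_def using c k by simp
  define C5 where "C5 = 3 + (1 + C3) * C4"
  have C5: "0 < C5" unfolding C5_def using C3 C4 by (intro add_pos_nonneg mult_nonneg_nonneg) auto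
  have main: "(\<integral>\<^sup>+x. blanket_time f M \<epsilon> \<delta> x \<partial>M)
       \<le> ennreal (C5 * (1 + ln (1 / \<epsilon>)) ^ 3 / \<epsilon>\<^sup>2 * \<delta> powr (- D) * ln (1 / \<delta>))"
    if \<epsilon>: "\<epsilon> \<in> {0<..<1}" and \<delta>: "\<delta> \<in> {0<..<\<delta>0}" for \<epsilon> \<delta>
  proof -
    define L where "L = 1 + ln (1 / \<epsilon>)"
    define \<Lambda> where "\<Lambda> = ln (1 / \<delta>)"
    have \<delta>': "0 < \<delta>" "\<delta> \<le> scale" "\<delta> < 1" using \<delta> \<delta>0 by (auto simp: \<delta>0_def)
    have L: "1 \<le> L" using \<epsilon> by (simp add: L_def)
    have "ln \<delta> \<le> ln (exp (- 1))" using \<delta> by (intro ln_mono) (auto simp: \<delta>0_def)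
    hence \<Lambda>: "1 \<le> \<Lambda>" "ln \<delta> = - \<Lambda>" using \<delta>' by (auto simp: \<Lambda>_def ln_div)
    have LL: "1 \<le> L * \<Lambda>" "L \<le> L * \<Lambda>" "\<Lambda> \<le> L * \<Lambda>"
      using mult_mono[of 1 L 1 \<Lambda>] L \<Lambda> by auto
    define h where "h = \<epsilon> * k * \<delta> powr D / 8"
    have h: "0 < h" using \<epsilon> k \<delta>' by (simp add: h_def)
    \<comment> \<open>The measure need not be doubling, so a ball can gain most of its mass from a
        displacement of its centre that is small compared with \<open>\<delta>\<close>. The displacement is
        therefore chosen so that intervals of length \<open>\<tau>\<close> have measure at most \<open>h\<close>, small
        relative to the minimal \<open>\<delta>\<close>-ball. Only the logarithm of \<open>\<tau>\<close> matters, and \<open>\<tau>\<close> is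
        bounded below by a power of \<open>\<epsilon>\<close> and \<open>\<delta>\<close>, up to a constant.\<close>
    define \<tau> where "\<tau> = min (r1 / 2) (min \<delta> (h powr (2 / d)))"
    have \<tau>: "0 < \<tau>" "\<tau> < r1" "\<tau> \<le> \<delta>" "\<tau> < 1" "\<tau> \<le> h powr (2 / d)"
      using r1(1) \<delta>' h by (auto simp: \<tau>_def)
    have max\<tau>: "max_ball \<tau> \<le> h"
    proof -
      have "max_ball \<tau> \<le> \<tau> powr (d / 2)" by (rule r1(2)[OF \<tau>(1,2)])
      also have "\<dots> \<le> (h powr (2 / d)) powr (d / 2)" using \<tau> d0 by (intro powr_mono2) auto
      also have "\<dots> = h" using h d0 by (simp add: powr_powr)
      finally show ?thesis .
    qed
    have ln\<tau>: "- ln \<tau> \<le> C2 * (L * \<Lambda>)"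
    proof -
      have t1: "- ln (r1 / 2) \<le> \<bar>ln (r1 / 2)\<bar> * (L * \<Lambda>)"
        using mult_left_mono[OF LL(1), of "\<bar>ln (r1 / 2)\<bar>"] by linarith
      have t2: "- ln \<delta> \<le> 1 * (L * \<Lambda>)" using LL \<Lambda> by simp
      have "- ln h = ln (1 / \<epsilon>) + ln (8 / k) + D * \<Lambda>"
        using \<epsilon> k \<delta>' by (simp add: h_def ln_div ln_mult ln_powr \<Lambda>(2))
      also have "\<dots> \<le> 1 * (L * \<Lambda>) + \<bar>ln (8 / k)\<bar> * (L * \<Lambda>) + D * (L * \<Lambda>)"
      proof (intro add_mono mult_left_mono)
        show "ln (1 / \<epsilon>) \<le> 1 * (L * \<Lambda>)" using LL(2) by (simp add: L_def)
        show "ln (8 / k) \<le> \<bar>ln (8 / k)\<bar> * (L * \<Lambda>)"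
          using mult_left_mono[OF LL(1), of "\<bar>ln (8 / k)\<bar>"] by linarith
      qed (use LL D0 in auto)
      finally have "2 / d * (- ln h) \<le> 2 / d * ((1 + \<bar>ln (8 / k)\<bar> + D) * (L * \<Lambda>))"
        using d0 by (intro mult_left_mono) (auto simp: distrib_right)
      hence t3: "- ln (h powr (2 / d)) \<le> 2 / d * (1 + \<bar>ln (8 / k)\<bar> + D) * (L * \<Lambda>)"
        using h by (simp add: ln_powr mult_ac)
      have p: "0 \<le> 2 / d * (1 + \<bar>ln (8 / k)\<bar> + D) * (L * \<Lambda>)" "0 \<le> \<bar>ln (r1 / 2)\<bar> * (L * \<Lambda>)" "0 \<le> 1 * (L * \<Lambda>)"
        using d0 D0 LL by auto
      have e: "C2 * (L * \<Lambda>) = \<bar>ln (r1 / 2)\<bar> * (L * \<Lambda>) + 1 * (L * \<Lambda>) + 2 / d * (1 + \<bar>ln (8 / k)\<bar> + D) * (L * \<Lambda>)"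
        by (simp only: C2_def distrib_right)
      consider "\<tau> = r1 / 2" | "\<tau> = \<delta>" | "\<tau> = h powr (2 / d)" unfolding \<tau>_def min_def by metis
      thus ?thesis using t1 t2 t3 p unfolding e by cases (simp only:; linarith)+
    qed
    define \<rho> where "\<rho> = \<tau> / 3"
    have \<rho>: "0 < \<rho>" "3 * \<rho> = \<tau>" using \<tau> by (auto simp: \<rho>_def)
    obtain Y where Y: "finite Y" "Y \<subseteq> I" "real (card Y) \<le> I_len / \<rho> + 1"
      "\<And>y. y \<in> I \<Longrightarrow> \<exists>z\<in>Y. z \<le> y \<and> y < z + \<rho>" using grid[OF \<rho>(1)] by blast
    define G where "G N z = {x \<in> I. (\<Sum>i<N. indicat_real (ball z (\<delta> - \<rho>)) ((f ^^ i) x))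
        \<le> (1 - \<epsilon> / 2) * ball_measure M z (\<delta> - \<rho>) * real N}" for N z
    define Bad where "Bad N = (\<Union>z\<in>Y. G N z)" for N
    have Gs: "G N z \<in> sets M" for N z unfolding G_def by (rule ball_visits_sets)
    have Bads: "Bad N \<in> sets M" for N unfolding Bad_def using Gs Y(1) by auto
    \<comment> \<open>The constants \<open>16\<close> and \<open>2 powr D\<close> account for \<open>\<epsilon> / 2\<close> in place of \<open>\<epsilon>\<close> and for balls
        of radius at least \<open>\<delta> / 2\<close>.\<close>
    define \<gamma> where "\<gamma> = c * \<epsilon>\<^sup>2 * k * \<delta> powr D / (16 * L\<^sup>2 * 2 powr D)"
    have \<gamma>: "0 < \<gamma>" unfolding \<gamma>_def using c \<epsilon> k \<delta>' L by (intro divide_pos_pos mult_pos_pos) auto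
    define Q where "Q = C * (I_len / \<rho> + 1)"
    have Q: "1 \<le> Q" unfolding Q_def using mult_mono[of 1 C 1 "I_len / \<rho> + 1"] C I_len(1) \<rho> by simp
    have bad: "x \<in> Bad N" if N: "1 \<le> N" and x: "x \<in> I" and nb: "\<not> blanketed f M \<epsilon> \<delta> x N" for N x
    proof -
      obtain y where y: "y \<in> I"
        "1 / real N * (\<Sum>i<N. indicat_real (ball y \<delta>) ((f ^^ i) x)) < (1 - \<epsilon>) * ball_measure M y \<delta>"
        using nb unfolding blanketed_def full by (auto simp: not_le)
      obtain z where z: "z \<in> Y" "z \<le> y" "y < z + \<rho>" using Y(4)[OF y(1)] by blast
      note gb = grid_ball[OF z(2,3) \<rho>, of \<delta>]
      have "k * \<delta> powr D \<le> ball_measure M y \<delta>"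
        using k(2)[OF \<delta>'(1,2)] min_ball_le[OF y(1), of \<delta>] by simp
      hence "\<epsilon> / 4 * (k * \<delta> powr D) \<le> \<epsilon> / 4 * ball_measure M y \<delta>" using \<epsilon> by (intro mult_left_mono) auto
      moreover have "2 * max_ball \<tau> \<le> \<epsilon> / 4 * (k * \<delta> powr D)" using max\<tau> by (simp add: h_def)
      ultimately have low: "(1 - \<epsilon> / 4) * ball_measure M y \<delta> \<le> ball_measure M z (\<delta> - \<rho>)"
        using gb(1) by (simp add: left_diff_distrib)
      have "(\<Sum>i<N. indicat_real (ball z (\<delta> - \<rho>)) ((f ^^ i) x)) \<le> (\<Sum>i<N. indicat_real (ball y \<delta>) ((f ^^ i) x))"
        using gb(2) by (intro sum_mono) (auto simp: indicator_def)
      also have "\<dots> \<le> (1 - \<epsilon>) * ball_measure M y \<delta> * real N" using y(2) N by (simp add: field_simps)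
      also have "\<dots> \<le> (1 - \<epsilon> / 2) * ball_measure M z (\<delta> - \<rho>) * real N"
      proof (rule mult_right_mono)
        have "(1 - \<epsilon>) * ball_measure M y \<delta> \<le> ((1 - \<epsilon> / 2) * (1 - \<epsilon> / 4)) * ball_measure M y \<delta>"
        proof (intro mult_right_mono ball_measure_nonneg)
          have "(1 - \<epsilon> / 2) * (1 - \<epsilon> / 4) = 1 - \<epsilon> * 3 / 4 + \<epsilon> * \<epsilon> / 8" by (simp add: field_simps)
          moreover have "0 \<le> \<epsilon> * \<epsilon>" "0 < \<epsilon>" using \<epsilon> by auto
          ultimately show "1 - \<epsilon> \<le> (1 - \<epsilon> / 2) * (1 - \<epsilon> / 4)" by linarith
        qed
        also have "\<dots> = (1 - \<epsilon> / 2) * ((1 - \<epsilon> / 4) * ball_measure M y \<delta>)" by simp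
        also have "\<dots> \<le> (1 - \<epsilon> / 2) * ball_measure M z (\<delta> - \<rho>)" using low \<epsilon> by (intro mult_left_mono) auto
        finally show "(1 - \<epsilon>) * ball_measure M y \<delta> \<le> (1 - \<epsilon> / 2) * ball_measure M z (\<delta> - \<rho>)" .
      qed simp
      finally show ?thesis using x z(1) by (auto simp: Bad_def G_def)
    qed
    have PG: "measure M (G N z) \<le> C * exp (- (\<gamma> * real N))" if z: "z \<in> Y" for N z
    proof -
      define \<mu> where "\<mu> = ball_measure M z (\<delta> - \<rho>)"
      have zI: "z \<in> I" using z Y(2) by blast
      have "k * (\<delta> / 2) powr D \<le> min_ball (\<delta> / 2)" by (rule k(2)) (use \<delta>' in auto)
      also have "\<dots> \<le> ball_measure M z (\<delta> / 2)" by (rule min_ball_le[OF zI])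
      also have "\<dots> \<le> \<mu>" unfolding \<mu>_def by (rule ball_measure_mono) (use \<tau> in \<open>simp add: \<rho>_def\<close>)
      finally have \<mu>: "k * \<delta> powr D / 2 powr D \<le> \<mu>" using \<delta>' by (simp add: powr_divide)
      have \<mu>0: "0 < \<mu>" using \<mu> k(1) \<delta>' by (smt (verit) divide_pos_pos mult_pos_pos powr_gt_zero)
      have "measure M (G N z) \<le> C * exp (- (c * (\<epsilon> / 2)\<^sup>2 / (1 + ln (1 / (\<epsilon> / 2)))\<^sup>2 * \<mu> * real N))"
        unfolding G_def \<mu>_def by (rule dev) (use \<epsilon> \<mu>0 in \<open>auto simp: \<mu>_def\<close>)
      also have "\<dots> \<le> C * exp (- (\<gamma> * real N))"
      proof -
        have 1: "ln 2 \<le> (1::real)" using ln_le_minus_one[of "2::real"] by simp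
        define l0 l1 where "l0 = ln (1 / (\<epsilon> / 2))" and "l1 = ln (1 / \<epsilon>)"
        have 2: "l0 = ln 2 + l1" using \<epsilon> by (simp add: l0_def l1_def ln_div)
        have 3: "0 \<le> l1" "0 \<le> ln (2::real)" using \<epsilon> by (auto simp: l1_def)
        have l: "1 + ln (1 / (\<epsilon> / 2)) \<le> 2 * L"
          unfolding L_def l0_def[symmetric] l1_def[symmetric] using add_mono[OF 1 3(1)] 2 3(1) by simp
        have l2: "0 < 1 + ln (1 / (\<epsilon> / 2))" unfolding l0_def[symmetric] 2
          by (intro add_pos_nonneg add_nonneg_nonneg 3) simp
        have "\<gamma> = c * (\<epsilon> / 2)\<^sup>2 / (2 * L)\<^sup>2 * (k * \<delta> powr D / 2 powr D)"
          by (simp add: \<gamma>_def power2_eq_square)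
        also have "\<dots> \<le> c * (\<epsilon> / 2)\<^sup>2 / (1 + ln (1 / (\<epsilon> / 2)))\<^sup>2 * \<mu>"
        proof (rule mult_mono)
          show "c * (\<epsilon> / 2)\<^sup>2 / (2 * L)\<^sup>2 \<le> c * (\<epsilon> / 2)\<^sup>2 / (1 + ln (1 / (\<epsilon> / 2)))\<^sup>2"
            using l l2 c by (intro divide_left_mono power_mono mult_pos_pos) auto
        qed (use \<mu> c k in auto)
        finally have "\<gamma> * real N \<le> c * (\<epsilon> / 2)\<^sup>2 / (1 + ln (1 / (\<epsilon> / 2)))\<^sup>2 * \<mu> * real N" by (rule mult_right_mono) simp
        thus ?thesis using C by simp
      qed
      finally show ?thesis .
    qed
    have PB: "measure M (Bad N) \<le> Q * exp (- (\<gamma> * real N))" for N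
    proof -
      have "measure M (Bad N) \<le> (\<Sum>z\<in>Y. measure M (G N z))"
        unfolding Bad_def using Gs Y(1) by (intro measure_UNION_le) auto
      also have "\<dots> \<le> (\<Sum>z\<in>Y. C * exp (- (\<gamma> * real N)))" using PG by (intro sum_mono)
      also have "\<dots> = real (card Y) * (C * exp (- (\<gamma> * real N)))" by simp
      also have "\<dots> \<le> (I_len / \<rho> + 1) * (C * exp (- (\<gamma> * real N)))" using Y(3) C by (intro mult_right_mono) auto
      finally show ?thesis by (simp add: Q_def mult_ac)
    qed
    note sums = suminf_min_geometric[of "\<lambda>N. measure M (Bad N)", OF measure_nonneg prob_le_1 PB Q \<gamma>]
    have lnQ: "ln Q \<le> C3 * (L * \<Lambda>)"
    proof -
      have "I_len / \<rho> + 1 \<le> (3 * I_len + 1) / \<tau>" using \<tau> by (simp add: \<rho>_def field_simps)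
      hence "ln (I_len / \<rho> + 1) \<le> ln ((3 * I_len + 1) / \<tau>)" using I_len(1) \<rho> by (intro ln_mono) (auto intro: add_pos_pos)
      also have "\<dots> = ln (3 * I_len + 1) - ln \<tau>" using I_len(1) \<tau> by (simp add: ln_div)
      finally have "ln (I_len / \<rho> + 1) \<le> ln (3 * I_len + 1) - ln \<tau>" .
      moreover have "0 < I_len / \<rho> + 1" using I_len(1) \<rho> by (intro add_pos_pos) auto
      ultimately have "ln Q \<le> ln C + ln (3 * I_len + 1) - ln \<tau>"
        unfolding Q_def using C by (simp add: ln_mult)
      also have "\<dots> \<le> (ln C + ln (3 * I_len + 1)) * (L * \<Lambda>) + C2 * (L * \<Lambda>)"
        using ln\<tau> mult_left_mono[OF LL(1), of "ln C + ln (3 * I_len + 1)"] C I_len(1) by simp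
      finally show ?thesis by (simp add: C3_def algebra_simps)
    qed
    have bt: "blanket_time f M \<epsilon> \<delta> x \<le> 1 + (\<Sum>N. indicator (Bad N) x)" if "x \<in> space M" for x
      by (rule blanket_time_le_suminf) (use bad that in simp)
    have "(\<integral>\<^sup>+x. blanket_time f M \<epsilon> \<delta> x \<partial>M) \<le> (\<integral>\<^sup>+x. 1 + (\<Sum>N. indicator (Bad N) x) \<partial>M)"
      by (rule nn_integral_mono[OF bt])
    also have "\<dots> = 1 + (\<Sum>N. emeasure M (Bad N))"
      using Bads emeasure_space_1 by (simp add: nn_integral_add nn_integral_suminf)
    also have "(\<Sum>N. emeasure M (Bad N)) = ennreal (\<Sum>N. measure M (Bad N))"
      unfolding emeasure_eq_measure by (rule suminf_ennreal2[OF measure_nonneg sums(1)])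
    also have "1 + ennreal (\<Sum>N. measure M (Bad N)) = ennreal (1 + (\<Sum>N. measure M (Bad N)))"
      using suminf_nonneg[OF sums(1)] by simp
    also have "\<dots> \<le> ennreal (C5 * L ^ 3 / \<epsilon>\<^sup>2 * \<delta> powr (- D) * \<Lambda>)"
    proof (rule ennreal_leI)
      define R where "R = L\<^sup>2 / \<epsilon>\<^sup>2 * \<delta> powr (- D)"
      have R: "1 \<le> R"
      proof -
        have "1 \<le> L\<^sup>2" using L by (simp add: one_le_power)
        moreover have "\<epsilon>\<^sup>2 \<le> 1" using \<epsilon> by (simp add: power_le_one)
        ultimately have "1 \<le> L\<^sup>2 / \<epsilon>\<^sup>2" using \<epsilon> by (simp add: le_divide_eq)
        moreover have "1 \<le> \<delta> powr (- D)"
        proof -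
          have "\<delta> powr D \<le> 1 powr D" using \<delta>' D0 by (intro powr_mono2) auto
          thus ?thesis using \<delta>' by (simp add: powr_minus one_le_inverse_iff)
        qed
        ultimately show ?thesis unfolding R_def using mult_mono[of 1 "L\<^sup>2 / \<epsilon>\<^sup>2" 1 "\<delta> powr (- D)"] by simp
      qed
      have inv: "1 / \<gamma> = C4 * R"
        using c k \<epsilon> \<delta>' L by (simp add: \<gamma>_def C4_def R_def powr_minus field_simps)
      have "1 + (\<Sum>N. measure M (Bad N)) \<le> 3 + (1 + ln Q) * (1 / \<gamma>)" using sums(2) by simp
      also have "\<dots> \<le> 3 * (L * \<Lambda> * R) + ((1 + C3) * (L * \<Lambda>)) * (C4 * R)"
      proof (rule add_mono)
        have "1 * 1 \<le> (L * \<Lambda>) * R" using LL(1) R by (intro mult_mono) auto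
        thus "3 \<le> 3 * (L * \<Lambda> * R)" by simp
        have "1 + ln Q \<le> (1 + C3) * (L * \<Lambda>)" using lnQ LL(1) by (simp add: distrib_right)
        thus "(1 + ln Q) * (1 / \<gamma>) \<le> ((1 + C3) * (L * \<Lambda>)) * (C4 * R)"
          unfolding inv using C4 R by (intro mult_right_mono mult_nonneg_nonneg) auto
      qed
      also have "\<dots> = C5 * (L * \<Lambda> * R)" by (simp add: C5_def algebra_simps)
      also have "\<dots> = C5 * L ^ 3 / \<epsilon>\<^sup>2 * \<delta> powr (- D) * \<Lambda>"
        by (simp add: R_def power2_eq_square power3_eq_cube)
      finally show "1 + (\<Sum>N. measure M (Bad N)) \<le> C5 * L ^ 3 / \<epsilon>\<^sup>2 * \<delta> powr (- D) * \<Lambda>" .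
    qed
    finally show ?thesis by (simp add: L_def \<Lambda>_def)
  qed
  show ?thesis
    by (rule bexI[OF _ \<delta>0], rule exI[of _ C5]) (use C5 main D_def in simp)
qed

end

text \<open>
  The exponent \<open>1 / d\<close> is divided among the three logarithms.
\<close>

lemma log_cube_le_power:
  assumes d: "0 < (d::real)"
  shows "\<exists>C>0. \<forall>\<epsilon>\<in>{0<..<1}. (1 + ln (1 / \<epsilon>)) ^ 3 \<le> C * (1 / \<epsilon>) powr (1 / d)"
proof -
  define e where "e = 1 / (3 * d)"
  have e: "0 < e" using d by (simp add: e_def)
  have "(1 + ln (1 / \<epsilon>)) ^ 3 \<le> (1 + 1 / e) ^ 3 * (1 / \<epsilon>) powr (1 / d)" if \<epsilon>: "\<epsilon> \<in> {0<..<1}" for \<epsilon>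
  proof -
    define y where "y = (1 / \<epsilon>) powr e"
    have y1: "1 \<le> y" unfolding y_def using \<epsilon> e by (intro ge_one_powr_ge_zero) auto
    have "ln y \<le> y" using ln_le_minus_one[of y] y1 by simp
    moreover have "ln y = e * ln (1 / \<epsilon>)" using \<epsilon> by (simp add: y_def ln_powr)
    ultimately have "ln (1 / \<epsilon>) \<le> 1 / e * y" using e by (simp add: field_simps)
    hence "1 + ln (1 / \<epsilon>) \<le> (1 + 1 / e) * y" using y1 by (simp add: distrib_right)
    moreover have "0 \<le> 1 + ln (1 / \<epsilon>)" using \<epsilon> by (simp add: add_nonneg_nonneg)
    ultimately have "(1 + ln (1 / \<epsilon>)) ^ 3 \<le> ((1 + 1 / e) * y) ^ 3" by (intro power_mono)
    also have "\<dots> = (1 + 1 / e) ^ 3 * y ^ 3" by (rule power_mult_distrib)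
    also have "y ^ 3 = (1 / \<epsilon>) powr (1 / d)"
    proof -
      have "y ^ 3 = (1 / \<epsilon>) powr (e + e + e)" by (simp only: y_def power3_eq_cube powr_add)
      also have "e + e + e = 1 / d" using d by (simp add: e_def)
      finally show ?thesis .
    qed
    finally show ?thesis .
  qed
  thus ?thesis using e by (intro exI[of _ "(1 + 1 / e) ^ 3"]) (auto simp: add_pos_pos)
qed

theorem theorem1p3:
  fixes I :: "real set" and \<P> :: "real set set"
    and f \<phi> :: "real \<Rightarrow> real" and M :: "real measure"
    and d D :: real
  assumes "full_branch_map I \<P> f"
    and "bounded_distortion I \<P> f"
    and "\<forall>P\<in>\<P>. holder_on P \<phi>"
    and "has_pressure I f \<phi> 0"
    and "borel_probability_on I M"
    and "invariant_measure f M"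
    and "gibbs_measure I \<P> f \<phi> M"
    and "supp M = I"
    and "d = dim_max_ball M"
    and "D = dim_min_ball M"
  shows "\<exists>\<delta>\<^sub>0\<in>{0<..<1}. \<exists>K :: real \<Rightarrow> real.
           (\<forall>\<epsilon>\<in>{0<..<1}. \<forall>\<delta>\<in>{0<..<\<delta>\<^sub>0}.
              (\<integral>\<^sup>+x. blanket_time f M \<epsilon> \<delta> x \<partial>M)
                \<le> ennreal (K \<epsilon> * \<delta> powr (- D) * ln (1 / \<delta>))) \<and>
           (\<exists>C>0. \<forall>\<epsilon>\<in>{0<..<1}. \<bar>K \<epsilon>\<bar> \<le> C * \<bar>1 / \<epsilon> powr (2 + 1 / d)\<bar>)"
proof -
  interpret gibbs_interval I \<P> f \<phi> M by unfold_locales (fact assms)+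
  obtain \<delta>\<^sub>0 C where C: "\<delta>\<^sub>0 \<in> {0<..<1}" "0 < C" "\<And>\<epsilon> \<delta>. \<epsilon> \<in> {0<..<1} \<Longrightarrow> \<delta> \<in> {0<..<\<delta>\<^sub>0} \<Longrightarrow>
     (\<integral>\<^sup>+x. blanket_time f M \<epsilon> \<delta> x \<partial>M)
       \<le> ennreal (C * (1 + ln (1 / \<epsilon>)) ^ 3 / \<epsilon>\<^sup>2 * \<delta> powr (- D) * ln (1 / \<delta>))"
    using expected_blanket_time unfolding assms(10) by blast
  have "0 < d" using max_dimension unfolding assms(9) by blast
  then obtain C' where C': "0 < C'" "\<And>\<epsilon>. \<epsilon> \<in> {0<..<1} \<Longrightarrow> (1 + ln (1 / \<epsilon>)) ^ 3 \<le> C' * (1 / \<epsilon>) powr (1 / d)"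
    using log_cube_le_power by blast
  define K where "K \<epsilon> = C * (1 + ln (1 / \<epsilon>)) ^ 3 / \<epsilon>\<^sup>2" for \<epsilon>
  have "\<bar>K \<epsilon>\<bar> \<le> C * C' * \<bar>1 / \<epsilon> powr (2 + 1 / d)\<bar>" if \<epsilon>: "\<epsilon> \<in> {0<..<1}" for \<epsilon>
  proof -
    have "0 \<le> 1 + ln (1 / \<epsilon>)" using \<epsilon> by (simp add: add_nonneg_nonneg)
    hence "\<bar>K \<epsilon>\<bar> = C / \<epsilon>\<^sup>2 * (1 + ln (1 / \<epsilon>)) ^ 3" using C(2) by (simp add: K_def)
    also have "\<dots> \<le> C / \<epsilon>\<^sup>2 * (C' * (1 / \<epsilon>) powr (1 / d))"
      using C'(2)[OF \<epsilon>] C(2) by (intro mult_left_mono) auto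
    also have "\<dots> = C * C' * (1 / \<epsilon> powr (2 + 1 / d))"
      using \<epsilon> by (simp add: powr_add powr_divide powr_numeral)
    finally show ?thesis by simp
  qed
  moreover have "0 < C * C'" using C(2) C'(1) by simp
  ultimately have "\<exists>C>0. \<forall>\<epsilon>\<in>{0<..<1}. \<bar>K \<epsilon>\<bar> \<le> C * \<bar>1 / \<epsilon> powr (2 + 1 / d)\<bar>" by blast
  moreover have "\<forall>\<epsilon>\<in>{0<..<1}. \<forall>\<delta>\<in>{0<..<\<delta>\<^sub>0}.
      (\<integral>\<^sup>+x. blanket_time f M \<epsilon> \<delta> x \<partial>M) \<le> ennreal (K \<epsilon> * \<delta> powr (- D) * ln (1 / \<delta>))"
    using C(3) unfolding K_def by blast
  ultimately show ?thesis using C(1) by blast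
qed

end
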